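(* Let $0<p<1$. Suppose that $X=(X_t)_{t\ge 0}$ is an adapted supermartingale with only nonnegative jumps (i.e. $\Delta X_t\ge 0$ for all $t$), satisfying $X_0=0$ almost surely. Then $$\|X\|_p\le C_p\,\|M^-\|_p ,$$ and the constant $C_p$ is the best possible (it cannot be replaced by any smaller constant valid for all such $X$). It is already the best possible if $X$ is assumed to be a stopped Brownian motion, i.e. $X=(B_{\eta\wedge t})_{t\ge 0}$ for a standard one-dimensional Brownian motion $B$ started at $0$ and a stopping time $\eta$ of $B$.
   Context: Setting: $(\Omega,\mathcal F,\mathbb P)$ is a complete probability space with a filtration $(\mathcal F_t)_{t\ge 0}$ (a nondecreasing family of sub-$\sigma$-algebras of $\mathcal F$) such that $\mathcal F_0$ contains all events of probability $0$. All processes $X$ considered are adapted to this filtration and have right-continuous trajectories with left limits. $\Delta X_t=X_t-X_{t-}$ is the jump of $X$ at time $t$, with the convention $X_{0-}=0$. Infimum process: $M^-_t=\left(\inf_{0\le s\le t}X_s\right)\wedge 0$, where $a\wedge b=\min\{a,b\}$. For a process $Y=(Y_t)_{t\ge0}$, $\|Y\|_p=\sup_{t\ge 0}\left(\mathbb E|Y_t|^p\right)^{1/p}$. Constants: $p_0$ is the unique number in $(0,1)$ satisfying $p_0^{-1}-1=\left(p_0^{-1}-1\right)^{1-p_0}+1$ (numerically $p_0\simeq 0.1945$). If $p\in(0,p_0]$, then $C_p=\frac{1-p}{p}$. If $p\in(p_0,1)$, let $\alpha_p$ be the unique positive solution of $$(1-p)\left(\alpha_p^{1/(1-p)}+1\right)=\alpha_p+1,$$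 and set $C_p=\left(1+\alpha_p^{-1}\right)^{1/p}$. *)

theory Defs
  imports "HOL-Probability.Probability"
begin

section \<open>The constants\<close>

definition p0 :: real where
  "p0 = (THE p. 0 < p \<and> p < 1 \<and> 1 / p - 1 = (1 / p - 1) powr (1 - p) + 1)"

definition alpha_const :: "real \<Rightarrow> real" where
  "alpha_const p = (THE a. 0 < a \<and> (1 - p) * (a powr (1 / (1 - p)) + 1) = a + 1)"

definition C_const :: "real \<Rightarrow> real" where
  "C_const p = (if p \<le> p0 then (1 - p) / p else (1 + 1 / alpha_const p) powr (1 / p))"


section \<open>Processes\<close>

text \<open>A process is a function of type \<open>real \<Rightarrow> 'a \<Rightarrow> real\<close>, and a filtration is a function of type
  \<open>real \<Rightarrow> 'a measure\<close>. Only their values at times \<open>t \<ge> 0\<close> are ever referred to.\<close>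

locale complete_filtered_prob_space = prob_space M + complete_measure M
  for M :: "'a measure" +
  fixes F :: "real \<Rightarrow> 'a measure"
  assumes subalgebra_F: "0 \<le> t \<Longrightarrow> subalgebra M (F t)"
    and sets_F_mono: "0 \<le> s \<Longrightarrow> s \<le> t \<Longrightarrow> sets (F s) \<subseteq> sets (F t)"
    and null_sets_F: "null_sets M \<subseteq> sets (F 0)"

definition adapted :: "(real \<Rightarrow> 'a measure) \<Rightarrow> (real \<Rightarrow> 'a \<Rightarrow> real) \<Rightarrow> bool" where
  "adapted F X \<longleftrightarrow> (\<forall>t\<ge>0. X t \<in> borel_measurable (F t))"

definition supermartingale ::
  "'a measure \<Rightarrow> (real \<Rightarrow> 'a measure) \<Rightarrow> (real \<Rightarrow> 'a \<Rightarrow> real) \<Rightarrow> bool" where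
  "supermartingale M F X \<longleftrightarrow> adapted F X \<and> (\<forall>t\<ge>0. integrable M (X t)) \<and>
     (\<forall>s t. 0 \<le> s \<longrightarrow> s \<le> t \<longrightarrow> (AE \<omega> in M. real_cond_exp M (F s) (X t) \<omega> \<le> X s \<omega>))"

definition cadlag :: "(real \<Rightarrow> real) \<Rightarrow> bool" where
  "cadlag x \<longleftrightarrow> (\<forall>t\<ge>0. continuous (at_right t) x) \<and> (\<forall>t>0. \<exists>l. (x \<longlongrightarrow> l) (at_left t))"

text \<open>The convention \<open>x (0-) = 0\<close> makes the jump at time \<open>0\<close> equal to \<open>x 0\<close>.\<close>

definition jump :: "(real \<Rightarrow> real) \<Rightarrow> real \<Rightarrow> real" where
  "jump x t = x t - (if t = 0 then 0 else Lim (at_left t) x)"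

definition infimum_process :: "(real \<Rightarrow> 'a \<Rightarrow> real) \<Rightarrow> real \<Rightarrow> 'a \<Rightarrow> real" where
  "infimum_process X t \<omega> = min (INF s\<in>{0..t}. X s \<omega>) 0"

text \<open>Powers with real exponent \<open>a > 0\<close> on \<open>[0, \<infinity>]\<close>.\<close>

definition ennreal_powr :: "ennreal \<Rightarrow> real \<Rightarrow> ennreal" where
  "ennreal_powr x a = (if x = \<infinity> then \<infinity> else ennreal (enn2real x powr a))"

text \<open>The norm may be infinite.\<close>

definition process_norm :: "'a measure \<Rightarrow> real \<Rightarrow> (real \<Rightarrow> 'a \<Rightarrow> real) \<Rightarrow> ennreal" where
  "process_norm M p Y =
     (SUP t\<in>{0..}. ennreal_powr (\<integral>\<^sup>+ \<omega>. ennreal (\<bar>Y t \<omega>\<bar> powr p) \<partial>M) (1 / p))"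

definition supermartingale_nonneg_jumps ::
  "'a measure \<Rightarrow> (real \<Rightarrow> 'a measure) \<Rightarrow> (real \<Rightarrow> 'a \<Rightarrow> real) \<Rightarrow> bool" where
  "supermartingale_nonneg_jumps M F X \<longleftrightarrow>
     complete_filtered_prob_space M F \<and> supermartingale M F X \<and>
     (\<forall>\<omega>\<in>space M. cadlag (\<lambda>t. X t \<omega>)) \<and>
     (\<forall>\<omega>\<in>space M. \<forall>t\<ge>0. 0 \<le> jump (\<lambda>t. X t \<omega>) t) \<and>
     (AE \<omega> in M. X 0 \<omega> = 0)"


section \<open>Stopped Brownian motion\<close>

text \<open>In \<open>indep_increments\<close>, a monotone sequence \<open>\<tau>\<close> serves to enumerate the time points
  \<open>\<tau> 0 \<le> \<dots> \<le> \<tau> n\<close>.\<close>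

locale standard_brownian_motion = prob_space M for M :: "'a measure" +
  fixes B :: "real \<Rightarrow> 'a \<Rightarrow> real"
  assumes random_variable_B: "0 \<le> t \<Longrightarrow> B t \<in> borel_measurable M"
    and start: "\<omega> \<in> space M \<Longrightarrow> B 0 \<omega> = 0"
    and continuous_paths: "\<omega> \<in> space M \<Longrightarrow> continuous_on {0..} (\<lambda>t. B t \<omega>)"
    and indep_increments: "0 \<le> \<tau> 0 \<Longrightarrow> mono \<tau> \<Longrightarrow>
      indep_vars (\<lambda>_. borel) (\<lambda>i \<omega>. B (\<tau> (Suc i)) \<omega> - B (\<tau> i) \<omega>) {..<n :: nat}"
    and normal_increments: "0 \<le> s \<Longrightarrow> s < t \<Longrightarrow>
      distributed M lborel (\<lambda>\<omega>. B t \<omega> - B s \<omega>) (normal_density 0 (sqrt (t - s)))"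

text \<open>The filtration generated by \<open>B\<close>, augmented by the null sets.\<close>

definition natural_filtration ::
  "'a measure \<Rightarrow> (real \<Rightarrow> 'a \<Rightarrow> real) \<Rightarrow> real \<Rightarrow> 'a measure" where
  "natural_filtration M B t =
     sigma (space M) (null_sets M \<union> (\<Union>s\<in>{0..t}. {B s -` A \<inter> space M | A. A \<in> sets borel}))"

text \<open>The library's \<^const>\<open>stopping_time\<close> requires times to have the type of the index set of the
  filtration. Here the index set is \<open>[0, \<infinity>)\<close>, but a stopping time may be infinite.\<close>

definition ext_stopping_time :: "(real \<Rightarrow> 'a measure) \<Rightarrow> ('a \<Rightarrow> ennreal) \<Rightarrow> bool" where
  "ext_stopping_time F \<eta> \<longleftrightarrow> (\<forall>t\<ge>0. Measurable.pred (F t) (\<lambda>\<omega>. \<eta> \<omega> \<le> ennreal t))"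

definition stopped :: "(real \<Rightarrow> 'a \<Rightarrow> real) \<Rightarrow> ('a \<Rightarrow> ennreal) \<Rightarrow> real \<Rightarrow> 'a \<Rightarrow> real" where
  "stopped B \<eta> t \<omega> = B (enn2real (min (\<eta> \<omega>) (ennreal t))) \<omega>"

definition stopped_brownian_motion :: "'a measure \<Rightarrow> (real \<Rightarrow> 'a \<Rightarrow> real) \<Rightarrow> bool" where
  "stopped_brownian_motion M X \<longleftrightarrow> complete_measure M \<and>
     (\<exists>B \<eta>. standard_brownian_motion M B \<and>
       ext_stopping_time (natural_filtration M B) \<eta> \<and> X = stopped B \<eta>)"

end

theory Submission
  imports Defs "HOL-Real_Asymp.Real_Asymp"
begin

text \<open>The upper bound is Burkholder's method. For the payoff \<open>\<bar>x\<bar> powr p - D * m powr p\<close>, with \<open>m\<close> the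
  negative of the running infimum, a suitable majorant is \<open>m powr p * u (x / m)\<close>, where \<open>u\<close> is
  \<open>y powr p - D\<close> to the right of a contact point \<open>a\<close> and its tangent at \<open>a\<close> to the left of it.
  Stationarity in \<open>m\<close> at \<open>x = -m\<close> forces \<open>D = (1 - p) * a powr (p - 1) * (a + 1)\<close>, and
  minimising \<open>D\<close> over those \<open>a\<close> for which the majorant dominates the payoff at \<open>x = -m\<close> gives the two
  regimes of the constant. As a supermartingale with nonnegative jumps has a continuous running
  infimum, the majorant decreases in mean along time grids up to an error that vanishes with the mesh.

  For sharpness, Brownian motion is stopped when it first leaves \<open>(-1, a)\<close>, \<open>(-q, a * q)\<close>,
  \<open>(-q\<^sup>2, a * q\<^sup>2)\<close>, ... through the upper end. At that time the running infimum is at least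
  \<open>-1 / a\<close> times the value. The exit probabilities follow from the fact that the stopped values have
  mean zero. After finitely many stages with \<open>q\<close> close to \<open>1\<close> the ratio of the moments exceeds every
  number below \<open>C_const p powr p\<close>.

  Brownian motion is the Levy-Ciesielski series over independent standard normal variables. Its
  covariance is found by refining dyadic grids, and the independence of its increments is read off
  the joint characteristic function.\<close>


section \<open>The constants\<close>

text \<open>The majorant is linear in \<open>x\<close> between the current minimum and the contact
  point, so it loses nothing along a process that stays infinitesimally close to its minimum until
  it escapes to \<open>a\<close> times its modulus. The stages with ratio \<open>q\<close> imitate
  such a process, and for the optimal \<open>a\<close> their limiting ratio of moments, as
  \<open>q\<close> tends to 1, equals the constant of the upper bound.

  Stationarity in \<open>m\<close> holds only at \<open>x = - m\<close>, whereas between two grid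
  times the path may fall visibly below its old minimum. The error is this overshoot times the drop
  of \<open>m powr (p - 1)\<close>. Small overshoots telescope to \<open>d * e powr (p - 1)\<close>,
  where a floor \<open>e\<close> on \<open>m\<close> removes the singularity at
  \<open>m = 0\<close>. Large ones occur on an event that vanishes with the mesh. Since the negative
  part of a supermartingale is a submartingale, they can be charged to the final time, so domination
  by \<open>\<bar>X t\<bar>\<close> is enough and no integrability of a supremum over time
  enters.\<close>

lemma ln_diff_bound:
  fixes a :: real assumes "1 < a" shows "ln a - ln (a - 1) \<le> 1 / (a - 1)"
proof -
  have "ln a - ln (a - 1) = ln (1 + 1 / (a - 1))"
    using assms ln_div[of a "a - 1"] by (simp add: field_simps)
  also have "\<dots> \<le> 1 / (a - 1)"
    using assms by (intro ln_add_one_self_le_self) auto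
  finally show ?thesis .
qed

text \<open>The equation of \<open>p0\<close> in the variable \<open>a = 1 / p - 1\<close>, for
  which \<open>1 - p = a / (1 + a)\<close>: take logarithms in \<open>a - 1 = a powr (1 - p)\<close>
  and clear the denominator. In this form monotonicity, and with it uniqueness of the root, is
  visible.\<close>

definition crit :: "real \<Rightarrow> real" where
  "crit a = (1 + a) * ln (a - 1) - a * ln a"

lemma crit_deriv:
  assumes "1 < a"
  shows "(crit has_real_derivative (ln (a - 1) - ln a + 2 / (a - 1))) (at a)"
  unfolding crit_def using assms
  by (auto intro!: derivative_eq_intros simp: field_simps)

lemma crit_strict_mono:
  assumes "1 < a" "a < b" shows "crit a < crit b"
proof (rule DERIV_pos_imp_increasing[OF assms(2)])
  fix x assume x: "a \<le> x" "x \<le> b"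
  have "0 < ln (x - 1) - ln x + 2 / (x - 1)"
  proof -
    have "0 < 1 / (x - 1)" using x assms by simp
    moreover have "2 / (x - 1) = 1 / (x - 1) + 1 / (x - 1)" by simp
    ultimately show ?thesis using ln_diff_bound[of x] x assms by linarith
  qed
  then show "\<exists>y. (crit has_real_derivative y) (at x) \<and> 0 < y"
    using crit_deriv[of x] x assms by auto
qed

lemma crit_root: "\<exists>a>1. crit a = 0"
proof -
  have e3: "6 \<le> exp (3::real)"
    using exp_lower_Taylor_quadratic[of "3::real"] by (simp add: power2_eq_square)
  have "crit 2 \<le> 0" by (simp add: crit_def)
  moreover have "0 \<le> crit (exp 3)"
  proof -
    \<comment> \<open>At \<open>exp 3\<close> the logarithm is exactly 3, and
      \<open>ln_diff_bound\<close> leaves \<open>3 - (1 + a) / (a - 1)\<close>, which is nonnegative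
      once \<open>a\<close> is at least 2.\<close>
    let ?a = "exp (3::real)"
    have 1: "ln (?a - 1) \<ge> 3 - 1 / (?a - 1)" using ln_diff_bound[of ?a] e3 by simp
    have "(1 + ?a) * ln (?a - 1) \<ge> (1 + ?a) * (3 - 1 / (?a - 1))"
      using 1 by (intro mult_left_mono) (auto intro: add_nonneg_nonneg)
    moreover have "(1 + ?a) * (3 - 1 / (?a - 1)) - ?a * 3 = 3 - (1 + ?a) / (?a - 1)"
      by (simp add: field_simps)
    moreover have "(1 + ?a) / (?a - 1) \<le> 3" using e3 by (simp add: field_simps)
    ultimately show ?thesis by (simp add: crit_def)
  qed
  moreover have "continuous_on {2..exp 3} crit"
    by (intro continuous_at_imp_continuous_on ballI DERIV_isCont[OF crit_deriv]) auto
  moreover have "(2::real) \<le> exp 3" using e3 by simp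
  ultimately obtain x where "2 \<le> x" "x \<le> exp 3" "crit x = 0"
    using IVT'[of crit 2 0 "exp 3"] by auto
  then show ?thesis by (intro exI[of _ x]) auto
qed

text \<open>Monotonicity and injectivity of \<open>ln\<close>, applied to \<open>a - 1\<close> and
  \<open>a powr (1 - p)\<close>. The conjunct \<open>1 < a\<close> keeps \<open>ln (a - 1)\<close>
  away from arguments where \<open>ln\<close> has only a default value.\<close>

lemma crit_iff:
  assumes p: "0 < p" "p < 1" and a: "a = 1 / p - 1"
  shows "a powr (1 - p) + 1 \<le> a \<longleftrightarrow> 1 < a \<and> 0 \<le> crit a"
    and "a = a powr (1 - p) + 1 \<longleftrightarrow> 1 < a \<and> crit a = 0"
proof -
  have a0: "0 < a" using p a by simp
  have "(1 - p) * (1 + a) = a" using p a by (simp add: field_simps)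
  then have e: "1 - p = a / (1 + a)" using a0 by (simp add: eq_divide_eq)
  have pos: "0 < a powr (1 - p)" using a0 by simp
  have l: "crit a = (1 + a) * (ln (a - 1) - ln (a powr (1 - p)))"
    using a0 unfolding crit_def e by (simp add: ln_powr field_simps)
  have s: "0 \<le> crit a \<longleftrightarrow> ln (a powr (1 - p)) \<le> ln (a - 1)" "crit a = 0 \<longleftrightarrow> ln (a powr (1 - p)) = ln (a - 1)"
    unfolding l using a0 by (auto simp: zero_le_mult_iff)
  show "a powr (1 - p) + 1 \<le> a \<longleftrightarrow> 1 < a \<and> 0 \<le> crit a"
    using pos s(1) ln_le_cancel_iff[of "a powr (1 - p)" "a - 1"] by (smt (verit))
  show "a = a powr (1 - p) + 1 \<longleftrightarrow> 1 < a \<and> crit a = 0"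
    using pos s(2) ln_inj_iff[of "a powr (1 - p)" "a - 1"] by (smt (verit))
qed

text \<open>The map from \<open>p\<close> to \<open>1 / p - 1\<close> is decreasing, so
  \<open>p <= p0\<close> says that \<open>1 / p - 1\<close> lies at or beyond the root of
  \<open>crit\<close>. The right-hand side is, up to a power of \<open>1 / p - 1\<close>, the
  admissibility of the contact point \<open>(1 - p) / p\<close>.\<close>

lemma le_p0_iff:
  assumes p: "0 < p" "p < 1"
  shows "p \<le> p0 \<longleftrightarrow> (1 / p - 1) powr (1 - p) + 1 \<le> 1 / p - 1"
proof -
  obtain b where b: "1 < b" "crit b = 0" using crit_root by auto
  define r where "r = 1 / (1 + b)"
  have r: "0 < r" "r < 1" "1 / r - 1 = b" using b by (auto simp: r_def field_simps)
  have "p0 = r" unfolding p0_def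
  proof (rule the_equality)
    show "0 < r \<and> r < 1 \<and> 1 / r - 1 = (1 / r - 1) powr (1 - r) + 1"
      using crit_iff(2)[OF r(1,2) refl] r b by simp
  next
    fix x :: real assume x: "0 < x \<and> x < 1 \<and> 1 / x - 1 = (1 / x - 1) powr (1 - x) + 1"
    then have "1 < 1 / x - 1" "crit (1 / x - 1) = 0"
      using crit_iff(2)[of x "1 / x - 1"] by auto
    then have "1 / x - 1 = b" using crit_strict_mono[of b "1 / x - 1"] crit_strict_mono[of "1 / x - 1" b] b
      by (cases "1 / x - 1" b rule: linorder_cases) auto
    then show "x = r" using x b by (auto simp: r_def field_simps)
  qed
  have "p \<le> r \<longleftrightarrow> b \<le> 1 / p - 1" using p b by (auto simp: r_def field_simps)
  also have "\<dots> \<longleftrightarrow> 1 < 1 / p - 1 \<and> 0 \<le> crit (1 / p - 1)"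
    using crit_strict_mono[of b "1 / p - 1"] crit_strict_mono[of "1 / p - 1" b] b by fastforce
  finally show ?thesis using crit_iff(1)[OF p refl] \<open>p0 = r\<close> by simp
qed

section \<open>The parameter \<open>alpha_const\<close>\<close>

text \<open>The difference \<open>f\<close> of the two sides is negative on \<open>(0, 1]\<close>
  and strictly increasing from 1 on, since its derivative
  \<open>x powr (1 / (1 - p) - 1) - 1\<close> changes sign at 1. Hence there is exactly one positive
  root, and it lies beyond 1.\<close>

lemma alpha_const_props:
  assumes p: "0 < p" "p < 1"
  shows "0 < alpha_const p" "(1 - p) * (alpha_const p powr (1 / (1 - p)) + 1) = alpha_const p + 1"
proof -
  define f where "f x = (1 - p) * (x powr (1 / (1 - p)) + 1) - (x + 1)" for x
  have d: "(f has_real_derivative (x powr (1 / (1 - p) - 1) - 1)) (at x)" if "0 < x" for x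
    unfolding f_def using that p by (auto intro!: derivative_eq_intros simp: powr_diff)
  have r: "1 / (1 - p) - 1 > 0" using p by (simp add: field_simps)
  have neg: "f x < 0" if "0 < x" "x \<le> 1" for x
  proof -
    have "x powr (1 / (1 - p)) \<le> x powr 1" using that p by (intro powr_mono') (auto simp: field_simps)
    then have "(1 - p) * (x powr (1 / (1 - p)) + 1) \<le> (1 - p) * (x + 1)"
      using p that by (intro mult_left_mono) auto
    also have "\<dots> < x + 1" using p that by (simp add: field_simps add_pos_pos)
    finally show ?thesis by (simp add: f_def)
  qed
  have mono: "f x < f y" if "1 \<le> x" "x < y" for x y
  proof (rule DERIV_pos_imp_increasing_open[OF that(2)])
    fix z assume z: "x < z" "z < y"
    have "1 powr (1 / (1 - p) - 1) < z powr (1 / (1 - p) - 1)"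
      using z that r by (intro powr_less_mono2) auto
    then show "\<exists>w. (f has_real_derivative w) (at z) \<and> 0 < w" using d[of z] z that by auto
  next
    show "continuous_on {x..y} f"
      by (intro continuous_at_imp_continuous_on ballI DERIV_isCont[OF d]) (use that in auto)
  qed
  have uniq: "x = y" if "0 < x" "f x = 0" "0 < y" "f y = 0" for x y
    using neg[of x] neg[of y] mono[of x y] mono[of y x] that by (smt (verit))
  have ex: "\<exists>x>0. f x = 0"
  proof -
    \<comment> \<open>Chosen so that \<open>(1 - p) * N powr (1 / (1 - p)) = 2 * N\<close>, whence
      \<open>f N = N - p\<close> is nonnegative.\<close>
    define N where "N = (2 / (1 - p)) powr (1 / (1 / (1 - p) - 1))"
    have N1: "1 \<le> N" unfolding N_def using r p by (intro ge_one_powr_ge_zero) (auto simp: field_simps)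
    have "N powr (1 / (1 - p) - 1) = 2 / (1 - p)"
      unfolding N_def using r p by (simp add: powr_powr)
    moreover have "N powr (1 / (1 - p)) = N * N powr (1 / (1 - p) - 1)"
      using N1 powr_add[of N 1 "1 / (1 - p) - 1"] by simp
    ultimately have "(1 - p) * N powr (1 / (1 - p)) = 2 * N" using p by simp
    then have N: "0 \<le> f N" using N1 p by (simp add: f_def algebra_simps)
    have "continuous_on {1..N} f"
      by (intro continuous_at_imp_continuous_on ballI DERIV_isCont[OF d]) auto
    then obtain x where "1 \<le> x" "x \<le> N" "f x = 0"
      using IVT'[of f 1 0 N] neg[of 1] N N1 by auto
    then show ?thesis by (intro exI[of _ x]) auto
  qed
  then obtain x where x: "0 < x" "f x = 0" by auto
  have "0 < alpha_const p \<and> (1 - p) * (alpha_const p powr (1 / (1 - p)) + 1) = alpha_const p + 1"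
    unfolding alpha_const_def
  proof (rule theI[where a = x])
    show "0 < x \<and> (1 - p) * (x powr (1 / (1 - p)) + 1) = x + 1"
      using x(1) x(2)[unfolded f_def] by simp
    fix y assume "0 < y \<and> (1 - p) * (y powr (1 / (1 - p)) + 1) = y + 1"
    then have "0 < y" "f y = 0" unfolding f_def by simp_all
    then show "y = x" using uniq x by blast
  qed
  then show "0 < alpha_const p" "(1 - p) * (alpha_const p powr (1 / (1 - p)) + 1) = alpha_const p + 1"
    by auto
qed

section \<open>Admissible contact points and the value of the constant\<close>

text \<open>The expression is the value at \<open>-1\<close> of the tangent to the power function at
  \<open>a\<close>. The majorant dominates the payoff at the minimum if this value is at least 1, so
  by monotonicity the admissible \<open>a\<close> form a half-line.\<close>

lemma bellman_cond_strict_mono: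
  fixes p :: real
  assumes p: "0 < p" "p < 1" and "0 < a" "a < b"
  shows "(1 - p) * a powr p - p * a powr (p - 1) < (1 - p) * b powr p - p * b powr (p - 1)"
proof -
  have "a powr p < b powr p" using assms by (intro powr_less_mono2) auto
  moreover have "b powr (p - 1) < a powr (p - 1)" using assms by (intro powr_less_mono2_neg) auto
  ultimately show ?thesis using p by (intro diff_strict_mono mult_strict_left_mono) auto
qed

text \<open>As a function of \<open>a\<close>, \<open>(1 - p) * a powr (p - 1) * (a + 1)\<close> is
  smallest at \<open>(1 - p) / p\<close>. For \<open>p <= p0\<close> this point is admissible, so
  the constant is the unconstrained minimum.\<close>

lemma C_const_small:
  assumes p: "0 < p" "p < 1" and "p \<le> p0" and a: "a = (1 - p) / p"
  shows "0 < a" "C_const p = a" "a powr p = (1 - p) * a powr (p - 1) * (a + 1)"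
    "1 \<le> (1 - p) * a powr p - p * a powr (p - 1)"
proof -
  show a0: "0 < a" using p a by simp
  show "C_const p = a" using assms by (simp add: C_const_def)
  have s: "a powr p = a * a powr (p - 1)" using a0 by (simp add: powr_diff)
  have e: "a = (1 - p) * (a + 1)" using p a by (simp add: field_simps)
  show "a powr p = (1 - p) * a powr (p - 1) * (a + 1)"
    unfolding s by (subst e) (simp add: algebra_simps)
  have "a powr (1 - p) + 1 \<le> a"
    using le_p0_iff[OF p] \<open>p \<le> p0\<close> a p by (simp add: diff_divide_distrib)
  then have "a powr (1 - p) * a powr (p - 1) \<le> (a - 1) * a powr (p - 1)"
    by (intro mult_right_mono) auto
  moreover have "a powr (1 - p) * a powr (p - 1) = 1" using a0 by (simp flip: powr_add)
  moreover have "a - 1 = (1 - p) * a - p" using p a by (simp add: field_simps)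
  ultimately have "1 \<le> ((1 - p) * a - p) * a powr (p - 1)" by (simp only:)
  then show "1 \<le> (1 - p) * a powr p - p * a powr (p - 1)"
    unfolding s by (simp add: algebra_simps)
qed

text \<open>Beyond \<open>p0\<close> the unconstrained minimiser is not admissible, so the best
  \<open>a\<close> turns the admissibility condition into an equality. Multiplied by
  \<open>a powr (1 - p)\<close>, that equality is the defining equation of
  \<open>alpha_const p = a powr (1 - p)\<close>.\<close>

lemma C_const_large:
  assumes p: "0 < p" "p < 1" and "p0 < p" and a: "a = alpha_const p powr (1 / (1 - p))"
  shows "0 < a" "0 < C_const p" "C_const p powr p = (1 - p) * a powr (p - 1) * (a + 1)"
    "(1 - p) * a powr p - p * a powr (p - 1) = 1" "(1 - p) / p < a"
    "C_const p powr p = 1 + a powr (p - 1)"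
proof -
  note al = alpha_const_props[OF p]
  show a0: "0 < a" using al a by simp
  have ap: "a powr (1 - p) = alpha_const p" using al p a by (simp add: powr_powr)
  have inv: "a powr (p - 1) = 1 / alpha_const p"
    unfolding ap[symmetric] by (metis minus_diff_eq powr_minus_divide)
  have C: "C_const p = (1 + 1 / alpha_const p) powr (1 / p)" using assms by (simp add: C_const_def)
  have "0 < 1 + 1 / alpha_const p" using al by (simp add: add_pos_pos)
  then show "0 < C_const p" unfolding C by simp
  have Cp: "C_const p powr p = 1 + 1 / alpha_const p"
    unfolding C using al p by (simp add: powr_powr add_nonneg_nonneg)
  then show "C_const p powr p = 1 + a powr (p - 1)" by (simp add: inv)
  have eq: "(1 - p) * (a + 1) = alpha_const p + 1" using al a by simp
  have "(1 - p) * a powr (p - 1) * (a + 1) = (alpha_const p + 1) * (1 / alpha_const p)"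
    unfolding inv eq[symmetric] by simp
  also have "\<dots> = 1 + 1 / alpha_const p" using al by (simp add: field_simps)
  finally show "C_const p powr p = (1 - p) * a powr (p - 1) * (a + 1)" using Cp by simp
  have s: "x powr p = x * x powr (p - 1)" if "0 < x" for x using that by (simp add: powr_diff)
  have "(1 - p) * a - p = alpha_const p" using eq by (simp add: algebra_simps)
  then have "((1 - p) * a - p) * a powr (p - 1) = 1" unfolding inv using al by simp
  then show one: "(1 - p) * a powr p - p * a powr (p - 1) = 1"
    unfolding s[OF a0] by algebra
  \<comment> \<open>The unconstrained minimiser violates the admissibility condition, so by
    monotonicity it lies to the left of \<open>a\<close>.\<close>
  define b where "b = (1 - p) / p"
  have b0: "0 < b" using p by (simp add: b_def)
  have "\<not> b powr (1 - p) + 1 \<le> b"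
    using le_p0_iff[OF p] \<open>p0 < p\<close> p by (simp add: diff_divide_distrib b_def)
  then have "(b - 1) * b powr (p - 1) < b powr (1 - p) * b powr (p - 1)"
    using b0 by (intro mult_strict_right_mono) auto
  moreover have "b powr (1 - p) * b powr (p - 1) = 1" using b0 by (simp flip: powr_add)
  moreover have "b - 1 = (1 - p) * b - p" using p by (simp add: b_def field_simps)
  ultimately have "((1 - p) * b - p) * b powr (p - 1) < 1" by (simp only:)
  then have "(1 - p) * b powr p - p * b powr (p - 1) < 1"
    unfolding s[OF b0] by (simp add: algebra_simps)
  then have "\<not> a \<le> b" using bellman_cond_strict_mono[OF p a0, of b] one by (smt (verit))
  then show "(1 - p) / p < a" by (simp add: b_def)
qed

lemma bellman_parameter:
  assumes p: "0 < p" "p < 1"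
  obtains a where "0 < a" "0 < C_const p" "C_const p powr p = (1 - p) * a powr (p - 1) * (a + 1)"
    "1 \<le> (1 - p) * a powr p - p * a powr (p - 1)"
proof (cases "p \<le> p0")
  case True
  note C = C_const_small[OF p True refl]
  show thesis by (rule that[OF C(1) _ _ C(4)]) (unfold C(2), rule C(1), rule C(3))
next
  case False
  then have "p0 < p" by simp
  note C = C_const_large[OF p this refl]
  show thesis by (rule that[OF C(1-3) eq_refl[OF C(4)[symmetric]]])
qed

section \<open>Parameters of nearly extremal stopping rules\<close>

text \<open>The bound on \<open>c powr p\<close> is the limiting ratio of the moments of the value
  and of the infimum, as the number of stages grows and \<open>q\<close> tends to 1. At the contact
  point of the upper bound it equals \<open>C_const p powr p\<close> in both regimes. The condition
  \<open>1 < p * (a + 1)\<close> is what lets the contributions of the stages grow.\<close>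

lemma extremal_parameter:
  assumes p: "0 < p" "p < 1" and c: "0 \<le> c" "c < C_const p"
  obtains a where "0 < a" "1 < p * (a + 1)" "c powr p < 1 + (a powr p - 1) / (p * (a + 1))"
proof (cases "p \<le> p0")
  case True
  define b where "b = (1 - p) / p"
  note b = C_const_small[OF p True b_def]
  define f where "f a = 1 + (a powr p - 1) / (p * (a + 1))" for a
  have "isCont f b" unfolding f_def using b(1) p by (intro continuous_intros) auto
  moreover have pb: "p * (b + 1) = 1" using p by (simp add: b_def field_simps)
  then have "f b = b powr p" by (simp add: f_def)
  moreover have "c powr p < b powr p" using b c p by (intro powr_less_mono2) auto
  ultimately have "eventually (\<lambda>x. c powr p < f x) (at b)"
    by (metis continuous_at order_tendstoD(1))
  \<comment> \<open>At \<open>b\<close> itself \<open>p * (b + 1) = 1\<close>, so \<open>a\<close>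
    has to be taken strictly to the right of \<open>b\<close>, and continuity keeps the
    estimate.\<close>
  then have "eventually (\<lambda>x. c powr p < f x) (at_right b)"
    by (simp add: eventually_at_split)
  moreover have "eventually (\<lambda>x. b < x) (at_right b)" by (simp add: eventually_at_right_less)
  ultimately have "eventually (\<lambda>x. c powr p < f x \<and> b < x) (at_right b)" by eventually_elim auto
  then obtain a where a: "c powr p < f a" "b < a"
    by (metis (mono_tags, lifting) eventually_happens trivial_limit_at_right_real)
  have "1 < p * (a + 1)" using a p pb by (smt (verit) mult_strict_left_mono)
  with a b show thesis by (intro that[of a]) (auto simp: f_def)
next
  case False
  define a where "a = alpha_const p powr (1 / (1 - p))"
  have "p0 < p" using False by simp
  note a = C_const_large[OF p this a_def]
  note a0 = a(1) and ab = a(5)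
  have "a powr p - 1 = a powr (p - 1) * (p * (a + 1))"
    using a(4) a0 by (simp add: powr_diff field_simps)
  moreover have pa: "p * (a + 1) > 1" using ab p by (simp add: field_simps)
  ultimately have "1 + (a powr p - 1) / (p * (a + 1)) = C_const p powr p"
    using a(6) a0 p by simp
  moreover have "c powr p < C_const p powr p" using c p by (intro powr_less_mono2) auto
  ultimately have "c powr p < 1 + (a powr p - 1) / (p * (a + 1))" by argo
  with a0 pa show thesis by (rule that)
qed

text \<open>Both expressions that have to be positive vanish at \<open>q = 1\<close> and have
  positive derivative there. The first inequality keeps the weighted probability of a lower exit
  from shrinking, the second makes every stage a gain.\<close>

lemma extremal_ratio:
  fixes p d a :: real
  assumes "0 < p" "p < 1" "0 < a" "1 < p * (a + 1)" "d < 1 + (a powr p - 1) / (p * (a + 1))"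
  obtains q where "1 < q" "q * (a + 1) < q powr p * (a * q + 1)"
    "0 < (a powr p - d) * (q powr p * (q - 1)) + (1 - d) * (q powr p * (a * q + 1) - q * (a + 1))"
proof -
  define g where "g q = q powr p * (a * q + 1) - q * (a + 1)" for q
  define G where "G q = (a powr p - d) * (q powr p * (q - 1)) + (1 - d) * g q" for q
  have g': "(g has_real_derivative (p * (a + 1) - 1)) (at 1)"
    unfolding g_def by (auto intro!: derivative_eq_intros simp: algebra_simps)
  have "(G has_real_derivative ((a powr p - d) + (1 - d) * (p * (a + 1) - 1))) (at 1)"
    unfolding G_def by (auto intro!: derivative_eq_intros g')
  moreover have "0 < (a powr p - d) + (1 - d) * (p * (a + 1) - 1)"
  proof -
    have "(d - 1) * (p * (a + 1)) < a powr p - 1"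
      using assms by (smt (verit) pos_less_divide_eq)
    then show ?thesis by (simp add: algebra_simps)
  qed
  ultimately obtain e1 where e1: "e1 > 0" "\<And>h. 0 < h \<Longrightarrow> h < e1 \<Longrightarrow> G 1 < G (1 + h)"
    using DERIV_pos_inc_right by blast
  obtain e2 where e2: "e2 > 0" "\<And>h. 0 < h \<Longrightarrow> h < e2 \<Longrightarrow> g 1 < g (1 + h)"
    using DERIV_pos_inc_right[OF g'] assms by auto
  define h where "h = min e1 e2 / 2"
  have h: "0 < h" "h < e1" "h < e2" using e1 e2 by (auto simp: h_def min_def)
  show thesis
    by (rule that[of "1 + h"]) (use h e1(2)[of h] e2(2)[of h] in \<open>auto simp: G_def g_def\<close>)
qed


section \<open>The majorant\<close>

text \<open>Young's inequality for \<open>x powr p * c powr (1 - p)\<close>, divided by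
  \<open>c powr (1 - p)\<close>.\<close>

lemma powr_le_tangent:
  fixes x c p :: real
  assumes p: "0 < p" "p < 1" and "0 \<le> x" "0 < c"
  shows "x powr p \<le> c powr p + p * c powr (p - 1) * (x - c)"
proof (cases "x = 0")
  case True
  have "p * c powr (p - 1) * (0 - c) = - (p * c powr p)" using assms by (simp add: powr_diff)
  moreover have "p * c powr p \<le> c powr p" using p by (simp add: mult_left_le_one_le)
  ultimately show ?thesis using True by (simp only: diff_0 mult_minus_right) simp
next
  case False
  then have "x powr p * c powr (1 - p) \<le> p * x + (1 - p) * c"
    using assms by (intro Youngs_inequality_0) auto
  then have "x powr p * c powr (1 - p) * c powr (p - 1) \<le> (p * x + (1 - p) * c) * c powr (p - 1)"
    by (intro mult_right_mono) auto
  moreover have "c powr (1 - p) * c powr (p - 1) = 1" using assms by (simp flip: powr_add)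
  moreover have "c powr p = c * c powr (p - 1)" using assms by (simp add: powr_diff)
  ultimately show ?thesis by (simp add: algebra_simps)
qed

text \<open>The function \<open>z \<mapsto> z powr p\<close>, replaced to the left of \<open>b\<close> by its tangent at \<open>b\<close>.\<close>

definition tangent_ext :: "real \<Rightarrow> real \<Rightarrow> real \<Rightarrow> real" where
  "tangent_ext p b x = max x b powr p + p * max x b powr (p - 1) * (x - max x b)"

text \<open>Concavity with an explicit slope. The slope is nonnegative and at most
  \<open>p * b powr (p - 1)\<close>, so it is a legitimate weight for a supermartingale
  increment.\<close>

lemma tangent_ext_concave:
  assumes p: "0 < p" "p < 1" and b: "0 < b"
  shows "tangent_ext p b x' \<le> tangent_ext p b x + p * max x b powr (p - 1) * (x' - x)"
proof -
  define c c' where "c = max x b" and "c' = max x' b"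
  have c: "0 < c" "0 < c'" using b by (auto simp: c_def c'_def)
  have "p * c' powr (p - 1) * (x' - c') \<le> p * c powr (p - 1) * (x' - c')"
  proof (cases "x' < c'")
    case True
    then have "c powr (p - 1) \<le> c' powr (p - 1)"
      using b p by (intro powr_mono2') (auto simp: c_def c'_def)
    then show ?thesis using True p by (intro mult_right_mono_neg mult_left_mono) auto
  qed (auto simp: c'_def)
  moreover have "c' powr p \<le> c powr p + p * c powr (p - 1) * (c' - c)"
    using c by (intro powr_le_tangent p) auto
  ultimately show ?thesis
    unfolding tangent_ext_def c_def[symmetric] c'_def[symmetric] by (simp add: algebra_simps)
qed

text \<open>The majorant of the Burkholder method for the payoff \<open>\<bar>x\<bar> powr p - D * m powr p\<close>, where
  \<open>-m\<close> is the current minimum. The value of \<open>D\<close> makes its \<open>m\<close>-derivative vanish at \<open>x = -m\<close>.\<close>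

definition majorant :: "real \<Rightarrow> real \<Rightarrow> real \<Rightarrow> real \<Rightarrow> real" where
  "majorant p a x m =
     tangent_ext p (a * m) x - (1 - p) * a powr (p - 1) * (a + 1) * m powr p"

text \<open>To the right of 0 a tangent lies above the power. Left of 0 the majorant is linear with
  positive slope while \<open>\<bar>x\<bar> powr p <= m powr p\<close>, so the worst point is
  \<open>x = - m\<close>, and there the claim is the condition on \<open>a\<close> scaled by
  \<open>m powr p\<close>.\<close>

lemma majorant_ge:
  assumes p: "0 < p" "p < 1" and a: "0 < a" "1 \<le> (1 - p) * a powr p - p * a powr (p - 1)"
    and m: "0 < m" "- m \<le> x"
  shows "\<bar>x\<bar> powr p - (1 - p) * a powr (p - 1) * (a + 1) * m powr p \<le> majorant p a x m"
proof -
  have "\<bar>x\<bar> powr p \<le> tangent_ext p (a * m) x"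
  proof (cases "0 \<le> x")
    case True
    then show ?thesis using powr_le_tangent[OF p, of x "max x (a * m)"] a m
      by (simp add: tangent_ext_def less_max_iff_disj)
  next
    case False
    then have mx: "max x (a * m) = a * m" using a m by (intro max_absorb2) (smt (verit) mult_pos_pos)
    have "\<bar>x\<bar> powr p \<le> m powr p" using False m p by (intro powr_mono2) auto
    also have "\<dots> \<le> m powr p * ((1 - p) * a powr p - p * a powr (p - 1))"
      using mult_left_mono[OF a(2), of "m powr p"] by simp
    also have "\<dots> = (a * m) powr p + p * (a * m) powr (p - 1) * (- m - a * m)"
      using a m by (simp add: powr_mult powr_diff field_simps)
    also have "\<dots> \<le> (a * m) powr p + p * (a * m) powr (p - 1) * (x - a * m)"
      using p m by (intro add_left_mono mult_left_mono) auto
    finally show ?thesis by (simp add: tangent_ext_def mx)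
  qed
  then show ?thesis by (simp add: majorant_def)
qed

text \<open>In this form the derivative in \<open>m\<close> is a negative multiple of
  \<open>x + m\<close>: growth of \<open>m\<close> lowers the majorant as long as the path is above
  \<open>- m\<close>.\<close>

lemma majorant_left:
  assumes "0 < p" "p < 1" "0 < a" "0 < m" "x \<le> a * m"
  shows "majorant p a x m = a powr (p - 1) * (p * x * m powr (p - 1) - (1 - p) * m powr p)"
proof -
  have "max x (a * m) = a * m" using assms by simp
  then show ?thesis using assms
    by (simp add: majorant_def tangent_ext_def powr_mult powr_diff field_simps)
qed

text \<open>Growth of \<open>m\<close> raises the majorant only where the path is already below the
  old minimum. The last term bounds the rise by this overshoot times the drop of
  \<open>m powr (p - 1)\<close>; the drops telescope along a grid.\<close>

lemma majorant_step_min: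
  assumes p: "0 < p" "p < 1" and a: "0 < a" and m: "0 < m" "m \<le> m'"
  shows "majorant p a x m' \<le> majorant p a x m +
    p * a powr (p - 1) * max (- x - m) 0 * (m powr (p - 1) - m' powr (p - 1))"
proof -
  have w: "0 \<le> m powr (p - 1) - m' powr (p - 1)" if "0 < m" "m \<le> m'" for m m' :: real
    using powr_mono2'[of "p - 1" m m'] p that by simp
  have left: "majorant p a x m' \<le> majorant p a x m +
    p * a powr (p - 1) * max (- x - m) 0 * (m powr (p - 1) - m' powr (p - 1))"
    if m: "0 < m" "m \<le> m'" and x: "x \<le> a * m" for m m'
  proof -
    define v where "v = m powr (p - 1) - m' powr (p - 1)"
    have v: "0 \<le> v" using w[OF m] by (simp add: v_def)
    have xm': "x \<le> a * m'" using x m a by (meson mult_left_mono less_imp_le order_trans)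
    \<comment> \<open>The tangent is taken at the new value \<open>m'\<close>. Rearranged, the
      inequality says that at \<open>x = - m\<close> the majorant does not rise when
      \<open>m\<close> grows to \<open>m'\<close>.\<close>
    have "m powr p \<le> m' powr p + p * m' powr (p - 1) * (m - m')"
      using m by (intro powr_le_tangent p) auto
    moreover have "m powr p = m * m powr (p - 1)" "m' powr p = m' * m' powr (p - 1)"
      using m by (simp_all add: powr_diff)
    ultimately have "p * m * v \<le> (1 - p) * (m' powr p - m powr p)"
      by (simp add: v_def algebra_simps)
    moreover have "p * (- x - m) * v \<le> p * max (- x - m) 0 * v"
      using p v by (intro mult_right_mono mult_left_mono) auto
    ultimately have "- p * x * v - (1 - p) * (m' powr p - m powr p) \<le> p * max (- x - m) 0 * v"
      by (simp add: algebra_simps)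
    then have "a powr (p - 1) * (- p * x * v - (1 - p) * (m' powr p - m powr p))
      \<le> a powr (p - 1) * (p * max (- x - m) 0 * v)" by (intro mult_left_mono) auto
    moreover have "majorant p a x m' - majorant p a x m
        = a powr (p - 1) * (- p * x * v - (1 - p) * (m' powr p - m powr p))"
      using majorant_left[OF p a, of m x] majorant_left[OF p a, of m' x] m x xm'
      by (simp add: v_def algebra_simps)
    ultimately show ?thesis by (simp add: v_def algebra_simps)
  qed
  have right: "majorant p a x m' \<le> majorant p a x m"
    if m: "0 < m" "m \<le> m'" and x: "a * m' \<le> x" for m m'
  proof -
    have "a * m \<le> x" using x m a by (meson mult_left_mono less_imp_le order_trans)
    moreover have "m powr p \<le> m' powr p" using m p by (intro powr_mono2) auto
    ultimately show ?thesis using x p a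
      by (auto simp: majorant_def tangent_ext_def max_absorb1 intro!: mult_left_mono)
  qed
  consider "x \<le> a * m" | "a * m < x" "x < a * m'" | "a * m' \<le> x" by linarith
  then show ?thesis
  proof cases
    case 1 then show ?thesis by (rule left[OF m])
  next
    case 2
    \<comment> \<open>The value of \<open>m\<close> at which \<open>x\<close> is the contact point;
      up to \<open>s\<close> the power part is in force, from \<open>s\<close> on the linear
      part.\<close>
    define s where "s = x / a"
    have x: "x = a * s" using a by (simp add: s_def)
    have s: "m < s" "s < m'" using 2 a unfolding x by (auto simp: mult_less_cancel_left_pos)
    have "majorant p a x m' \<le> majorant p a x s +
        p * a powr (p - 1) * max (- x - s) 0 * (s powr (p - 1) - m' powr (p - 1))"
      using s m x by (intro left) auto
    moreover have "max (- x - s) 0 = 0" using 2 s m a by (intro max_absorb2) (smt (verit) mult_pos_pos)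
    moreover have "majorant p a x s \<le> majorant p a x m"
      using s m x by (intro right) auto
    moreover have "0 \<le> p * a powr (p - 1) * max (- x - m) 0 * (m powr (p - 1) - m' powr (p - 1))"
      using w[OF m] p by (intro mult_nonneg_nonneg) auto
    ultimately show ?thesis by simp
  next
    case 3
    have "0 \<le> p * a powr (p - 1) * max (- x - m) 0 * (m powr (p - 1) - m' powr (p - 1))"
      using w[OF m] p by (intro mult_nonneg_nonneg) auto
    then show ?thesis using right[OF m 3] by simp
  qed
qed

text \<open>First \<open>x\<close> moves with \<open>m\<close> frozen, which concavity controls;
  then \<open>m\<close> moves with \<open>x'\<close> frozen.\<close>

lemma majorant_step:
  assumes "0 < p" "p < 1" "0 < a" "0 < m" "m \<le> m'"
  shows "majorant p a x' m' \<le> majorant p a x m + p * max x (a * m) powr (p - 1) * (x' - x) +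
    p * a powr (p - 1) * max (- x' - m) 0 * (m powr (p - 1) - m' powr (p - 1))"
  using majorant_step_min[OF assms(1-5), of x'] tangent_ext_concave[of p "a * m" x' x] assms
  by (simp add: majorant_def)


section \<open>Paths with nonnegative jumps\<close>

lemma cadlag_rightD:
  assumes "cadlag x" "0 \<le> s" "0 < e"
  obtains d where "0 < d" "\<And>r. s \<le> r \<Longrightarrow> r < s + d \<Longrightarrow> \<bar>x r - x s\<bar> < e"
proof -
  have "(x \<longlongrightarrow> x s) (at_right s)"
    using assms by (simp add: cadlag_def continuous_within)
  then have "eventually (\<lambda>r. dist (x r) (x s) < e) (at_right s)" using assms by (simp add: tendsto_iff)
  then obtain b where b: "s < b" "\<And>r. s < r \<Longrightarrow> r < b \<Longrightarrow> dist (x r) (x s) < e"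
    by (auto simp: eventually_at_right_field)
  show thesis
  proof (rule that[of "b - s"])
    fix r assume "s \<le> r" "r < s + (b - s)"
    then show "\<bar>x r - x s\<bar> < e" using b(2)[of r] \<open>0 < e\<close> by (cases "r = s") (auto simp: dist_real_def)
  qed (use b in auto)
qed

text \<open>\<open>x s - jump x s\<close> is the left limit; written like this, the sign of the jump
  can be used directly.\<close>

lemma cadlag_leftD:
  assumes "cadlag x" "0 < s" "0 < e"
  obtains d where "0 < d" "d \<le> s" "\<And>r. s - d < r \<Longrightarrow> r < s \<Longrightarrow> \<bar>x r - (x s - jump x s)\<bar> < e"
proof -
  obtain l where l: "(x \<longlongrightarrow> l) (at_left s)" using assms by (auto simp: cadlag_def)
  then have "Lim (at_left s) x = l" by (intro tendsto_Lim) auto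
  then have xl: "x s - jump x s = l" using assms by (simp add: jump_def)
  have "eventually (\<lambda>r. dist (x r) l < e) (at_left s)" using assms l by (simp add: tendsto_iff)
  then obtain b where b: "b < s" "\<And>r. b < r \<Longrightarrow> r < s \<Longrightarrow> dist (x r) l < e"
    by (auto simp: eventually_at_left_field)
  show thesis
    by (rule that[of "min s (s - b)"])
       (use b assms in \<open>auto simp: xl dist_real_def min_def split: if_splits\<close>)
qed

text \<open>Bisection: the property passes to unions of adjacent intervals and holds near each point
  by the one-sided limits. Intersecting with \<open>{0..}\<close> admits intervals around 0 that
  reach into negative times, where nothing is known about \<open>x\<close>.\<close>

lemma cadlag_bdd_below:
  assumes "cadlag x" "0 \<le> t"
  shows "bdd_below (x ` {0..t})"
proof -
  define P where "P u v \<longleftrightarrow> bdd_below (x ` ({u..v} \<inter> {0..}))" for u v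
  have "P 0 t"
    using \<open>0 \<le> t\<close>
  proof (induction rule: Bolzano)
    case (trans a b c)
    have "{a..c} \<inter> {0..} \<subseteq> ({a..b} \<inter> {0..}) \<union> ({b..c} \<inter> {0..})"
      using trans by auto
    then have "x ` ({a..c} \<inter> {0..}) \<subseteq> x ` ({a..b} \<inter> {0..}) \<union> x ` ({b..c} \<inter> {0..})"
      by (metis image_Un image_mono)
    then show ?case using trans unfolding P_def by (meson bdd_below_Un bdd_below_mono)
  next
    case (local s)
    obtain d where d: "0 < d" "\<And>r. s \<le> r \<Longrightarrow> r < s + d \<Longrightarrow> \<bar>x r - x s\<bar> < 1"
      using cadlag_rightD[OF assms(1), of s 1] local by auto
    obtain d' l where d': "0 < d'" "\<And>r. 0 \<le> r \<Longrightarrow> s - d' < r \<Longrightarrow> r < s \<Longrightarrow> \<bar>x r - l\<bar> < 1"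
    proof (cases "s = 0")
      case True then show thesis by (intro that[of 1 0]) auto
    next
      case False then show thesis using cadlag_leftD[OF assms(1), of s 1] that local
        by (metis less_eq_real_def zero_less_one)
    qed
    show ?case
    proof (intro exI[of _ "min d d'"] conjI allI impI)
      fix u v assume uv: "u \<le> s \<and> s \<le> v \<and> v - u < min d d'"
      have "min (x s) l - 1 \<le> x r" if "r \<in> {u..v} \<inter> {0..}" for r
        using d(2)[of r] d'(2)[of r] uv that by (cases "r < s") auto
      then show "P u v" unfolding P_def by (intro bdd_belowI2[where m = "min (x s) l - 1"])
    qed (use d d' in auto)
  qed
  then show ?thesis by (simp add: P_def Int_absorb2 atLeastatMost_subset_iff)
qed

section \<open>The running infimum\<close>

definition run_inf :: "(real \<Rightarrow> real) \<Rightarrow> real \<Rightarrow> real" where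
  "run_inf x t = (INF s\<in>{0..t}. x s)"

lemma run_inf_le:
  assumes "cadlag x" "0 \<le> s" "s \<le> t" shows "run_inf x t \<le> x s"
  unfolding run_inf_def using assms by (intro cINF_lower cadlag_bdd_below) auto

lemma run_inf_ge:
  assumes "0 \<le> t" "\<And>s. 0 \<le> s \<Longrightarrow> s \<le> t \<Longrightarrow> c \<le> x s" shows "c \<le> run_inf x t"
  unfolding run_inf_def using assms by (intro cINF_greatest) auto

lemma run_inf_antimono:
  assumes "cadlag x" "0 \<le> s" "s \<le> t" shows "run_inf x t \<le> run_inf x s"
  using assms by (intro run_inf_ge) (auto intro: run_inf_le)

text \<open>Only a downward jump could make the infimum jump. Just before \<open>s\<close> the path
  is close to its left limit \<open>l\<close>, and \<open>l <= x s\<close>, so neither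
  \<open>x s\<close> nor any value shortly before \<open>s\<close> falls far below an earlier
  \<open>x r\<close>. To the right of \<open>s\<close> right-continuity suffices.\<close>

lemma run_inf_continuous:
  assumes x: "cadlag x" and j: "\<And>t. 0 \<le> t \<Longrightarrow> 0 \<le> jump x t"
  shows "continuous_on {0..} (run_inf x)"
  unfolding continuous_on_iff
proof (intro ballI allI impI)
  fix s e :: real assume s: "s \<in> {0..}" and e: "0 < e"
  obtain d where d: "0 < d" "\<And>r. s \<le> r \<Longrightarrow> r < s + d \<Longrightarrow> \<bar>x r - x s\<bar> < e / 3"
    using cadlag_rightD[OF x, of s "e / 3"] s e by auto
  define l where "l = x s - jump x s"
  have l: "l \<le> x s" using j[of s] s by (simp add: l_def)
  obtain d' where d': "0 < d'" "\<And>r. 0 \<le> r \<Longrightarrow> s - d' < r \<Longrightarrow> r < s \<Longrightarrow> \<bar>x r - l\<bar> < e / 3"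
  proof (cases "s = 0")
    case True then show thesis by (intro that[of 1]) auto
  next
    case False then show thesis using cadlag_leftD[OF x, of s "e / 3"] that s e unfolding l_def
      by (metis atLeast_iff divide_pos_pos less_eq_real_def zero_less_numeral)
  qed
  show "\<exists>d>0. \<forall>r\<in>{0..}. dist r s < d \<longrightarrow> dist (run_inf x r) (run_inf x s) < e"
  proof (intro exI[of _ "min d d'"] conjI ballI impI)
    fix r :: real assume r: "r \<in> {0..}" "dist r s < min d d'"
    show "dist (run_inf x r) (run_inf x s) < e"
    proof (cases "r < s")
      case True
      have "run_inf x r - 2 * (e / 3) \<le> x u" if u: "0 \<le> u" "u \<le> s" for u
      proof -
        have 1: "run_inf x r \<le> x r" using run_inf_le[OF x, of r r] r by auto
        have 2: "\<bar>x r - l\<bar> < e / 3" using d'(2)[of r] r True by (auto simp: dist_real_def)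
        consider "u \<le> r" | "r < u" "u < s" | "u = s" using u by linarith
        then show ?thesis
        proof cases
          case 1 then show ?thesis using run_inf_le[OF x, of u r] that e by auto
        next
          case 2
          then have "\<bar>x u - l\<bar> < e / 3" using d'(2)[of u] r u by (auto simp: dist_real_def)
          then show ?thesis using \<open>run_inf x r \<le> x r\<close> \<open>\<bar>x r - l\<bar> < e / 3\<close> by linarith
        next
          case 3 show ?thesis unfolding 3 using 1 2 l e by linarith
        qed
      qed
      then have "run_inf x r - 2 * (e / 3) \<le> run_inf x s" using s by (intro run_inf_ge) auto
      moreover have "run_inf x s \<le> run_inf x r" using run_inf_antimono[OF x, of r s] r True by auto
      ultimately show ?thesis using e by (auto simp: dist_real_def)
    next
      case False
      have "run_inf x s - e / 3 \<le> x u" if "0 \<le> u" "u \<le> r" for u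
      proof (cases "u \<le> s")
        case True then show ?thesis using run_inf_le[OF x, of u s] that e by auto
      next
        case f: False
        then have "\<bar>x u - x s\<bar> < e / 3" using d(2)[of u] r that by (auto simp: dist_real_def)
        moreover have "run_inf x s \<le> x s" using run_inf_le[OF x, of s s] s by auto
        ultimately show ?thesis by linarith
      qed
      then have "run_inf x s - e / 3 \<le> run_inf x r" using r by (intro run_inf_ge) auto
      moreover have "run_inf x r \<le> run_inf x s" using run_inf_antimono[OF x, of s r] s False by auto
      ultimately show ?thesis using e by (auto simp: dist_real_def)
    qed
  qed (use d d' in auto)
qed

text \<open>This gives measurability of the infimum at time \<open>t\<close>. The point
  \<open>t\<close> is listed separately because right-continuity does not approximate its value by
  times before \<open>t\<close>.\<close>

lemma run_inf_countable:
  assumes x: "cadlag x" and t: "0 \<le> t"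
  shows "run_inf x t = (INF s\<in>insert t (\<rat> \<inter> {0..t}). x s)"
proof (rule antisym)
  have sub: "insert t (\<rat> \<inter> {0..t}) \<subseteq> {0..t}" using t by auto
  show "run_inf x t \<le> (INF s\<in>insert t (\<rat> \<inter> {0..t}). x s)"
    using sub by (intro cINF_greatest run_inf_le[OF x]) auto
  have bdd: "bdd_below (x ` insert t (\<rat> \<inter> {0..t}))"
    using sub by (meson bdd_below_mono cadlag_bdd_below[OF x t] image_mono)
  show "(INF s\<in>insert t (\<rat> \<inter> {0..t}). x s) \<le> run_inf x t" (is "?I \<le> _")
  proof (rule run_inf_ge[OF t])
    fix s assume s: "0 \<le> s" "s \<le> t"
    show "?I \<le> x s"
    proof (cases "s = t")
      case True then show ?thesis using bdd by (intro cINF_lower) auto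
    next
      case False
      show ?thesis
      proof (rule field_le_epsilon)
        fix e :: real assume "0 < e"
        then obtain d where d: "0 < d" "\<And>r. s \<le> r \<Longrightarrow> r < s + d \<Longrightarrow> \<bar>x r - x s\<bar> < e"
          using cadlag_rightD[OF x s(1)] by blast
        obtain r where r: "r \<in> \<rat>" "s < r" "r < min (s + d) t"
          using Rats_dense_in_real[of s "min (s + d) t"] d False s by auto
        have "?I \<le> x r" using bdd r s by (intro cINF_lower) auto
        also have "\<dots> \<le> x s + e" using d(2)[of r] r by auto
        finally show "?I \<le> x s + e" .
      qed
    qed
  qed
qed


section \<open>The upper bound\<close>

context complete_filtered_prob_space
begin

lemma measurable_F: "0 \<le> s \<Longrightarrow> f \<in> borel_measurable (F s) \<Longrightarrow> f \<in> borel_measurable M"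
  using measurable_from_subalg[OF subalgebra_F] .

lemma space_F: "0 \<le> s \<Longrightarrow> space (F s) = space M"
  using subalgebra_F[of s] by (simp add: subalgebra_def)

lemma measurable_F_mono: "0 \<le> s \<Longrightarrow> s \<le> t \<Longrightarrow> f \<in> borel_measurable (F s) \<Longrightarrow> f \<in> borel_measurable (F t)"
  by (rule measurable_from_subalg) (use sets_F_mono[of s t] space_F[of s] space_F[of t] in \<open>auto simp: subalgebra_def\<close>)

lemma integrable_bdd_mult:
  fixes h f :: "'a \<Rightarrow> real"
  assumes "integrable M f" "h \<in> borel_measurable M" "\<And>\<omega>. \<bar>h \<omega>\<bar> \<le> K"
  shows "integrable M (\<lambda>\<omega>. h \<omega> * f \<omega>)"
  by (rule Bochner_Integration.integrable_bound[of M "\<lambda>\<omega>. K * f \<omega>"])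
     (use assms in \<open>auto simp: abs_mult intro!: AE_I2 mult_right_mono order_trans[OF assms(3) abs_ge_self]\<close>)

lemma supermartingale_mult_increment:
  assumes X: "supermartingale M F X" and st: "0 \<le> s" "s \<le> t"
    and h: "h \<in> borel_measurable (F s)" "\<And>\<omega>. 0 \<le> h \<omega>" "\<And>\<omega>. h \<omega> \<le> K"
  shows "integrable M (\<lambda>\<omega>. h \<omega> * (X t \<omega> - X s \<omega>))"
    and "(\<integral>\<omega>. h \<omega> * (X t \<omega> - X s \<omega>) \<partial>M) \<le> 0"
proof -
  interpret S: finite_measure_subalgebra M "F s"
    by standard (rule subalgebra_F[OF st(1)])
  have i: "integrable M (X t)" "integrable M (X s)" using X st by (auto simp: supermartingale_def)
  have hM: "h \<in> borel_measurable M" using h st by (auto intro: measurable_F)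
  have ih: "integrable M (\<lambda>\<omega>. h \<omega> * X t \<omega>)" "integrable M (\<lambda>\<omega>. h \<omega> * X s \<omega>)"
    using h by (auto intro!: integrable_bdd_mult[where K = K] i hM)
  then show "integrable M (\<lambda>\<omega>. h \<omega> * (X t \<omega> - X s \<omega>))" by (simp add: right_diff_distrib)
  have "(\<integral>\<omega>. h \<omega> * X t \<omega> \<partial>M) = (\<integral>\<omega>. h \<omega> * real_cond_exp M (F s) (X t) \<omega> \<partial>M)"
    using ih h i by (intro S.real_cond_exp_intg(2)[symmetric]) auto
  also have "\<dots> \<le> (\<integral>\<omega>. h \<omega> * X s \<omega> \<partial>M)"
  proof (rule integral_mono_AE)
    show "integrable M (\<lambda>\<omega>. h \<omega> * real_cond_exp M (F s) (X t) \<omega>)"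
      using ih h i by (intro S.real_cond_exp_intg(1)) auto
    have "AE \<omega> in M. real_cond_exp M (F s) (X t) \<omega> \<le> X s \<omega>" using X st by (auto simp: supermartingale_def)
    then show "AE \<omega> in M. h \<omega> * real_cond_exp M (F s) (X t) \<omega> \<le> h \<omega> * X s \<omega>"
      by eventually_elim (use h in \<open>auto intro: mult_left_mono\<close>)
  qed (use ih in auto)
  finally show "(\<integral>\<omega>. h \<omega> * (X t \<omega> - X s \<omega>) \<partial>M) \<le> 0" using ih by (simp add: right_diff_distrib)
qed

text \<open>The negative part is a submartingale: test the supermartingale inequality with
  \<open>h\<close> restricted to the event \<open>X s < 0\<close>, and drop the restriction at time
  \<open>t\<close>, where it can only lower the integral.\<close>

lemma supermartingale_neg_part:
  assumes X: "supermartingale M F X" and st: "0 \<le> s" "s \<le> t"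
    and h: "h \<in> borel_measurable (F s)" "\<And>\<omega>. 0 \<le> h \<omega>" "\<And>\<omega>. h \<omega> \<le> K"
  shows "(\<integral>\<omega>. h \<omega> * max (- X s \<omega>) 0 \<partial>M) \<le> (\<integral>\<omega>. h \<omega> * max (- X t \<omega>) 0 \<partial>M)"
proof -
  have K: "0 \<le> K" using h(2,3) order_trans by blast
  have Xs: "X s \<in> borel_measurable (F s)" using X st by (auto simp: supermartingale_def adapted_def)
  have i: "integrable M (X t)" "integrable M (X s)" using X st by (auto simp: supermartingale_def)
  have hM: "h \<in> borel_measurable M" using h st by (auto intro: measurable_F)
  define g where "g \<omega> = h \<omega> * indicator {..<0} (X s \<omega>)" for \<omega>
  have g: "g \<in> borel_measurable (F s)" "\<And>\<omega>. 0 \<le> g \<omega>" "\<And>\<omega>. g \<omega> \<le> K"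
    unfolding g_def using h Xs K by (auto split: split_indicator)
  have gM: "g \<in> borel_measurable M" using g st by (auto intro: measurable_F)
  have ig: "integrable M (\<lambda>\<omega>. g \<omega> * X t \<omega>)" "integrable M (\<lambda>\<omega>. g \<omega> * X s \<omega>)"
    using g by (auto intro!: integrable_bdd_mult[where K = K] i gM)
  have "(\<integral>\<omega>. h \<omega> * max (- X s \<omega>) 0 \<partial>M) = (\<integral>\<omega>. - (g \<omega> * X s \<omega>) \<partial>M)"
    by (intro Bochner_Integration.integral_cong) (auto simp: g_def max_def split: split_indicator)
  also have "\<dots> \<le> (\<integral>\<omega>. - (g \<omega> * X t \<omega>) \<partial>M)"
    using supermartingale_mult_increment(2)[OF X st g] ig by (simp add: right_diff_distrib)
  also have "\<dots> \<le> (\<integral>\<omega>. h \<omega> * max (- X t \<omega>) 0 \<partial>M)"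
  proof (rule integral_mono)
    show "integrable M (\<lambda>\<omega>. h \<omega> * max (- X t \<omega>) 0)"
      using h(2,3) i by (intro integrable_bdd_mult[where K = K] hM) auto
    show "- (g \<omega> * X t \<omega>) \<le> h \<omega> * max (- X t \<omega>) 0" for \<omega>
      using mult_left_mono[of "- X t \<omega>" "max (- X t \<omega>) 0" "h \<omega>"] h(2)[of \<omega>]
      by (simp add: g_def split: split_indicator)
  qed (use ig in simp)
  finally show ?thesis .
qed

end

section \<open>The Burkholder argument along grids and its limit\<close>

text \<open>The overshoot \<open>- x (Suc i) - m i\<close> has two bounds: the increment of
  \<open>m\<close>, because \<open>- x <= m\<close>, and the negative part of \<open>x\<close>. The
  first serves for increments up to \<open>d\<close>, where the drops of
  \<open>m powr (p - 1)\<close> telescope, the second for the rare larger increments.\<close>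

lemma majorant_sum:
  fixes x m :: "nat \<Rightarrow> real"
  assumes p: "0 < p" "p < 1" "0 < a" and m0: "0 < m 0" and m: "\<And>i. m i \<le> m (Suc i)"
    and x: "\<And>i. - x i \<le> m i" and d: "0 < d"
  shows "majorant p a (x N) (m N) \<le> majorant p a (x 0) (m 0) +
    (\<Sum>i<N. p * max (x i) (a * m i) powr (p - 1) * (x (Suc i) - x i)) +
    p * a powr (p - 1) * (d * (m 0 powr (p - 1) - m N powr (p - 1)) +
      (\<Sum>i<N. (if d < m (Suc i) - m i then m i powr (p - 1) - m (Suc i) powr (p - 1) else 0) *
        max (- x (Suc i)) 0))"
proof (induction N)
  case 0
  then show ?case by simp
next
  case (Suc N)
  have pos: "0 < m i" for i
    using m0 m by (induction i) (auto intro: less_le_trans)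
  define w where "w = m N powr (p - 1) - m (Suc N) powr (p - 1)"
  have w: "0 \<le> w" using powr_mono2'[of "p - 1" "m N" "m (Suc N)"] p pos m by (simp add: w_def)
  have "max (- x (Suc N) - m N) 0 * w \<le>
      d * w + (if d < m (Suc N) - m N then w else 0) * max (- x (Suc N)) 0"
  proof (cases "d < m (Suc N) - m N")
    case True
    have "max (- x (Suc N) - m N) 0 * w \<le> max (- x (Suc N)) 0 * w"
      using w pos[of N] by (intro mult_right_mono) auto
    moreover have "0 \<le> d * w" using w d by simp
    ultimately show ?thesis using True by (simp add: algebra_simps)
  next
    case False
    have "max (- x (Suc N) - m N) 0 * w \<le> d * w"
      using w False x[of "Suc N"] d by (intro mult_right_mono) auto
    then show ?thesis using False by simp
  qed
  then have "p * a powr (p - 1) * (max (- x (Suc N) - m N) 0 * w) \<le> p * a powr (p - 1) *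
      (d * w + (if d < m (Suc N) - m N then w else 0) * max (- x (Suc N)) 0)"
    using p by (intro mult_left_mono) auto
  with Suc.IH majorant_step[OF p pos[of N] m, of "x (Suc N)" "x N"]
  show ?case unfolding w_def by (simp add: algebra_simps)
qed

text \<open>The mean of \<open>majorant_sum\<close>. The floor \<open>e\<close> bounds all weights,
  so the supermartingale sum has nonpositive mean. The \<open>min\<close> in the grid makes it stand
  still after index \<open>N\<close>, so that monotonicity holds for all indices.\<close>

lemma (in complete_filtered_prob_space) grid_estimate:
  assumes p: "0 < p" "p < 1" and a: "0 < a" "1 \<le> (1 - p) * a powr p - p * a powr (p - 1)"
    and X: "supermartingale_nonneg_jumps M F X" and t: "0 \<le> t" and e: "0 < e" and d: "0 < d"
    and m_def: "\<And>s \<omega>. m s \<omega> = max e (- run_inf (\<lambda>s. X s \<omega>) s)"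
    and int: "integrable M (\<lambda>\<omega>. m t \<omega> powr p)"
    and N: "0 < N" and s_def: "\<And>i. s i = t * (real (min i N) / real N)"
  shows "(\<integral>\<omega>. \<bar>X t \<omega>\<bar> powr p \<partial>M) \<le>
      (1 - p) * a powr (p - 1) * (a + 1) * (\<integral>\<omega>. m t \<omega> powr p \<partial>M) + (a * e) powr p
      + p * a powr (p - 1) * e powr (p - 1) * (d +
         (\<integral>\<omega>. indicator {\<omega>. \<exists>i<N. d < m (s (Suc i)) \<omega> - m (s i) \<omega>} \<omega> * max (- X t \<omega>) 0 \<partial>M))"
proof -
  have sm: "supermartingale M F X" and cad: "\<And>\<omega>. \<omega> \<in> space M \<Longrightarrow> cadlag (\<lambda>t. X t \<omega>)"
    and X0: "AE \<omega> in M. X 0 \<omega> = 0"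
    using X by (auto simp: supermartingale_nonneg_jumps_def)
  have ad: "X r \<in> borel_measurable (F r)" and iX: "integrable M (X r)" if "0 \<le> r" for r
    using sm that by (auto simp: supermartingale_def adapted_def)
  have s: "0 \<le> s i" "s i \<le> s (Suc i)" for i
    using t N by (auto simp: s_def intro!: mult_left_mono divide_right_mono)
  have s: "0 \<le> s i" "s i \<le> s (Suc i)" "s i \<le> t" for i
    using s mult_left_le[OF _ t, of "real (min i N) / real N"] N by (auto simp: s_def)
  have sN: "s N = t" and s0: "s 0 = 0" using N by (auto simp: s_def)
  have mono: "m r \<omega> \<le> m r' \<omega>" if "\<omega> \<in> space M" "0 \<le> r" "r \<le> r'" for r r' \<omega>
    using run_inf_antimono[OF cad[OF that(1)] that(2,3)] by (auto simp: m_def)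
  have me: "e \<le> m r \<omega>" for r \<omega> by (simp add: m_def)
  have Xm: "- X r \<omega> \<le> m r \<omega>" if "\<omega> \<in> space M" "0 \<le> r" for r \<omega>
    using run_inf_le[OF cad[OF that(1)] that(2) order_refl] by (auto simp: m_def)
  have mF: "m r \<in> borel_measurable (F r)" if r: "0 \<le> r" for r
  proof -
    have "(\<lambda>\<omega>. INF u\<in>insert r (\<rat> \<inter> {0..r}). X u \<omega>) \<in> borel_measurable (F r)"
      using r by (intro borel_measurable_cINF_real)
        (auto intro!: countable_rat countable_Int1 intro: ad measurable_F_mono[OF _ _ ad])
    then have "(\<lambda>\<omega>. max e (- (INF u\<in>insert r (\<rat> \<inter> {0..r}). X u \<omega>))) \<in> borel_measurable (F r)"
      by measurable
    then show ?thesis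
      by (rule measurable_cong[THEN iffD1, rotated])
         (use run_inf_countable[OF cad r] space_F[OF r] in \<open>auto simp: m_def\<close>)
  qed
  define D where "D = (1 - p) * a powr (p - 1) * (a + 1)"
  define k where "k = p * a powr (p - 1)"
  have k: "0 \<le> k" using p by (simp add: k_def)
  define S where "S i \<omega> = p * max (X (s i) \<omega>) (a * m (s i) \<omega>) powr (p - 1)" for i \<omega>
  \<comment> \<open>The outer \<open>max 0\<close> makes the weight nonnegative at every point, also
    outside \<open>space M\<close>, as the submartingale inequality demands. On
    \<open>space M\<close> it changes nothing.\<close>
  define b where "b i \<omega> = max 0 (if d < m (s (Suc i)) \<omega> - m (s i) \<omega>
      then m (s i) \<omega> powr (p - 1) - m (s (Suc i)) \<omega> powr (p - 1) else 0)" for i \<omega>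
  have S: "S i \<in> borel_measurable (F (s i))" "0 \<le> S i \<omega>" "S i \<omega> \<le> p * (a * e) powr (p - 1)" for i \<omega>
  proof -
    note [measurable] = mF[OF s(1), of i] ad[OF s(1), of i]
    show "S i \<in> borel_measurable (F (s i))" unfolding S_def by measurable
    show "0 \<le> S i \<omega>" using p by (simp add: S_def)
    have "a * e \<le> max (X (s i) \<omega>) (a * m (s i) \<omega>)" using me a by (simp add: le_max_iff_disj)
    then show "S i \<omega> \<le> p * (a * e) powr (p - 1)" unfolding S_def
      using p a e by (intro mult_left_mono powr_mono2') auto
  qed
  have b: "b i \<in> borel_measurable (F (s (Suc i)))" "0 \<le> b i \<omega>" "b i \<omega> \<le> e powr (p - 1)" for i \<omega>
  proof -
    have [measurable]: "m (s i) \<in> borel_measurable (F (s (Suc i)))"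
      "m (s (Suc i)) \<in> borel_measurable (F (s (Suc i)))"
      using mF s measurable_F_mono by blast+
    show "b i \<in> borel_measurable (F (s (Suc i)))" unfolding b_def by measurable
    show "0 \<le> b i \<omega>" by (simp add: b_def)
    have "m (s i) \<omega> powr (p - 1) \<le> e powr (p - 1)" using me e p by (intro powr_mono2') auto
    moreover have "0 \<le> m (s (Suc i)) \<omega> powr (p - 1)" by simp
    ultimately have "m (s i) \<omega> powr (p - 1) - m (s (Suc i)) \<omega> powr (p - 1) \<le> e powr (p - 1)" by linarith
    then show "b i \<omega> \<le> e powr (p - 1)" by (simp add: b_def)
  qed
  have b_eq: "b i \<omega> = (if d < m (s (Suc i)) \<omega> - m (s i) \<omega>
      then m (s i) \<omega> powr (p - 1) - m (s (Suc i)) \<omega> powr (p - 1) else 0)" if "\<omega> \<in> space M" for i \<omega>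
    using powr_mono2'[of "p - 1" "m (s i) \<omega>" "m (s (Suc i)) \<omega>"] p mono[OF that s(1,2)] less_le_trans[OF e me]
    by (auto simp: b_def)
  note [measurable] = measurable_F[OF s(1) b(1)] measurable_F[OF s(1) mF[OF s(1)]]
    measurable_F[OF t ad[OF t]] measurable_F[OF s(1) ad[OF s(1)]]
  define E where "E = {\<omega>. \<exists>i<N. d < m (s (Suc i)) \<omega> - m (s i) \<omega>}"
  have ind: "(indicator E :: 'a \<Rightarrow> real) \<in> borel_measurable M"
    unfolding E_def indicator_def by measurable
  have bsum: "(\<Sum>i<N. b i \<omega>) \<le> e powr (p - 1) * indicator E \<omega>" if "\<omega> \<in> space M" for \<omega>
  proof (cases "\<omega> \<in> E")
    case True
    have "(\<Sum>i<N. b i \<omega>) \<le> (\<Sum>i<N. m (s i) \<omega> powr (p - 1) - m (s (Suc i)) \<omega> powr (p - 1))"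
      using powr_mono2'[of "p - 1" "m (s _) \<omega>" "m (s (Suc _)) \<omega>"] p mono[OF that s(1,2)] less_le_trans[OF e me]
      by (intro sum_mono) (auto simp: b_eq[OF that])
    also have "\<dots> = m (s 0) \<omega> powr (p - 1) - m (s N) \<omega> powr (p - 1)"
      by (rule sum_lessThan_telescope')
    also have "\<dots> \<le> m (s 0) \<omega> powr (p - 1)" by simp
    also have "\<dots> \<le> e powr (p - 1)" using me e p by (intro powr_mono2') auto
    finally show ?thesis using True by simp
  next
    case False
    then have "b i \<omega> = 0" if "i < N" for i using that by (auto simp: b_def E_def)
    then show ?thesis using False by simp
  qed
  have AE: "AE \<omega> in M. \<bar>X t \<omega>\<bar> powr p \<le> D * m t \<omega> powr p + (a * e) powr p
      + (\<Sum>i<N. S i \<omega> * (X (s (Suc i)) \<omega> - X (s i) \<omega>))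
      + k * (d * e powr (p - 1) + (\<Sum>i<N. b i \<omega> * max (- X (s (Suc i)) \<omega>) 0))"
    using X0 AE_space
  proof eventually_elim
    case (elim \<omega>)
    have "run_inf (\<lambda>s. X s \<omega>) 0 = 0" using elim by (simp add: run_inf_def)
    then have m0: "m 0 \<omega> = e" using e by (simp add: m_def)
    have "\<bar>X t \<omega>\<bar> powr p - D * m t \<omega> powr p \<le> majorant p a (X t \<omega>) (m t \<omega>)"
      unfolding D_def using me e Xm[of \<omega> t] elim t
      by (intro majorant_ge p a) (auto intro: less_le_trans simp: minus_le_iff)
    also have "\<dots> \<le> majorant p a (X (s 0) \<omega>) (m (s 0) \<omega>) +
      (\<Sum>i<N. S i \<omega> * (X (s (Suc i)) \<omega> - X (s i) \<omega>)) +
      k * (d * (m (s 0) \<omega> powr (p - 1) - m (s N) \<omega> powr (p - 1)) +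
        (\<Sum>i<N. b i \<omega> * max (- X (s (Suc i)) \<omega>) 0))"
      using majorant_sum[OF p a(1), of "\<lambda>i. m (s i) \<omega>" "\<lambda>i. X (s i) \<omega>" d N]
        less_le_trans[OF e me] mono s Xm elim d
      by (simp add: S_def k_def b_eq sN)
    finally have 1: "\<bar>X t \<omega>\<bar> powr p - D * m t \<omega> powr p \<le> majorant p a (X (s 0) \<omega>) (m (s 0) \<omega>) +
      (\<Sum>i<N. S i \<omega> * (X (s (Suc i)) \<omega> - X (s i) \<omega>)) +
      k * (d * (m (s 0) \<omega> powr (p - 1) - m (s N) \<omega> powr (p - 1)) +
        (\<Sum>i<N. b i \<omega> * max (- X (s (Suc i)) \<omega>) 0))" .
    have 2: "majorant p a (X (s 0) \<omega>) (m (s 0) \<omega>) \<le> (a * e) powr p"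
    proof -
      have "0 \<le> (1 - p) * a powr (p - 1) * (a + 1) * e powr p" using p a by simp
      moreover have "p * (a * e) powr (p - 1) * (0 - a * e) \<le> 0"
        using p a e by (intro mult_nonneg_nonpos) auto
      ultimately show ?thesis using a e elim by (simp add: s0 m0 majorant_def tangent_ext_def)
    qed
    have "k * (d * (m (s 0) \<omega> powr (p - 1) - m (s N) \<omega> powr (p - 1)) +
        (\<Sum>i<N. b i \<omega> * max (- X (s (Suc i)) \<omega>) 0)) \<le> k * (d * e powr (p - 1) +
        (\<Sum>i<N. b i \<omega> * max (- X (s (Suc i)) \<omega>) 0))"
      using d k by (intro mult_left_mono add_right_mono) (auto simp: s0 m0)
    with 1 2 show ?case by linarith
  qed
  have iS: "integrable M (\<lambda>\<omega>. S i \<omega> * (X (s (Suc i)) \<omega> - X (s i) \<omega>))"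
    "(\<integral>\<omega>. S i \<omega> * (X (s (Suc i)) \<omega> - X (s i) \<omega>) \<partial>M) \<le> 0" for i
    using supermartingale_mult_increment[OF sm s(1,2) S] by auto
  have ib: "integrable M (\<lambda>\<omega>. b i \<omega> * max (- X r \<omega>) 0)" if "0 \<le> r" for i r
    using b iX[OF that] by (intro integrable_bdd_mult[where K = "e powr (p - 1)"]) auto
  have ineg: "integrable M (\<lambda>\<omega>. max (- X t \<omega>) 0)" using iX[OF t] by auto
  have iE: "integrable M (\<lambda>\<omega>. indicator E \<omega> * max (- X t \<omega>) 0)"
    by (intro integrable_bdd_mult[where K = 1] ineg ind) (auto split: split_indicator)
  let ?J = "\<integral>\<omega>. indicator E \<omega> * max (- X t \<omega>) 0 \<partial>M"
  have "(\<integral>\<omega>. (\<Sum>i<N. b i \<omega> * max (- X (s (Suc i)) \<omega>) 0) \<partial>M)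
      = (\<Sum>i<N. \<integral>\<omega>. b i \<omega> * max (- X (s (Suc i)) \<omega>) 0 \<partial>M)"
    by (intro Bochner_Integration.integral_sum ib s)
  \<comment> \<open>The negative parts are all moved to the final time, so that a common factor
    appears and the weights can be summed pointwise, where they telescope.\<close>
  also have "\<dots> \<le> (\<Sum>i<N. \<integral>\<omega>. b i \<omega> * max (- X t \<omega>) 0 \<partial>M)"
    by (intro sum_mono supermartingale_neg_part[OF sm s(1) s(3) b])
  also have "\<dots> = (\<integral>\<omega>. (\<Sum>i<N. b i \<omega> * max (- X t \<omega>) 0) \<partial>M)"
    by (intro Bochner_Integration.integral_sum[symmetric] ib t)
  also have "\<dots> \<le> (\<integral>\<omega>. e powr (p - 1) * (indicator E \<omega> * max (- X t \<omega>) 0) \<partial>M)"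
  proof (rule integral_mono)
    fix \<omega> assume "\<omega> \<in> space M"
    from mult_right_mono[OF bsum[OF this], of "max (- X t \<omega>) 0"]
    show "(\<Sum>i<N. b i \<omega> * max (- X t \<omega>) 0) \<le> e powr (p - 1) * (indicator E \<omega> * max (- X t \<omega>) 0)"
      by (simp add: sum_distrib_right mult.assoc)
  qed (use ib[OF t] iE in auto)
  also have "\<dots> = e powr (p - 1) * ?J" by simp
  finally have bb: "(\<integral>\<omega>. (\<Sum>i<N. b i \<omega> * max (- X (s (Suc i)) \<omega>) 0) \<partial>M) \<le> e powr (p - 1) * ?J" .
  have SS: "(\<integral>\<omega>. (\<Sum>i<N. S i \<omega> * (X (s (Suc i)) \<omega> - X (s i) \<omega>)) \<partial>M) \<le> 0"
    by (subst Bochner_Integration.integral_sum) (auto intro: iS sum_nonpos)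
  have "(\<integral>\<omega>. \<bar>X t \<omega>\<bar> powr p \<partial>M) \<le> (\<integral>\<omega>. D * m t \<omega> powr p + (a * e) powr p
      + (\<Sum>i<N. S i \<omega> * (X (s (Suc i)) \<omega> - X (s i) \<omega>))
      + k * (d * e powr (p - 1) + (\<Sum>i<N. b i \<omega> * max (- X (s (Suc i)) \<omega>) 0)) \<partial>M)"
    (is "_ \<le> (\<integral>\<omega>. ?R \<omega> \<partial>M)")
  proof (rule integral_mono_AE[OF _ _ AE])
    have iR: "integrable M ?R"
      using int iS(1) ib s by (intro Bochner_Integration.integrable_add integrable_mult_right Bochner_Integration.integrable_sum) auto
    then show "integrable M ?R" .
    show "integrable M (\<lambda>\<omega>. \<bar>X t \<omega>\<bar> powr p)"
      by (rule Bochner_Integration.integrable_bound[OF iR]) (use AE in auto)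
  qed
  also have "\<dots> = D * (\<integral>\<omega>. m t \<omega> powr p \<partial>M) + (a * e) powr p
      + (\<integral>\<omega>. (\<Sum>i<N. S i \<omega> * (X (s (Suc i)) \<omega> - X (s i) \<omega>)) \<partial>M)
      + k * (d * e powr (p - 1) + (\<integral>\<omega>. (\<Sum>i<N. b i \<omega> * max (- X (s (Suc i)) \<omega>) 0) \<partial>M))"
    using int iS(1) ib s by (simp add: prob_space)
  also have "\<dots> \<le> D * (\<integral>\<omega>. m t \<omega> powr p \<partial>M) + (a * e) powr p + 0
      + k * (d * e powr (p - 1) + e powr (p - 1) * ?J)"
    by (rule add_mono[OF add_left_mono[OF SS] mult_left_mono[OF add_left_mono[OF bb] k]])
  finally show ?thesis unfolding E_def D_def k_def by (simp add: algebra_simps)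
qed

text \<open>Three limits, in this order: the mesh with \<open>d\<close> and \<open>e\<close> fixed,
  then \<open>d\<close>, then \<open>e\<close>. The factor \<open>e powr (p - 1)\<close> explodes as
  \<open>e\<close> tends to 0, so it has to be removed by \<open>d\<close> before.\<close>

lemma (in complete_filtered_prob_space) fixed_time_estimate:
  assumes p: "0 < p" "p < 1" and a: "0 < a" "1 \<le> (1 - p) * a powr p - p * a powr (p - 1)"
    and X: "supermartingale_nonneg_jumps M F X" and t: "0 \<le> t"
    and int: "integrable M (\<lambda>\<omega>. \<bar>infimum_process X t \<omega>\<bar> powr p)"
  shows "(\<integral>\<omega>. \<bar>X t \<omega>\<bar> powr p \<partial>M) \<le>
      (1 - p) * a powr (p - 1) * (a + 1) * (\<integral>\<omega>. \<bar>infimum_process X t \<omega>\<bar> powr p \<partial>M)"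
proof -
  have cad: "\<And>\<omega>. \<omega> \<in> space M \<Longrightarrow> cadlag (\<lambda>t. X t \<omega>)"
    and jmp: "\<And>\<omega> t. \<omega> \<in> space M \<Longrightarrow> 0 \<le> t \<Longrightarrow> 0 \<le> jump (\<lambda>t. X t \<omega>) t"
    and sm: "supermartingale M F X"
    using X by (auto simp: supermartingale_nonneg_jumps_def)
  have iX: "integrable M (X t)" using sm t by (auto simp: supermartingale_def)
  have XM: "X r \<in> borel_measurable M" if "0 \<le> r" for r
    using sm that by (auto simp: supermartingale_def dest: borel_measurable_integrable)
  have runM: "(\<lambda>\<omega>. run_inf (\<lambda>s. X s \<omega>) r) \<in> borel_measurable M" if r: "0 \<le> r" for r
  proof -
    have "(\<lambda>\<omega>. INF u\<in>insert r (\<rat> \<inter> {0..r}). X u \<omega>) \<in> borel_measurable M"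
      using r by (intro borel_measurable_cINF_real)
        (auto intro!: countable_rat countable_Int1 intro: XM)
    then show ?thesis
      by (rule measurable_cong[THEN iffD1, rotated]) (use run_inf_countable[OF cad r] in auto)
  qed
  define D where "D = (1 - p) * a powr (p - 1) * (a + 1)"
  have D: "0 \<le> D" using p a by (simp add: D_def)
  define k where "k = p * a powr (p - 1)"
  have k: "0 \<le> k" using p by (simp add: k_def)
  let ?x = "\<integral>\<omega>. \<bar>X t \<omega>\<bar> powr p \<partial>M" and ?y = "\<integral>\<omega>. \<bar>infimum_process X t \<omega>\<bar> powr p \<partial>M"
  have est: "?x \<le> D * (?y + e powr p) + (a * e) powr p" if e: "0 < e" for e
  proof -
    define m where "m s \<omega> = max e (- run_inf (\<lambda>s. X s \<omega>) s)" for s \<omega>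
    have mM: "m r \<in> borel_measurable M" if "0 \<le> r" for r
      using runM[OF that] unfolding m_def by measurable
    have inf_eq: "\<bar>infimum_process X t \<omega>\<bar> = max 0 (- run_inf (\<lambda>s. X s \<omega>) t)" for \<omega>
      by (simp add: infimum_process_def run_inf_def min_def max_def)
    have mle: "m t \<omega> powr p \<le> \<bar>infimum_process X t \<omega>\<bar> powr p + e powr p" for \<omega>
      using e by (auto simp: m_def inf_eq max_def)
    have mint: "integrable M (\<lambda>\<omega>. m t \<omega> powr p)"
    proof (rule Bochner_Integration.integrable_bound)
      show "integrable M (\<lambda>\<omega>. \<bar>infimum_process X t \<omega>\<bar> powr p + e powr p)"
        using int by simp
      show "(\<lambda>\<omega>. m t \<omega> powr p) \<in> borel_measurable M"
        using mM[OF t] by measurable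
      show "AE \<omega> in M. norm (m t \<omega> powr p) \<le> norm (\<bar>infimum_process X t \<omega>\<bar> powr p + e powr p)"
        using mle by (intro AE_I2) simp
    qed
    have "(\<integral>\<omega>. m t \<omega> powr p \<partial>M) \<le> (\<integral>\<omega>. \<bar>infimum_process X t \<omega>\<bar> powr p + e powr p \<partial>M)"
      using mint int by (intro integral_mono mle) simp_all
    then have my: "(\<integral>\<omega>. m t \<omega> powr p \<partial>M) \<le> ?y + e powr p" using int by (simp add: prob_space)
    have "?x \<le> D * (\<integral>\<omega>. m t \<omega> powr p \<partial>M) + (a * e) powr p + k * e powr (p - 1) * (d + 0)"
      if d: "0 < d" for d
    proof (rule LIMSEQ_le_const)
      define s where "s N i = t * (real (min i (Suc N)) / real (Suc N))" for N i
      define E where "E N = {\<omega>. \<exists>i<Suc N. d < m (s N (Suc i)) \<omega> - m (s N i) \<omega>}" for N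
      have "(\<lambda>N. \<integral>\<omega>. indicator (E N) \<omega> * max (- X t \<omega>) 0 \<partial>M) \<longlonglongrightarrow> (\<integral>\<omega>. 0 \<partial>M)"
      proof (rule integral_dominated_convergence[where w = "\<lambda>\<omega>. \<bar>X t \<omega>\<bar>"])
        have sN: "0 \<le> s N i" for N i using t by (simp add: s_def)
        note [measurable] = mM[OF sN] XM[OF t]
        show "(\<lambda>\<omega>. indicator (E N) \<omega> * max (- X t \<omega>) 0) \<in> borel_measurable M" for N
          unfolding E_def indicator_def by measurable
        show "AE \<omega> in M. norm (indicator (E N) \<omega> * max (- X t \<omega>) 0) \<le> \<bar>X t \<omega>\<bar>" for N
          by (intro AE_I2) (auto simp: indicator_def)
        show "AE \<omega> in M. (\<lambda>N. indicator (E N) \<omega> * max (- X t \<omega>) 0) \<longlonglongrightarrow> 0"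
        proof (rule AE_I2)
          fix \<omega> assume \<omega>: "\<omega> \<in> space M"
          \<comment> \<open>Here nonnegativity of the jumps enters: the infimum is continuous, hence
            uniformly continuous on \<open>{0..t}\<close>, and a given path lies in
            \<open>E N\<close> for finitely many \<open>N\<close> only.\<close>
          have "continuous_on {0..t} (\<lambda>r. m r \<omega>)"
            unfolding m_def using run_inf_continuous[OF cad[OF \<omega>] jmp[OF \<omega>]]
            by (intro continuous_intros) (auto intro: continuous_on_subset)
          then have "uniformly_continuous_on {0..t} (\<lambda>r. m r \<omega>)"
            by (rule compact_uniformly_continuous) simp
          then obtain h where h: "0 < h" "\<And>u v. u \<in> {0..t} \<Longrightarrow> v \<in> {0..t} \<Longrightarrow> dist v u < h \<Longrightarrow>
              dist (m v \<omega>) (m u \<omega>) < d"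
            by (rule uniformly_continuous_onE[OF _ d]) blast
          have "(\<lambda>N. t / real (Suc N)) \<longlonglongrightarrow> 0"
            using LIMSEQ_Suc[OF lim_const_over_n[of t]] by simp
          then have "eventually (\<lambda>N. t / real (Suc N) < h) sequentially"
            using h by (auto dest: order_tendstoD(2))
          then have "eventually (\<lambda>N. indicator (E N) \<omega> * max (- X t \<omega>) 0 = 0) sequentially"
          proof eventually_elim
            case (elim N)
            have "\<not> d < m (s N (Suc i)) \<omega> - m (s N i) \<omega>" if "i < Suc N" for i
            proof -
              have "s N (Suc i) - s N i = t / real (Suc N)"
                using that by (simp add: s_def flip: right_diff_distrib diff_divide_distrib)
              moreover have "s N j \<le> t" for j
                using mult_left_le[OF _ t, of "real (min j (Suc N)) / real (Suc N)"] by (auto simp: s_def)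
              ultimately show ?thesis using h(2)[of "s N i" "s N (Suc i)"] sN elim t
                by (auto simp: dist_real_def)
            qed
            then show ?case by (auto simp: E_def)
          qed
          then show "(\<lambda>N. indicator (E N) \<omega> * max (- X t \<omega>) 0) \<longlonglongrightarrow> 0" by (rule tendsto_eventually)
        qed
      qed (use iX in auto)
      then have lim: "(\<lambda>N. \<integral>\<omega>. indicator (E N) \<omega> * max (- X t \<omega>) 0 \<partial>M) \<longlonglongrightarrow> 0" by simp
      show "(\<lambda>N. D * (\<integral>\<omega>. m t \<omega> powr p \<partial>M) + (a * e) powr p + k * e powr (p - 1) *
          (d + (\<integral>\<omega>. indicator (E N) \<omega> * max (- X t \<omega>) 0 \<partial>M)))
        \<longlonglongrightarrow> D * (\<integral>\<omega>. m t \<omega> powr p \<partial>M) + (a * e) powr p + k * e powr (p - 1) * (d + 0)"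
        by (intro tendsto_intros lim)
      show "\<exists>N0. \<forall>N\<ge>N0. ?x \<le> D * (\<integral>\<omega>. m t \<omega> powr p \<partial>M) + (a * e) powr p + k * e powr (p - 1) *
          (d + (\<integral>\<omega>. indicator (E N) \<omega> * max (- X t \<omega>) 0 \<partial>M))"
        unfolding D_def k_def E_def
        using grid_estimate[OF p a X t e d m_def mint zero_less_Suc s_def] by blast
    qed
    then have lim: "?x \<le> D * (\<integral>\<omega>. m t \<omega> powr p \<partial>M) + (a * e) powr p + k * e powr (p - 1) * d"
      if "0 < d" for d using that by simp
    have "((\<lambda>d. D * (\<integral>\<omega>. m t \<omega> powr p \<partial>M) + (a * e) powr p + k * e powr (p - 1) * d) \<longlongrightarrow>
        D * (\<integral>\<omega>. m t \<omega> powr p \<partial>M) + (a * e) powr p + k * e powr (p - 1) * 0) (at_right 0)"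
      by (intro tendsto_intros)
    then have "?x \<le> D * (\<integral>\<omega>. m t \<omega> powr p \<partial>M) + (a * e) powr p + k * e powr (p - 1) * 0"
      by (rule tendsto_lowerbound) (auto intro!: lim eventually_at_right_less[THEN eventually_mono])
    also have "\<dots> \<le> D * (?y + e powr p) + (a * e) powr p"
      using mult_left_mono[OF my D] by simp
    finally show ?thesis .
  qed
  have p0: "((\<lambda>e::real. e powr p) \<longlongrightarrow> 0) (at_right 0)"
    using p by (auto intro!: tendsto_eq_intros eventually_at_rightI[of 0 1])
  have "((\<lambda>e. D * (?y + e powr p) + a powr p * e powr p) \<longlongrightarrow> D * (?y + 0) + a powr p * 0) (at_right 0)"
    by (intro tendsto_intros p0)
  then have "?x \<le> D * (?y + 0) + a powr p * 0"
  proof (rule tendsto_lowerbound)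
    have "eventually (\<lambda>e::real. 0 < e) (at_right 0)" by (rule eventually_at_right_less)
    then show "eventually (\<lambda>e. ?x \<le> D * (?y + e powr p) + a powr p * e powr p) (at_right 0)"
      by eventually_elim (use est a in \<open>auto simp: powr_mult\<close>)
  qed simp
  then show ?thesis by (simp add: D_def)
qed

section \<open>Passage to norms with values in the extended half-line\<close>

lemma ennreal_powr_mono:
  assumes "x \<le> y" "0 \<le> a" shows "ennreal_powr x a \<le> ennreal_powr y a"
  using assms by (auto simp: ennreal_powr_def top_unique less_top intro!: ennreal_leI powr_mono2 enn2real_mono)

lemma ennreal_powr_scale:
  assumes "0 < c" "0 < p" shows "ennreal_powr (ennreal (c powr p) * y) (1 / p) = ennreal c * ennreal_powr y (1 / p)"
proof (cases "y = top")
  case True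
  then show ?thesis using assms by (simp add: ennreal_powr_def ennreal_mult_top)
next
  case False
  then obtain r where r: "y = ennreal r" "0 \<le> r" by (cases y) auto
  then show ?thesis using assms
    by (simp add: ennreal_powr_def powr_mult powr_powr flip: ennreal_mult')
qed

text \<open>An infinite moment of the infimum makes the right-hand side infinite because
  \<open>C\<close> is positive. Otherwise the estimate for Lebesgue integrals applies at each time,
  and \<open>1 / p\<close>-th powers and suprema preserve it.\<close>

lemma (in complete_filtered_prob_space) process_norm_le_infimum_process:
  assumes p: "0 < p" "p < 1" and a: "0 < a" "1 \<le> (1 - p) * a powr p - p * a powr (p - 1)"
    and C: "0 < C" "C powr p = (1 - p) * a powr (p - 1) * (a + 1)"
    and X: "supermartingale_nonneg_jumps M F X"
  shows "process_norm M p X \<le> ennreal C * process_norm M p (infimum_process X)"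
proof -
  have fixed: "(\<integral>\<^sup>+ \<omega>. ennreal (\<bar>X t \<omega>\<bar> powr p) \<partial>M) \<le>
      ennreal (C powr p) * (\<integral>\<^sup>+ \<omega>. ennreal (\<bar>infimum_process X t \<omega>\<bar> powr p) \<partial>M)" if t: "0 \<le> t" for t
  proof (cases "(\<integral>\<^sup>+ \<omega>. ennreal (\<bar>infimum_process X t \<omega>\<bar> powr p) \<partial>M) = \<infinity>")
    case True
    have "ennreal (C powr p) * top = top" using C(1) by (simp add: ennreal_mult_top)
    then show ?thesis using True by simp
  next
    case False
    have cad: "\<And>\<omega>. \<omega> \<in> space M \<Longrightarrow> cadlag (\<lambda>t. X t \<omega>)"
      and sm: "supermartingale M F X"
      using X by (auto simp: supermartingale_nonneg_jumps_def)
    have XM: "X r \<in> borel_measurable M" if "0 \<le> r" for r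
      using sm that by (auto simp: supermartingale_def dest: borel_measurable_integrable)
    have "(\<lambda>\<omega>. min (INF u\<in>insert t (\<rat> \<inter> {0..t}). X u \<omega>) 0) \<in> borel_measurable M"
      using t by (intro borel_measurable_min borel_measurable_cINF_real)
        (auto intro!: countable_rat countable_Int1 intro: XM)
    then have iM: "infimum_process X t \<in> borel_measurable M"
      by (rule measurable_cong[THEN iffD1, rotated])
         (use run_inf_countable[OF cad t] in \<open>auto simp: run_inf_def infimum_process_def\<close>)
    have int: "integrable M (\<lambda>\<omega>. \<bar>infimum_process X t \<omega>\<bar> powr p)"
    proof (rule integrableI_nonneg)
      show "(\<integral>\<^sup>+ \<omega>. ennreal (\<bar>infimum_process X t \<omega>\<bar> powr p) \<partial>M) < \<infinity>"
        using False by (metis infinity_ennreal_def less_top)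
      show "(\<lambda>\<omega>. \<bar>infimum_process X t \<omega>\<bar> powr p) \<in> borel_measurable M" using iM by measurable
    qed simp
    have "integrable M (X t)" using sm t by (auto simp: supermartingale_def)
    then have intX: "integrable M (\<lambda>\<omega>. \<bar>X t \<omega>\<bar> powr p)"
    proof (rule Bochner_Integration.integrable_bound[OF Bochner_Integration.integrable_add[OF integrable_const integrable_abs]])
      have "norm (\<bar>X t \<omega>\<bar> powr p) \<le> norm (1 + \<bar>X t \<omega>\<bar>)" for \<omega>
        using powr_mono[of p 1 "\<bar>X t \<omega>\<bar>"] powr_le1[of p "\<bar>X t \<omega>\<bar>"] p(1) less_imp_le[OF p(2)]
        by (cases "\<bar>X t \<omega>\<bar> \<le> 1") auto
      then show "AE \<omega> in M. norm (\<bar>X t \<omega>\<bar> powr p) \<le> norm (1 + \<bar>X t \<omega>\<bar>)" by (rule AE_I2)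
      show "(\<lambda>\<omega>. \<bar>X t \<omega>\<bar> powr p) \<in> borel_measurable M" using XM[OF t] by measurable
    qed
    have "(\<integral>\<^sup>+ \<omega>. ennreal (\<bar>X t \<omega>\<bar> powr p) \<partial>M) = ennreal (\<integral>\<omega>. \<bar>X t \<omega>\<bar> powr p \<partial>M)"
      by (rule nn_integral_eq_integral[OF intX]) simp
    also have "\<dots> \<le> ennreal (C powr p * (\<integral>\<omega>. \<bar>infimum_process X t \<omega>\<bar> powr p \<partial>M))"
      unfolding C(2) by (rule ennreal_leI[OF fixed_time_estimate[OF p a X t int]])
    also have "\<dots> = ennreal (C powr p) * ennreal (\<integral>\<omega>. \<bar>infimum_process X t \<omega>\<bar> powr p \<partial>M)"
      by (rule ennreal_mult') simp
    also have "ennreal (\<integral>\<omega>. \<bar>infimum_process X t \<omega>\<bar> powr p \<partial>M) =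
        (\<integral>\<^sup>+ \<omega>. ennreal (\<bar>infimum_process X t \<omega>\<bar> powr p) \<partial>M)"
      by (rule nn_integral_eq_integral[OF int, symmetric]) simp
    finally show ?thesis .
  qed
  show ?thesis unfolding process_norm_def
  proof (rule SUP_least)
    fix t :: real assume t: "t \<in> {0..}"
    have "ennreal_powr (\<integral>\<^sup>+ \<omega>. ennreal (\<bar>X t \<omega>\<bar> powr p) \<partial>M) (1 / p) \<le>
       ennreal C * ennreal_powr (\<integral>\<^sup>+ \<omega>. ennreal (\<bar>infimum_process X t \<omega>\<bar> powr p) \<partial>M) (1 / p)"
      using ennreal_powr_mono[OF fixed[of t], of "1 / p"] t p C(1) by (simp add: ennreal_powr_scale)
    also have "\<dots> \<le> ennreal C *
        (SUP t\<in>{0..}. ennreal_powr (\<integral>\<^sup>+ \<omega>. ennreal (\<bar>infimum_process X t \<omega>\<bar> powr p) \<partial>M) (1 / p))"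
      using t by (intro mult_left_mono SUP_upper) auto
    finally show "ennreal_powr (\<integral>\<^sup>+ \<omega>. ennreal (\<bar>X t \<omega>\<bar> powr p) \<partial>M) (1 / p) \<le> \<dots>" .
  qed
qed


section \<open>Independence from joint characteristic functions\<close>

lemma (in prob_space) integrable_bounded:
  fixes f :: "'a \<Rightarrow> 'b :: {banach, second_countable_topology}"
  assumes "f \<in> borel_measurable M" "\<And>\<omega>. norm (f \<omega>) \<le> H"
  shows "integrable M f"
  using assms by (intro integrable_const_bound[where B = H]) auto

text \<open>Levy uniqueness for a signed weight: adding a constant to \<open>h\<close> and
  normalising gives a probability density, under which \<open>Y\<close> has the characteristic
  function of \<open>\<mu>\<close> and hence the law \<open>\<mu>\<close>. Subtracting the share of
  the constant, also governed by \<open>\<mu>\<close>, leaves the claim.\<close>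

lemma (in prob_space) weighted_char_real:
  fixes h :: "'a \<Rightarrow> real"
  assumes \<mu>: "real_distribution \<mu>" and Y: "Y \<in> borel_measurable M"
    and h: "h \<in> borel_measurable M" "\<And>\<omega>. \<bar>h \<omega>\<bar> \<le> H"
    and distr: "distr M borel Y = \<mu>"
    and char: "\<And>\<theta>. (CLINT \<omega>|M. of_real (h \<omega>) * iexp (\<theta> * Y \<omega>)) = of_real c * char \<mu> \<theta>"
    and A: "A \<in> sets borel"
  shows "(\<integral>\<omega>. h \<omega> * indicator A (Y \<omega>) \<partial>M) = c * measure \<mu> A"
proof -
  interpret \<mu>: real_distribution \<mu> by fact
  note [measurable] = Y h(1) A
  have ih: "integrable M h" using h by (intro integrable_bounded[where H = H]) auto
  have "(CLINT \<omega>|M. of_real (h \<omega>)) = complex_of_real c" using char[of 0] by (simp add: \<mu>.char_zero)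
  then have c: "(\<integral>\<omega>. h \<omega> \<partial>M) = c" using integral_complex_of_real[of M h] of_real_eq_iff by metis
  \<comment> \<open>The shift is \<open>H + 1\<close> rather than \<open>H\<close>, so that the
    normaliser is at least 1 even when \<open>c = - H\<close>.\<close>
  define Z where "Z = H + 1 + c"
  have Z: "1 \<le> Z"
  proof -
    have "(\<integral>\<omega>. - H \<partial>M) \<le> (\<integral>\<omega>. h \<omega> \<partial>M)"
      using h(2) by (intro integral_mono ih) (auto simp: abs_le_iff minus_le_iff)
    then show ?thesis using c by (simp add: Z_def prob_space)
  qed
  define g where "g \<omega> = (H + 1 + h \<omega>) / Z" for \<omega>
  have [measurable]: "g \<in> borel_measurable M" unfolding g_def by measurable
  have g: "0 \<le> g \<omega>" for \<omega> using h(2)[of \<omega>] Z by (auto simp: g_def abs_le_iff)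
  have ig: "integrable M g" unfolding g_def using ih by simp
  have "(\<integral>\<omega>. g \<omega> \<partial>M) = 1" unfolding g_def using ih c Z by (simp add: prob_space Z_def)
  then have "(\<integral>\<^sup>+ \<omega>. ennreal (g \<omega>) \<partial>M) = 1"
    using g ig by (subst nn_integral_eq_integral) auto
  then have "prob_space (density M g)"
    by (intro prob_spaceI) (simp add: emeasure_density cong: nn_integral_cong)
  then interpret D: prob_space "density M g" .
  define \<nu> where "\<nu> = distr (density M g) borel Y"
  have \<nu>: "real_distribution \<nu>" unfolding \<nu>_def
    by (rule D.real_distribution_distr) simp
  have "char \<nu> = char \<mu>"
  proof
    fix \<theta> :: real
    have "char \<nu> \<theta> = (CLINT \<omega>|density M g. iexp (\<theta> * Y \<omega>))"
      unfolding \<nu>_def char_def by (subst integral_distr) auto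
    also have "\<dots> = (CLINT \<omega>|M. g \<omega> *\<^sub>R iexp (\<theta> * Y \<omega>))"
      using g by (subst integral_density) auto
    also have "\<dots> = (CLINT \<omega>|M. (of_real (H + 1) * iexp (\<theta> * Y \<omega>) + of_real (h \<omega>) * iexp (\<theta> * Y \<omega>)) / of_real Z)"
      by (intro Bochner_Integration.integral_cong) (auto simp: g_def scaleR_conv_of_real field_simps)
    also have "\<dots> = (of_real (H + 1) * (CLINT \<omega>|M. iexp (\<theta> * Y \<omega>)) + (CLINT \<omega>|M. of_real (h \<omega>) * iexp (\<theta> * Y \<omega>))) / of_real Z"
    proof -
      have "integrable M (\<lambda>\<omega>. iexp (\<theta> * Y \<omega>))" by (intro integrable_bounded[where H = 1]) auto
      moreover have "integrable M (\<lambda>\<omega>. of_real (h \<omega>) * iexp (\<theta> * Y \<omega>))"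
        using h(2) by (intro integrable_bounded[where H = H]) (auto simp: norm_mult)
      ultimately show ?thesis by simp
    qed
    also have "(CLINT \<omega>|M. iexp (\<theta> * Y \<omega>)) = char \<mu> \<theta>"
      unfolding distr[symmetric] char_def by (subst integral_distr) auto
    also have "(of_real (H + 1) * char \<mu> \<theta> + (CLINT \<omega>|M. of_real (h \<omega>) * iexp (\<theta> * Y \<omega>))) / of_real Z
        = (of_real Z * char \<mu> \<theta>) / of_real Z"
      unfolding char by (simp add: Z_def algebra_simps)
    also have "\<dots> = char \<mu> \<theta>" using Z by simp
    finally show "char \<nu> \<theta> = char \<mu> \<theta>" .
  qed
  then have "\<nu> = \<mu>" by (rule Levy_uniqueness[OF \<nu> \<mu>])
  then have "measure \<mu> A = (\<integral>x. indicator A x \<partial>\<nu>)" using A by simp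
  also have "\<dots> = (\<integral>\<omega>. indicator A (Y \<omega>) \<partial>density M g)"
    unfolding \<nu>_def by (subst integral_distr) auto
  also have "\<dots> = (\<integral>\<omega>. ((H + 1) * indicator A (Y \<omega>) + h \<omega> * indicator A (Y \<omega>)) / Z \<partial>M)"
    using g by (subst integral_density) (auto simp: g_def field_simps intro!: Bochner_Integration.integral_cong)
  also have "\<dots> = ((H + 1) * (\<integral>\<omega>. indicator A (Y \<omega>) \<partial>M) + (\<integral>\<omega>. h \<omega> * indicator A (Y \<omega>) \<partial>M)) / Z"
  proof -
    have "integrable M (\<lambda>\<omega>. indicator A (Y \<omega>) :: real)" by (intro integrable_bounded[where H = 1]) (auto split: split_indicator)
    moreover have "\<bar>h \<omega> * indicator A (Y \<omega>)\<bar> \<le> H" for \<omega>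
      using h(2)[of \<omega>] by (auto split: split_indicator)
    then have "integrable M (\<lambda>\<omega>. h \<omega> * indicator A (Y \<omega>))" by (intro integrable_bounded[where H = H]) auto
    ultimately show ?thesis by simp
  qed
  also have "(\<integral>\<omega>. indicator A (Y \<omega>) \<partial>M) = measure \<mu> A"
  proof -
    have "measure \<mu> A = (\<integral>x. indicator A x \<partial>distr M borel Y)" using A distr by simp
    also have "\<dots> = (\<integral>\<omega>. indicator A (Y \<omega>) \<partial>M)" by (subst integral_distr) auto
    finally show ?thesis by simp
  qed
  finally have "measure \<mu> A * Z = (H + 1) * measure \<mu> A + (\<integral>\<omega>. h \<omega> * indicator A (Y \<omega>) \<partial>M)"
    using Z by (simp add: field_simps)
  then show ?thesis by (simp add: Z_def algebra_simps)
qed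

text \<open>Real and imaginary part of \<open>h\<close> are treated separately. The hypothesis for
  the conjugate of \<open>h\<close> follows by conjugating the one for \<open>h\<close> at the
  argument \<open>- \<theta>\<close>.\<close>

lemma (in prob_space) weighted_char_complex:
  fixes h :: "'a \<Rightarrow> complex"
  assumes \<mu>: "real_distribution \<mu>" and Y: "Y \<in> borel_measurable M"
    and h: "h \<in> borel_measurable M" "\<And>\<omega>. cmod (h \<omega>) \<le> H"
    and distr: "distr M borel Y = \<mu>"
    and char: "\<And>\<theta>. (CLINT \<omega>|M. h \<omega> * iexp (\<theta> * Y \<omega>)) = c * char \<mu> \<theta>"
    and A: "A \<in> sets borel"
  shows "(CLINT \<omega>|M. h \<omega> * of_real (indicator A (Y \<omega>))) = c * of_real (measure \<mu> A)"
proof -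
  note [measurable] = Y h(1) A
  have i1: "integrable M (\<lambda>\<omega>. h \<omega> * iexp (\<theta> * Y \<omega>))" for \<theta>
    using h(2) by (intro integrable_bounded[where H = H]) (auto simp: norm_mult)
  have cnj: "(CLINT \<omega>|M. cnj (h \<omega>) * iexp (\<theta> * Y \<omega>)) = cnj c * char \<mu> \<theta>" for \<theta>
  proof -
    have "(CLINT \<omega>|M. cnj (h \<omega>) * iexp (\<theta> * Y \<omega>)) = (CLINT \<omega>|M. cnj (h \<omega> * iexp ((- \<theta>) * Y \<omega>)))"
      by (intro Bochner_Integration.integral_cong) (auto simp: exp_cnj)
    also have "\<dots> = cnj (CLINT \<omega>|M. h \<omega> * iexp ((- \<theta>) * Y \<omega>))" by (rule Bochner_Integration.integral_cnj)
    also have "\<dots> = cnj c * cnj (char \<mu> (- \<theta>))" unfolding char by simp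
    also have "cnj (char \<mu> (- \<theta>)) = char \<mu> \<theta>"
      unfolding char_def Bochner_Integration.integral_cnj[symmetric]
      by (intro Bochner_Integration.integral_cong) (auto simp: exp_cnj)
    finally show ?thesis .
  qed
  have [measurable]: "(\<lambda>\<omega>. cnj (h \<omega>)) \<in> borel_measurable M"
    using h(1) by (rule measurable_compose) (intro borel_measurable_continuous_onI continuous_intros)
  have i2: "integrable M (\<lambda>\<omega>. cnj (h \<omega>) * iexp (\<theta> * Y \<omega>))" for \<theta>
    using h(2) by (intro integrable_bounded[where H = H]) (auto simp: norm_mult)
  have re: "(\<integral>\<omega>. Re (h \<omega>) * indicator A (Y \<omega>) \<partial>M) = Re c * measure \<mu> A"
  proof (rule weighted_char_real[OF \<mu> Y _ _ distr _ A, of _ H])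
    show "\<bar>Re (h \<omega>)\<bar> \<le> H" for \<omega> using abs_Re_le_cmod[of "h \<omega>"] h(2)[of \<omega>] by linarith
    fix \<theta>
    have "(CLINT \<omega>|M. of_real (Re (h \<omega>)) * iexp (\<theta> * Y \<omega>)) =
        (CLINT \<omega>|M. (h \<omega> * iexp (\<theta> * Y \<omega>) + cnj (h \<omega>) * iexp (\<theta> * Y \<omega>)) / 2)"
      by (intro Bochner_Integration.integral_cong) (auto simp: complex_add_cnj simp flip: distrib_right)
    also have "\<dots> = (c * char \<mu> \<theta> + cnj c * char \<mu> \<theta>) / 2"
      using i1 i2 char cnj by simp
    also have "\<dots> = of_real (Re c) * char \<mu> \<theta>" by (simp add: complex_add_cnj flip: distrib_right)
    finally show "(CLINT \<omega>|M. of_real (Re (h \<omega>)) * iexp (\<theta> * Y \<omega>)) = of_real (Re c) * char \<mu> \<theta>" .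
  qed simp
  have im: "(\<integral>\<omega>. Im (h \<omega>) * indicator A (Y \<omega>) \<partial>M) = Im c * measure \<mu> A"
  proof (rule weighted_char_real[OF \<mu> Y _ _ distr _ A, of _ H])
    show "\<bar>Im (h \<omega>)\<bar> \<le> H" for \<omega> using abs_Im_le_cmod[of "h \<omega>"] h(2)[of \<omega>] by linarith
    fix \<theta>
    have im: "complex_of_real (Im z) = (z - cnj z) / (2 * \<i>)" for z
      by (subst eq_divide_eq) (simp add: complex_eq_iff)
    have "(CLINT \<omega>|M. of_real (Im (h \<omega>)) * iexp (\<theta> * Y \<omega>)) =
        (CLINT \<omega>|M. (h \<omega> * iexp (\<theta> * Y \<omega>) - cnj (h \<omega>) * iexp (\<theta> * Y \<omega>)) / (2 * \<i>))"
      unfolding im by (intro Bochner_Integration.integral_cong) (auto simp: left_diff_distrib)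
    also have "\<dots> = (c * char \<mu> \<theta> - cnj c * char \<mu> \<theta>) / (2 * \<i>)"
      using i1 i2 char cnj by (simp del: divide_divide_eq_left)
    also have "\<dots> = of_real (Im c) * char \<mu> \<theta>" unfolding im by (simp add: left_diff_distrib)
    finally show "(CLINT \<omega>|M. of_real (Im (h \<omega>)) * iexp (\<theta> * Y \<omega>)) = of_real (Im c) * char \<mu> \<theta>" .
  qed simp
  have "(CLINT \<omega>|M. h \<omega> * of_real (indicator A (Y \<omega>))) =
    (CLINT \<omega>|M. of_real (Re (h \<omega>) * indicator A (Y \<omega>)) + \<i> * of_real (Im (h \<omega>) * indicator A (Y \<omega>)))"
    by (intro Bochner_Integration.integral_cong) (auto simp: complex_eq_iff)
  also have "\<dots> = of_real (Re c * measure \<mu> A) + \<i> * of_real (Im c * measure \<mu> A)"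
  proof -
    have "\<bar>Re (h \<omega>) * indicator A (Y \<omega>)\<bar> \<le> H" "\<bar>Im (h \<omega>) * indicator A (Y \<omega>)\<bar> \<le> H" for \<omega>
      using abs_Re_le_cmod[of "h \<omega>"] abs_Im_le_cmod[of "h \<omega>"] h(2)[of \<omega>]
      by (auto split: split_indicator)
    then have "integrable M (\<lambda>\<omega>. Re (h \<omega>) * indicator A (Y \<omega>))" "integrable M (\<lambda>\<omega>. Im (h \<omega>) * indicator A (Y \<omega>))"
      by (auto intro!: integrable_bounded[where H = H])
    then show ?thesis using re im
      by (subst Bochner_Integration.integral_add)
         (auto simp: integral_complex_of_real simp del: of_real_mult)
  qed
  also have "\<dots> = c * of_real (measure \<mu> A)" by (simp add: complex_eq_iff)
  finally show ?thesis .
qed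

text \<open>Exponentials are exchanged for indicators one coordinate at a time. In the induction the
  weight consists of the indicators obtained so far and the exponentials of the coordinates still to
  come; when all are exchanged, the product formula for probabilities remains. The marginal laws
  come from setting all other arguments to 0.\<close>

theorem (in prob_space) indep_vars_char:
  fixes Y :: "'i \<Rightarrow> 'a \<Rightarrow> real"
  assumes I: "finite I" and Y: "\<And>i. i \<in> I \<Longrightarrow> Y i \<in> borel_measurable M"
    and \<mu>: "\<And>i. i \<in> I \<Longrightarrow> real_distribution (\<mu> i)"
    and char: "\<And>\<theta>. (CLINT \<omega>|M. iexp (\<Sum>i\<in>I. \<theta> i * Y i \<omega>)) = (\<Prod>i\<in>I. char (\<mu> i) (\<theta> i))"
  shows "indep_vars (\<lambda>_. borel) Y I" and "\<And>i. i \<in> I \<Longrightarrow> distr M borel (Y i) = \<mu> i"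
proof -
  have char0: "char (\<mu> i) 0 = 1" if "i \<in> I" for i
    using \<mu>[OF that] by (rule real_distribution.char_zero)
  show distr: "distr M borel (Y i) = \<mu> i" if i: "i \<in> I" for i
  proof (rule Levy_uniqueness[OF _ \<mu>[OF i]])
    show "real_distribution (distr M borel (Y i))" using Y[OF i] by simp
    show "char (distr M borel (Y i)) = char (\<mu> i)"
    proof
      fix \<theta>
      have "char (distr M borel (Y i)) \<theta> = (CLINT \<omega>|M. iexp (\<theta> * Y i \<omega>))"
        unfolding char_def using Y[OF i] by (subst integral_distr) auto
      also have "(\<lambda>\<omega>. iexp (\<theta> * Y i \<omega>)) = (\<lambda>\<omega>. iexp (\<Sum>j\<in>I. (if j = i then \<theta> else 0) * Y j \<omega>))"
        using I i by (simp add: if_distrib[of "\<lambda>x. x * _"] sum.delta cong: if_cong)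
      also have "(CLINT \<omega>|M. \<dots> \<omega>) = (\<Prod>j\<in>I. char (\<mu> j) (if j = i then \<theta> else 0))" by (rule char)
      also have "\<dots> = (\<Prod>j\<in>I. if j = i then char (\<mu> i) \<theta> else 1)"
        using char0 by (intro prod.cong) auto
      also have "\<dots> = char (\<mu> i) \<theta>" using I i by simp
      finally show "char (distr M borel (Y i)) \<theta> = char (\<mu> i) \<theta>" .
    qed
  qed
  have ind: "(CLINT \<omega>|M. (\<Prod>j\<in>J. of_real (indicator (A j) (Y j \<omega>))) * iexp (\<Sum>i\<in>I - J. \<theta> i * Y i \<omega>)) =
      (\<Prod>j\<in>J. of_real (measure (\<mu> j) (A j))) * (\<Prod>i\<in>I - J. char (\<mu> i) (\<theta> i))"
    if "J \<subseteq> I" "\<And>j. j \<in> J \<Longrightarrow> A j \<in> sets borel" for J and A :: "'i \<Rightarrow> real set" and \<theta>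
    using finite_subset[OF that(1) I] that
  proof (induction J arbitrary: \<theta>)
    case empty
    then show ?case using char by simp
  next
    case (insert k J)
    have k: "k \<in> I" "k \<notin> J" using insert by auto
    note [measurable] = Y
    have [measurable]: "A k \<in> sets borel" "j \<in> J \<Longrightarrow> A j \<in> sets borel" for j using insert by auto
    define I' where "I' = I - insert k J"
    have I': "I - J = insert k I'" "k \<notin> I'" "finite I'" "I' \<subseteq> I" using k I by (auto simp: I'_def)
    define h where "h \<omega> = (\<Prod>j\<in>J. complex_of_real (indicator (A j) (Y j \<omega>))) * iexp (\<Sum>i\<in>I'. \<theta> i * Y i \<omega>)" for \<omega>
    have JY: "\<And>j. j \<in> J \<Longrightarrow> Y j \<in> borel_measurable M" "\<And>j. j \<in> I' \<Longrightarrow> Y j \<in> borel_measurable M"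
      using insert I' Y by auto
    have hM: "h \<in> borel_measurable M" unfolding h_def
    proof (intro borel_measurable_times borel_measurable_prod)
      fix j assume j: "j \<in> J"
      note [measurable] = JY(1)[OF j] 
      have [measurable]: "A j \<in> sets borel" using j insert by auto
      show "(\<lambda>\<omega>. complex_of_real (indicator (A j) (Y j \<omega>))) \<in> borel_measurable M" by measurable
    next
      have [measurable]: "(\<lambda>\<omega>. \<Sum>i\<in>I'. \<theta> i * Y i \<omega>) \<in> borel_measurable M"
        using JY(2) by measurable
      show "(\<lambda>\<omega>. iexp (\<Sum>i\<in>I'. \<theta> i * Y i \<omega>)) \<in> borel_measurable M" by measurable
    qed
    have h1: "cmod (h \<omega>) \<le> 1" for \<omega>
    proof -
      have "cmod (\<Prod>j\<in>J. complex_of_real (indicator (A j) (Y j \<omega>))) \<le> 1"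
        by (auto simp: prod_norm[symmetric] intro!: prod_le_1)
      then show ?thesis by (simp add: h_def norm_mult)
    qed
    define c where "c = (\<Prod>j\<in>J. complex_of_real (measure (\<mu> j) (A j))) * (\<Prod>i\<in>I'. char (\<mu> i) (\<theta> i))"
    have "(CLINT \<omega>|M. h \<omega> * iexp (\<eta> * Y k \<omega>)) = c * char (\<mu> k) \<eta>" for \<eta>
    proof -
      have "(\<Sum>i\<in>I - J. (\<theta>(k := \<eta>)) i * Y i \<omega>) = \<eta> * Y k \<omega> + (\<Sum>i\<in>I'. \<theta> i * Y i \<omega>)" for \<omega>
        unfolding I'(1) using I'(2,3) by (auto intro!: sum.cong)
      moreover have "(\<Prod>i\<in>I - J. char (\<mu> i) ((\<theta>(k := \<eta>)) i)) = char (\<mu> k) \<eta> * (\<Prod>i\<in>I'. char (\<mu> i) (\<theta> i))"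
        unfolding I'(1) using I'(2,3) by (auto intro!: prod.cong)
      ultimately show ?thesis
        using insert.IH[of "\<theta>(k := \<eta>)"] insert.prems
        by (simp add: h_def c_def distrib_left exp_add mult_ac)
    qed
    then have "(CLINT \<omega>|M. h \<omega> * of_real (indicator (A k) (Y k \<omega>))) = c * of_real (measure (\<mu> k) (A k))"
      using insert.prems by (intro weighted_char_complex[OF \<mu>[OF k(1)] Y[OF k(1)] hM h1 distr[OF k(1)]]) auto
    then show ?case
      using insert.hyps k by (simp add: h_def c_def I'_def mult_ac)
  qed
  have prodm: "prob (\<Inter>j\<in>I. Y j -` A j \<inter> space M) = (\<Prod>j\<in>I. measure (\<mu> j) (A j))"
    if "I \<noteq> {}" "\<And>j. j \<in> I \<Longrightarrow> A j \<in> sets borel" for A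
  proof -
    have e: "(\<Inter>j\<in>I. Y j -` A j \<inter> space M) \<in> events"
      using that I Y by (intro sets.finite_INT) auto
    have "complex_of_real (prob (\<Inter>j\<in>I. Y j -` A j \<inter> space M)) =
        of_real (\<integral>\<omega>. indicator (\<Inter>j\<in>I. Y j -` A j \<inter> space M) \<omega> \<partial>M)" using e by simp
    also have "\<dots> = (CLINT \<omega>|M. of_real (indicator (\<Inter>j\<in>I. Y j -` A j \<inter> space M) \<omega>))"
      by (rule integral_complex_of_real[symmetric])
    also have "\<dots> = (CLINT \<omega>|M. (\<Prod>j\<in>I. of_real (indicator (A j) (Y j \<omega>))))"
    proof (intro Bochner_Integration.integral_cong refl)
      fix \<omega> assume "\<omega> \<in> space M"
      then show "complex_of_real (indicator (\<Inter>j\<in>I. Y j -` A j \<inter> space M) \<omega>) =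
          (\<Prod>j\<in>I. of_real (indicator (A j) (Y j \<omega>)))"
        using that(1) I by (auto simp: indicator_def)
    qed
    also have "\<dots> = of_real (\<Prod>j\<in>I. measure (\<mu> j) (A j))"
      using ind[of I A "\<lambda>_. 0"] that by simp
    finally show ?thesis using of_real_eq_iff by blast
  qed
  show "indep_vars (\<lambda>_. borel) Y I"
  proof (cases "I = {}")
    case True
    then show ?thesis by (simp add: indep_vars_def indep_sets_def)
  next
    case False
    show ?thesis
    proof (subst indep_vars_finite[where E = "\<lambda>_. sets borel"])
      show "\<forall>A\<in>I \<rightarrow> sets borel. prob (\<Inter>j\<in>I. Y j -` A j \<inter> space M) = (\<Prod>j\<in>I. prob (Y j -` A j \<inter> space M))"
      proof
        fix A assume A: "A \<in> I \<rightarrow> (sets borel :: real set set)"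
        have "prob (Y j -` A j \<inter> space M) = measure (\<mu> j) (A j)" if "j \<in> I" for j
          using A that Y[OF that] unfolding distr[OF that, symmetric] by (subst measure_distr) auto
        then show "prob (\<Inter>j\<in>I. Y j -` A j \<inter> space M) = (\<Prod>j\<in>I. prob (Y j -` A j \<inter> space M))"
          using A by (subst prodm[OF False]) (auto intro!: prod.cong)
      qed
    qed (use False I Y in \<open>auto simp: sets.Int_stable sets.sigma_sets_eq[of borel, simplified]\<close>)
  qed
qed


section \<open>Existence of Brownian motion\<close>

text \<open>The completion is taken because \<open>stopped_brownian_motion\<close> asks for a
  complete measure.\<close>

definition gauss_space :: "(nat \<Rightarrow> real) measure" where
  "gauss_space = completion (\<Pi>\<^sub>M n\<in>UNIV. std_normal_distribution)"

lemma prob_space_gauss_PiM: "prob_space (\<Pi>\<^sub>M n\<in>(UNIV :: nat set). std_normal_distribution)"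
  by (intro prob_space_PiM prob_space_normal_density) simp

lemma prob_space_gauss_space: "prob_space gauss_space"
proof -
  interpret P: prob_space "\<Pi>\<^sub>M n\<in>(UNIV :: nat set). std_normal_distribution"
    by (rule prob_space_gauss_PiM)
  show ?thesis by (intro prob_spaceI) (simp add: gauss_space_def P.emeasure_space_1)
qed

lemma complete_gauss_space: "complete_measure gauss_space"
  unfolding gauss_space_def by (rule completion.complete_measure_axioms)

lemma space_gauss_space[simp]: "space gauss_space = UNIV"
  by (simp add: gauss_space_def space_PiM)

lemma coordinate_PiM_measurable: "(\<lambda>\<omega>. \<omega> n) \<in> borel_measurable (\<Pi>\<^sub>M n\<in>(UNIV :: nat set). std_normal_distribution)"
  using measurable_component_singleton[of n UNIV "\<lambda>_. std_normal_distribution"]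
  by (simp cong: measurable_cong_sets)

lemma coordinate_measurable[measurable]: "(\<lambda>\<omega>. \<omega> n) \<in> borel_measurable gauss_space"
  unfolding gauss_space_def by (intro measurable_completion coordinate_PiM_measurable)

lemma distr_coordinate: "distr gauss_space borel (\<lambda>\<omega>. \<omega> n) = std_normal_distribution"
proof -
  interpret P: product_prob_space "\<lambda>_. std_normal_distribution" "UNIV :: nat set"
    by (intro product_prob_spaceI prob_space_normal_density) simp
  have "distr gauss_space borel (\<lambda>\<omega>. \<omega> n) =
      distr (\<Pi>\<^sub>M n\<in>(UNIV :: nat set). std_normal_distribution) borel (\<lambda>\<omega>. \<omega> n)"
    unfolding gauss_space_def by (rule distr_completion[OF coordinate_PiM_measurable])
  also have "\<dots> = distr (\<Pi>\<^sub>M n\<in>(UNIV :: nat set). std_normal_distribution) std_normal_distribution (\<lambda>\<omega>. \<omega> n)"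
    by (rule distr_cong) auto
  also have "\<dots> = std_normal_distribution" by (rule P.PiM_component) simp
  finally show ?thesis .
qed

lemma char_gauss_sum:
  assumes J: "finite J"
  shows "(CLINT \<omega>|gauss_space. iexp (\<Sum>n\<in>J. c n * \<omega> n)) = exp (- (\<Sum>n\<in>J. (c n)\<^sup>2) / 2)"
proof -
  let ?P = "\<Pi>\<^sub>M n\<in>(UNIV :: nat set). std_normal_distribution"
  interpret P: prob_space ?P by (rule prob_space_gauss_PiM)
  interpret PP: product_prob_space "\<lambda>_. std_normal_distribution" "UNIV :: nat set"
    by (intro product_prob_spaceI prob_space_normal_density) simp
  note [measurable] = coordinate_PiM_measurable
  have d: "distr ?P std_normal_distribution (\<lambda>\<omega>. \<omega> n) = std_normal_distribution" for n
    by (rule PP.PiM_component) simp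
  have "P.indep_vars (\<lambda>_. std_normal_distribution) (\<lambda>n \<omega>. \<omega> n) UNIV"
    by (subst P.indep_vars_iff_distr_eq_PiM) (simp_all add: d restrict_def distr_id2[OF refl])
  then have "P.indep_vars (\<lambda>_. borel) (\<lambda>n \<omega>. c n * \<omega> n) UNIV"
    by (rule P.indep_vars_compose2) simp
  then have ind: "P.indep_vars (\<lambda>_. borel) (\<lambda>n \<omega>. c n * \<omega> n) J"
    by (rule P.indep_vars_subset) simp
  have "(CLINT \<omega>|gauss_space. iexp (\<Sum>n\<in>J. c n * \<omega> n)) = (CLINT \<omega>|?P. iexp (\<Sum>n\<in>J. c n * \<omega> n))"
    unfolding gauss_space_def by (intro integral_completion) measurable
  also have "\<dots> = char (distr ?P borel (\<lambda>\<omega>. \<Sum>n\<in>J. c n * \<omega> n)) 1"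
    unfolding char_def by (subst integral_distr) auto
  also have "\<dots> = (\<Prod>n\<in>J. char (distr ?P borel (\<lambda>\<omega>. c n * \<omega> n)) 1)"
    by (rule P.char_distr_sum[OF ind])
  also have "\<dots> = (\<Prod>n\<in>J. complex_of_real (exp (- ((c n)\<^sup>2) / 2)))"
  proof (intro prod.cong refl)
    fix n
    have "char (distr ?P borel (\<lambda>\<omega>. c n * \<omega> n)) 1 = (CLINT \<omega>|?P. iexp (c n * \<omega> n))"
      unfolding char_def by (subst integral_distr) auto
    also have "\<dots> = (CLINT x|distr ?P std_normal_distribution (\<lambda>\<omega>. \<omega> n). iexp (c n * x))"
      by (subst integral_distr) (auto cong: measurable_cong_sets)
    also have "\<dots> = char std_normal_distribution (c n)" unfolding d char_def ..
    also have "\<dots> = exp (- ((c n)\<^sup>2) / 2)" by (simp add: char_std_normal_distribution)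
    finally show "char (distr ?P borel (\<lambda>\<omega>. c n * \<omega> n)) 1 = complex_of_real (exp (- ((c n)\<^sup>2) / 2))" by simp
  qed
  also have "\<dots> = exp (- (\<Sum>n\<in>J. (c n)\<^sup>2) / 2)"
    by (simp add: exp_sum[OF J, symmetric] sum_divide_distrib sum_negf flip: of_real_prod of_real_exp)
  finally show ?thesis .
qed

lemma coordinate_fourth_moment: "(\<integral>\<^sup>+ \<omega>. ennreal ((\<omega> n) ^ 4) \<partial>gauss_space) = 3"
proof -
  have "(\<integral>\<^sup>+ \<omega>. ennreal ((\<omega> n) ^ 4) \<partial>gauss_space) =
      (\<integral>\<^sup>+ x. ennreal (x ^ 4) \<partial>distr gauss_space borel (\<lambda>\<omega>. \<omega> n))"
    by (subst nn_integral_distr) auto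
  also have "\<dots> = (\<integral>\<^sup>+ x. ennreal (std_normal_density x * x ^ (2 * 2)) \<partial>lborel)"
    unfolding distr_coordinate by (subst nn_integral_density) (auto simp: ennreal_mult')
  also have "\<dots> = ennreal (fact (2 * 2) / (2 ^ 2 * fact 2))"
    by (rule nn_integral_eq_integral[THEN trans])
       (use std_normal_moment_even[of 2] in \<open>auto simp: has_bochner_integral_iff\<close>)
  also have "\<dots> = 3" by (simp add: fact_numeral)
  finally show ?thesis .
qed

section \<open>Integrated Haar functions and the covariance of Brownian motion\<close>

text \<open>The primitive of the indicator of the unit interval.\<close>

definition ramp :: "real \<Rightarrow> real" where "ramp x = max 0 (min 1 x)"

text \<open>Twice the primitive of the Haar function on the unit interval: a tent of height 1 with
  its peak at \<open>1 / 2\<close>.\<close>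

definition hat :: "real \<Rightarrow> real" where "hat x = ramp (2 * x) - ramp (2 * x - 1)"

lemma ramp_bounds: "0 \<le> ramp x" "ramp x \<le> 1" by (auto simp: ramp_def)

lemma ramp_mono: "x \<le> y \<Longrightarrow> ramp x \<le> ramp y" by (auto simp: ramp_def)

lemma hat_nonneg: "0 \<le> hat x" using ramp_mono[of "2 * x - 1" "2 * x"] by (simp add: hat_def)

lemma hat_nonpos: "x \<le> 0 \<Longrightarrow> hat x = 0" by (simp add: hat_def ramp_def)

lemma ramp_eq_half: "ramp x = (ramp (2 * x) + ramp (2 * x - 1)) / 2" by (auto simp: ramp_def max_def min_def)

lemma continuous_ramp: "continuous_on A f \<Longrightarrow> continuous_on A (\<lambda>x. ramp (f x))"
  unfolding ramp_def by (intro continuous_intros)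

lemma continuous_hat: "continuous_on A f \<Longrightarrow> continuous_on A (\<lambda>x. hat (f x))"
  unfolding hat_def by (intro continuous_intros continuous_ramp)

lemma sum_ramp: "0 \<le> x \<Longrightarrow> (\<Sum>k<K. ramp (x - real k)) = min x (real K)"
  by (induction K) (auto simp: ramp_def min_def max_def)

text \<open>The tents have disjoint interiors. Monotonicity of \<open>ramp\<close> enlarges each of
  them to a difference in a telescoping sum.\<close>

lemma sum_hat_le_1: "(\<Sum>k<K. hat (x - real k)) \<le> 1"
proof -
  have "(\<Sum>k<K. hat (x - real k)) \<le> (\<Sum>k<K. ramp (2 * x - 2 * real k) - ramp (2 * x - 2 * real (Suc k)))"
  proof (rule sum_mono)
    fix k
    have "ramp (2 * x - 2 * real (Suc k)) \<le> ramp (2 * (x - real k) - 1)" by (rule ramp_mono) simp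
    then show "hat (x - real k) \<le> ramp (2 * x - 2 * real k) - ramp (2 * x - 2 * real (Suc k))"
      by (simp add: hat_def right_diff_distrib)
  qed
  also have "\<dots> = ramp (2 * x - 2 * real 0) - ramp (2 * x - 2 * real K)"
    by (rule sum_lessThan_telescope')
  also have "\<dots> \<le> 1" using ramp_bounds(2)[of "2 * x"] ramp_bounds(1)[of "2 * x - 2 * real K"] by simp
  finally show ?thesis .
qed

text \<open>The inner product of the projections of the indicators of \<open>[0, x]\<close> and
  \<open>[0, y]\<close> to step functions on the first \<open>K\<close> unit cells, an approximation
  of \<open>min x y\<close>.\<close>

definition ramp_kernel :: "nat \<Rightarrow> real \<Rightarrow> real \<Rightarrow> real" where
  "ramp_kernel K x y = (\<Sum>k<K. ramp (x - real k) * ramp (y - real k))"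

lemma sum_even_odd: "(\<Sum>k<2 * K. f k) = (\<Sum>k<K. f (2 * k) + f (Suc (2 * k)))"
  for f :: "nat \<Rightarrow> 'a :: comm_monoid_add"
  by (induction K) (auto simp: add_ac)

text \<open>Halving the cells adds precisely one level of Haar functions: on each cell a pair of
  values is replaced by its mean and its difference.\<close>

lemma ramp_kernel_refine:
  "ramp_kernel (2 * K) (2 * x) (2 * y) / 2 =
     ramp_kernel K x y + (\<Sum>k<K. hat (x - real k) * hat (y - real k)) / 4"
proof -
  have 1: "2 * x - real (2 * k) = 2 * (x - real k)" "2 * x - real (Suc (2 * k)) = 2 * (x - real k) - 1"
    for x k by simp_all
  have "(u * u' + v * v') / 2 = (u + v) / 2 * ((u' + v') / 2) + (u - v) * (u' - v') / 4" for u v u' v' :: real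
    by (simp add: field_simps)
  then have 2: "(ramp (2 * a) * ramp (2 * b) + ramp (2 * a - 1) * ramp (2 * b - 1)) / 2 =
      ramp a * ramp b + hat a * hat b / 4" for a b
    by (simp add: hat_def ramp_eq_half[of a] ramp_eq_half[of b])
  show ?thesis
    unfolding ramp_kernel_def sum_even_odd 1 sum_divide_distrib sum.distrib[symmetric] 2 ..
qed

lemma ramp_kernel_commute: "ramp_kernel K x y = ramp_kernel K y x"
  by (simp add: ramp_kernel_def mult.commute)

text \<open>For \<open>x <= y\<close>, replacing the second factor by 1 gives an upper bound that
  sums to \<open>x\<close>. A lower bound is the sum shifted by one cell, because both factors are 1
  wherever \<open>ramp (x - real (Suc k))\<close> is positive. The two sums differ by at most one
  cell.\<close>

lemma ramp_kernel_approx: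
  assumes "0 \<le> x" "0 \<le> y" "x \<le> real K" "y \<le> real K"
  shows "\<bar>ramp_kernel K x y - min x y\<bar> \<le> 1"
proof -
  have *: "\<bar>ramp_kernel K x y - x\<bar> \<le> 1" if "0 \<le> x" "x \<le> y" "x \<le> real K" for x y
  proof -
    have "ramp_kernel K x y \<le> (\<Sum>k<K. ramp (x - real k))"
      unfolding ramp_kernel_def using ramp_bounds by (intro sum_mono mult_left_le) auto
    moreover have "(\<Sum>k<K. ramp (x - real (Suc k))) \<le> ramp_kernel K x y"
      unfolding ramp_kernel_def using that by (intro sum_mono) (auto simp: ramp_def max_def min_def)
    moreover have "(\<Sum>k<Suc K. ramp (x - real k)) = ramp x + (\<Sum>k<K. ramp (x - real (Suc k)))"
      by (subst sum.lessThan_Suc_shift) simp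
    ultimately show ?thesis using sum_ramp[OF that(1), of K] sum_ramp[OF that(1), of "Suc K"] that ramp_bounds(2)[of x]
      by simp
  qed
  show ?thesis
    using *[of x y] *[of y x] assms by (auto simp: min_def ramp_kernel_commute)
qed

text \<open>The factor is the peak of the primitive of the Haar function with unit norm on an
  interval of length \<open>1 / 2 ^ (i - 1)\<close>.\<close>

definition schauder :: "nat \<times> nat \<Rightarrow> real \<Rightarrow> real" where
  "schauder = (\<lambda>(i, k) t. if i = 0 then ramp (t - real k)
     else hat (2 ^ (i - 1) * t - real k) / (2 * sqrt (2 ^ (i - 1))))"

text \<open>The first coordinate is the level: level \<open>0\<close> has the unit intervals, level \<open>Suc n\<close> the
  intervals of length \<open>2 ^ -n\<close>. The functions of these sets are those that live in \<open>[0, K]\<close>.\<close>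

definition schauder_index :: "nat \<Rightarrow> nat \<Rightarrow> (nat \<times> nat) set" where
  "schauder_index K N = Sigma {..N} (\<lambda>i. {..<K * 2 ^ (i - 1)})"

lemma finite_schauder_index: "finite (schauder_index K N)" by (simp add: schauder_index_def)

text \<open>By \<open>ramp_kernel_refine\<close> every level refines the grid once, so the
  covariance up to level \<open>N\<close> collapses to a single kernel on the grid of mesh
  \<open>1 / 2 ^ N\<close>.\<close>

lemma sum_schauder:
  "(\<Sum>x\<in>schauder_index K N. schauder x s * schauder x t) =
     ramp_kernel (K * 2 ^ N) (2 ^ N * s) (2 ^ N * t) / 2 ^ N"
proof -
  have "(\<Sum>x\<in>schauder_index K N. schauder x s * schauder x t) =
    (\<Sum>i\<le>N. \<Sum>k<K * 2 ^ (i - 1). schauder (i, k) s * schauder (i, k) t)"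
    unfolding schauder_index_def by (subst sum.Sigma) auto
  also have "\<dots> = ramp_kernel (K * 2 ^ N) (2 ^ N * s) (2 ^ N * t) / 2 ^ N"
  proof (induction N)
    case 0
    then show ?case by (simp add: schauder_def ramp_kernel_def)
  next
    case (Suc N)
    have "(\<Sum>k<K * 2 ^ N. schauder (Suc N, k) s * schauder (Suc N, k) t) =
        (\<Sum>k<K * 2 ^ N. hat (2 ^ N * s - real k) * hat (2 ^ N * t - real k)) / 4 / 2 ^ N"
      by (simp add: schauder_def sum_divide_distrib)
    then have "(\<Sum>i\<le>Suc N. \<Sum>k<K * 2 ^ (i - 1). schauder (i, k) s * schauder (i, k) t) =
       (ramp_kernel (K * 2 ^ N) (2 ^ N * s) (2 ^ N * t) +
       (\<Sum>k<K * 2 ^ N. hat (2 ^ N * s - real k) * hat (2 ^ N * t - real k)) / 4) / 2 ^ N"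
      using Suc by (simp add: add_divide_distrib)
    also have "\<dots> = ramp_kernel (2 * (K * 2 ^ N)) (2 * (2 ^ N * s)) (2 * (2 ^ N * t)) / 2 / 2 ^ N"
      unfolding ramp_kernel_refine ..
    also have "\<dots> = ramp_kernel (K * 2 ^ Suc N) (2 ^ Suc N * s) (2 ^ Suc N * t) / 2 ^ Suc N"
      by (simp add: mult_ac)
    finally show ?case .
  qed
  finally show ?thesis .
qed

text \<open>Parseval's identity for the indicators of \<open>[0, s]\<close> and
  \<open>[0, t]\<close>, with an explicit rate: the kernel error 1 is scaled down by
  \<open>2 ^ N\<close>.\<close>

lemma schauder_parseval:
  assumes "0 \<le> s" "s \<le> real K" "0 \<le> t" "t \<le> real K"
  shows "(\<lambda>N. \<Sum>x\<in>schauder_index K N. schauder x s * schauder x t) \<longlonglongrightarrow> min s t"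
proof -
  have "\<bar>(\<Sum>x\<in>schauder_index K N. schauder x s * schauder x t) - min s t\<bar> \<le> (1 / 2) ^ N" for N
  proof -
    have "\<bar>ramp_kernel (K * 2 ^ N) (2 ^ N * s) (2 ^ N * t) - min (2 ^ N * s) (2 ^ N * t)\<bar> \<le> 1"
      using assms by (intro ramp_kernel_approx) (auto simp: mult.commute)
    then have "\<bar>ramp_kernel (K * 2 ^ N) (2 ^ N * s) (2 ^ N * t) - 2 ^ N * min s t\<bar> / 2 ^ N \<le> 1 / 2 ^ N"
      by (intro divide_right_mono) (auto simp: min_mult_distrib_left)
    then have "\<bar>(ramp_kernel (K * 2 ^ N) (2 ^ N * s) (2 ^ N * t) - 2 ^ N * min s t) / 2 ^ N\<bar> \<le> 1 / 2 ^ N"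
      by (simp add: abs_divide)
    then show ?thesis by (simp add: sum_schauder diff_divide_distrib power_one_over)
  qed
  moreover have "(\<lambda>N. (1 / 2 :: real) ^ N) \<longlonglongrightarrow> 0" by (intro LIMSEQ_power_zero) simp
  ultimately show ?thesis
    by (subst LIM_zero_iff[symmetric]) (auto intro: tendsto_0_le[where K = 1])
qed

section \<open>Growth of the Gaussian coefficients\<close>

definition gauss_coord :: "nat \<times> nat \<Rightarrow> (nat \<Rightarrow> real) \<Rightarrow> real" where
  "gauss_coord x \<omega> = \<omega> (prod_encode x)"

lemma gauss_coord_measurable[measurable]: "gauss_coord x \<in> borel_measurable gauss_space"
  unfolding gauss_coord_def by measurable

text \<open>The base \<open>5 / 4\<close> works because \<open>2 * (4 / 5) ^ 4 < 1\<close>, which makes the fourth moments summable,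
  and \<open>5 / 4 < sqrt 2\<close>, which makes the series of level sums converge.\<close>

definition good_points :: "(nat \<Rightarrow> real) set" where
  "good_points = {\<omega>. \<forall>K. \<exists>C::nat. \<forall>i k. k < K * 2 ^ (i - 1) \<longrightarrow> \<bar>gauss_coord (i, k) \<omega>\<bar> \<le> real C * (5 / 4) ^ i}"

lemma good_points_sets[measurable]: "good_points \<in> sets gauss_space"
proof -
  have "{\<omega>\<in>space gauss_space. \<forall>K. \<exists>C::nat. \<forall>i k. k < K * 2 ^ (i - 1) \<longrightarrow> \<bar>gauss_coord (i, k) \<omega>\<bar> \<le> real C * (5 / 4) ^ i}
      \<in> sets gauss_space"
    by measurable
  then show ?thesis by (simp add: good_points_def)
qed

text \<open>The fourth powers of the rescaled coefficients have mean
  \<open>3 * (256 / 625) ^ i\<close>, and level \<open>i\<close> has at most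
  \<open>K * 2 ^ i\<close> of them. Their total \<open>S\<close> has finite mean and is thus almost
  surely finite, and it bounds each of them.\<close>

lemma AE_good_points: "AE \<omega> in gauss_space. \<omega> \<in> good_points"
proof -
  have "AE \<omega> in gauss_space. \<exists>C::nat. \<forall>i k. k < K * 2 ^ (i - 1) \<longrightarrow> \<bar>gauss_coord (i, k) \<omega>\<bar> \<le> real C * (5 / 4) ^ i" for K
  proof -
    define S where "S \<omega> = (\<Sum>i. \<Sum>k<K * 2 ^ (i - 1). ennreal (((4 / 5) ^ i * gauss_coord (i, k) \<omega>) ^ 4))" for \<omega>
    have [measurable]: "S \<in> borel_measurable gauss_space" unfolding S_def by measurable
    have m4: "(\<integral>\<^sup>+ \<omega>. ennreal (((4 / 5) ^ i * gauss_coord (i, k) \<omega>) ^ 4) \<partial>gauss_space)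
        = ennreal (3 * (256 / 625) ^ i)" for i k
    proof -
      have "(\<integral>\<^sup>+ \<omega>. ennreal (((4 / 5) ^ i * gauss_coord (i, k) \<omega>) ^ 4) \<partial>gauss_space) =
          (\<integral>\<^sup>+ \<omega>. ennreal ((256 / 625) ^ i) * ennreal (\<omega> (prod_encode (i, k)) ^ 4) \<partial>gauss_space)"
      proof (intro nn_integral_cong)
        fix \<omega> :: "nat \<Rightarrow> real"
        have "((4 / 5 :: real) ^ i) ^ 4 = (256 / 625) ^ i"
          by (simp add: power_mult[symmetric] mult.commute[of i 4]) (simp add: power_mult power_divide)
        then show "ennreal (((4 / 5) ^ i * gauss_coord (i, k) \<omega>) ^ 4) =
            ennreal ((256 / 625) ^ i) * ennreal (\<omega> (prod_encode (i, k)) ^ 4)"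
          by (simp add: gauss_coord_def power_mult_distrib ennreal_mult')
      qed
      also have "\<dots> = ennreal ((256 / 625) ^ i) * 3"
        by (subst nn_integral_cmult) (auto simp: coordinate_fourth_moment)
      also have "\<dots> = ennreal (3 * (256 / 625) ^ i)" by (simp add: ennreal_mult' mult.commute)
      finally show ?thesis .
    qed
    have sm: "summable (\<lambda>i. 3 * real K * (512 / 625 :: real) ^ i)"
      by (intro summable_mult summable_geometric) simp
    have "(\<integral>\<^sup>+ \<omega>. S \<omega> \<partial>gauss_space) = (\<Sum>i. \<Sum>k<K * 2 ^ (i - 1). ennreal (3 * (256 / 625) ^ i))"
      unfolding S_def by (subst nn_integral_suminf) (auto simp: nn_integral_sum m4 simp del: sum_ennreal)
    also have "\<dots> \<le> (\<Sum>i. ennreal (3 * real K * (512 / 625) ^ i))"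
    proof (intro suminf_le summableI)
      fix i
      have "(\<Sum>k<K * 2 ^ (i - 1). ennreal (3 * (256 / 625) ^ i)) = ennreal (real (K * 2 ^ (i - 1)) * (3 * (256 / 625) ^ i))"
        by (simp add: ennreal_mult' ennreal_of_nat_eq_real_of_nat)
      also have "\<dots> \<le> ennreal (real (K * 2 ^ i) * (3 * (256 / 625) ^ i))"
        by (intro ennreal_leI mult_right_mono of_nat_mono mult_left_mono power_increasing) auto
      also have "real (K * 2 ^ i) * (3 * (256 / 625) ^ i) = 3 * real K * (512 / 625) ^ i"
        by (simp add: power_mult_distrib[symmetric] mult_ac)
      finally show "(\<Sum>k<K * 2 ^ (i - 1). ennreal (3 * (256 / 625) ^ i)) \<le> ennreal (3 * real K * (512 / 625) ^ i)" .
    qed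
    also have "\<dots> = ennreal (\<Sum>i. 3 * real K * (512 / 625) ^ i)"
      by (intro suminf_ennreal2 sm) simp
    also have "\<dots> < \<infinity>" by simp
    finally have "AE \<omega> in gauss_space. S \<omega> \<noteq> \<infinity>" by (intro nn_integral_PInf_AE) auto
    then show ?thesis
    proof eventually_elim
      case (elim \<omega>)
      then obtain s where s: "S \<omega> = ennreal s" "0 \<le> s" by (cases "S \<omega>") auto
      \<comment> \<open>With \<open>C\<close> at least 1 also \<open>C <= C ^ 4\<close>, so a bound
        of the fourth power by \<open>C\<close> is a bound of the value by \<open>C\<close>.\<close>
      obtain C :: nat where C: "max 1 s \<le> real C" using real_arch_simple by blast
      show ?case
      proof (intro exI[of _ C] allI impI)
        fix i k assume k: "k < K * 2 ^ (i - 1)"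
        define z where "z = (4 / 5) ^ i * gauss_coord (i, k) \<omega>"
        have "ennreal (z ^ 4) \<le> (\<Sum>k<K * 2 ^ (i - 1). ennreal (((4 / 5) ^ i * gauss_coord (i, k) \<omega>) ^ 4))"
          unfolding z_def using k by (intro member_le_sum) auto
        also have "\<dots> \<le> S \<omega>" unfolding S_def
          using sum_le_suminf[OF summableI, of "{i}" "\<lambda>i. \<Sum>k<K * 2 ^ (i - 1). ennreal (((4 / 5) ^ i * gauss_coord (i, k) \<omega>) ^ 4)"]
          by simp
        finally have "z ^ 4 \<le> s" using s by (simp add: ennreal_le_iff)
        then have "\<bar>z\<bar> ^ 4 \<le> real C" using C by simp
        also have "real C \<le> real C ^ 4" using C by (intro self_le_power) auto
        finally have "\<bar>z\<bar> \<le> real C" by (rule power_mono_iff[THEN iffD1, rotated 3]) auto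
        then have "\<bar>z\<bar> * (5 / 4) ^ i \<le> real C * (5 / 4) ^ i" by (intro mult_right_mono) auto
        moreover have "\<bar>z\<bar> * (5 / 4) ^ i = ((4 / 5) * (5 / 4)) ^ i * \<bar>gauss_coord (i, k) \<omega>\<bar>"
          unfolding power_mult_distrib by (simp add: z_def abs_mult)
        ultimately show "\<bar>gauss_coord (i, k) \<omega>\<bar> \<le> real C * (5 / 4) ^ i" by simp
      qed
    qed
  qed
  then have "AE \<omega> in gauss_space. \<forall>K. \<exists>C::nat. \<forall>i k. k < K * 2 ^ (i - 1) \<longrightarrow> \<bar>gauss_coord (i, k) \<omega>\<bar> \<le> real C * (5 / 4) ^ i"
    by (subst AE_all_countable) blast
  then show ?thesis by (simp add: good_points_def)
qed

section \<open>Convergence of the series and continuity of the paths\<close>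

definition level_sum :: "nat \<Rightarrow> nat \<Rightarrow> real \<Rightarrow> (nat \<Rightarrow> real) \<Rightarrow> real" where
  "level_sum K i t \<omega> = (\<Sum>k<K * 2 ^ (i - 1). schauder (i, k) t * gauss_coord (i, k) \<omega>)"

text \<open>Functions that belong to intervals to the right of \<open>t\<close> vanish at
  \<open>t\<close>, so the cutoff does not matter once it has reached \<open>t\<close>.\<close>

lemma level_sum_eq:
  assumes "t \<le> real K" "K \<le> K'" shows "level_sum K' i t \<omega> = level_sum K i t \<omega>"
  unfolding level_sum_def
proof (rule sum.mono_neutral_right)
  show "\<forall>k\<in>{..<K' * 2 ^ (i - 1)} - {..<K * 2 ^ (i - 1)}. schauder (i, k) t * gauss_coord (i, k) \<omega> = 0"
  proof
    fix k assume "k \<in> {..<K' * 2 ^ (i - 1)} - {..<K * 2 ^ (i - 1)}"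
    then have "K * 2 ^ (i - 1) \<le> k" by auto
    then have "real (K * 2 ^ (i - 1)) \<le> real k" by (simp only: of_nat_le_iff)
    then have "real K * 2 ^ (i - 1) \<le> real k" by simp
    moreover have "t * 2 ^ (i - 1) \<le> real K * 2 ^ (i - 1)" using assms by (intro mult_right_mono) auto
    ultimately have "t * 2 ^ (i - 1) - real k \<le> 0" by linarith
    then show "schauder (i, k) t * gauss_coord (i, k) \<omega> = 0"
      by (cases "i = 0") (auto simp: schauder_def hat_nonpos mult.commute[of _ t] ramp_def)
  qed
qed (use assms in \<open>auto intro: mult_right_mono\<close>)

text \<open>Since the tents of one level add up to at most 1, the number of intervals does not
  enter; what remains is the coefficient bound times the peak.\<close>

lemma level_sum_bound:
  assumes "\<And>i k. k < K * 2 ^ (i - 1) \<Longrightarrow> \<bar>gauss_coord (i, k) \<omega>\<bar> \<le> real C * (5 / 4) ^ i"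
  shows "\<bar>level_sum K (Suc n) t \<omega>\<bar> \<le> real C * (5 / 8) * (5 / 4 / sqrt 2) ^ n"
proof -
  have "\<bar>level_sum K (Suc n) t \<omega>\<bar> \<le> (\<Sum>k<K * 2 ^ n. \<bar>schauder (Suc n, k) t * gauss_coord (Suc n, k) \<omega>\<bar>)"
    unfolding level_sum_def by (simp add: sum_abs)
  also have "\<dots> \<le> (\<Sum>k<K * 2 ^ n. hat (2 ^ n * t - real k) / (2 * sqrt (2 ^ n)) * (real C * (5 / 4) ^ Suc n))"
  proof (rule sum_mono)
    fix k assume "k \<in> {..<K * 2 ^ n}"
    then show "\<bar>schauder (Suc n, k) t * gauss_coord (Suc n, k) \<omega>\<bar> \<le>
        hat (2 ^ n * t - real k) / (2 * sqrt (2 ^ n)) * (real C * (5 / 4) ^ Suc n)"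
      using assms[of k "Suc n"] hat_nonneg[of "2 ^ n * t - real k"]
      unfolding abs_mult by (intro mult_mono) (auto simp: schauder_def)
  qed
  also have "\<dots> = (\<Sum>k<K * 2 ^ n. hat (2 ^ n * t - real k)) * (real C * (5 / 4) ^ Suc n / (2 * sqrt (2 ^ n)))"
    by (simp add: sum_distrib_right sum_divide_distrib)
  also have "\<dots> \<le> 1 * (real C * (5 / 4) ^ Suc n / (2 * sqrt (2 ^ n)))"
    by (intro mult_right_mono sum_hat_le_1) auto
  also have "\<dots> = real C * (5 / 8) * (5 / 4 / sqrt 2) ^ n"
    by (simp add: power_divide real_sqrt_power)
  finally show ?thesis .
qed

text \<open>The value 0 off \<open>good_points\<close> makes every path continuous, as
  \<open>standard_brownian_motion\<close> requires, and not only almost every one.\<close>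

definition wiener :: "real \<Rightarrow> (nat \<Rightarrow> real) \<Rightarrow> real" where
  "wiener t \<omega> = (if \<omega> \<in> good_points then \<Sum>i. level_sum (nat \<lceil>t\<rceil>) i t \<omega> else 0)"

lemma wiener_eq:
  assumes "\<omega> \<in> good_points" "0 \<le> t" "t \<le> real K"
  shows "wiener t \<omega> = (\<Sum>i. level_sum K i t \<omega>)"
proof -
  have "nat \<lceil>t\<rceil> \<le> K" "t \<le> real (nat \<lceil>t\<rceil>)" using assms by (auto simp: ceiling_le_iff)
  then have "level_sum K i t \<omega> = level_sum (nat \<lceil>t\<rceil>) i t \<omega>" for i by (rule level_sum_eq[rotated])
  then show ?thesis using assms by (simp add: wiener_def)
qed

lemma wiener_uniform_limit:
  assumes \<omega>: "\<omega> \<in> good_points"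
  shows "uniform_limit {0..real K} (\<lambda>N t. \<Sum>i<N. level_sum K i t \<omega>) (\<lambda>t. wiener t \<omega>) sequentially"
proof -
  obtain C :: nat where C: "\<And>i k. k < K * 2 ^ (i - 1) \<Longrightarrow> \<bar>gauss_coord (i, k) \<omega>\<bar> \<le> real C * (5 / 4) ^ i"
    using \<omega> unfolding good_points_def by blast
  define b where "b i = (if i = 0 then \<Sum>k<K. \<bar>gauss_coord (0, k) \<omega>\<bar> else real C * (5 / 8) * (5 / 4 / sqrt 2) ^ (i - 1))" for i
  have "summable (\<lambda>i. b (Suc i))"
  proof -
    have "(5 / 4)\<^sup>2 < (2::real)" by (simp add: power2_eq_square)
    then have "5 / 4 < sqrt (2::real)" by (rule real_less_rsqrt)
    then show ?thesis unfolding b_def by (simp add: summable_mult summable_geometric)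
  qed
  then have sb: "summable b" by (simp only: summable_Suc_iff)
  have "norm (level_sum K i t \<omega>) \<le> b i" for i t
  proof (cases i)
    case 0
    have "\<bar>level_sum K 0 t \<omega>\<bar> \<le> (\<Sum>k<K. \<bar>schauder (0, k) t * gauss_coord (0, k) \<omega>\<bar>)"
      unfolding level_sum_def by (simp add: sum_abs)
    also have "\<dots> \<le> (\<Sum>k<K. \<bar>gauss_coord (0, k) \<omega>\<bar>)"
      using ramp_bounds by (intro sum_mono) (auto simp: abs_mult schauder_def intro!: mult_left_le_one_le)
    finally show ?thesis using 0 by (simp add: b_def)
  next
    case (Suc n)
    then show ?thesis using level_sum_bound[OF C, where n = n and t = t] by (simp add: b_def)
  qed
  then have "uniform_limit {0..real K} (\<lambda>N t. \<Sum>i<N. level_sum K i t \<omega>) (\<lambda>t. \<Sum>i. level_sum K i t \<omega>) sequentially"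
    by (intro Weierstrass_m_test[OF _ sb])
  then show ?thesis
    by (rule uniform_limit_cong'[THEN iffD1, rotated 2]) (auto simp: wiener_eq[OF \<omega>])
qed

lemma wiener_0: "wiener 0 \<omega> = 0"
  by (simp add: wiener_def level_sum_def)

lemma wiener_continuous: "continuous_on {0..} (\<lambda>t. wiener t \<omega>)"
proof (cases "\<omega> \<in> good_points")
  case False
  then show ?thesis by (simp add: wiener_def)
next
  case True
  have c: "continuous_on {0..real K} (\<lambda>t. wiener t \<omega>)" for K
  proof (rule uniform_limit_theorem[OF _ wiener_uniform_limit[OF True]])
    have "continuous_on {0..real K} (\<lambda>t. schauder (i, k) t)" for i k
      by (cases "i = 0") (auto simp: schauder_def intro!: continuous_intros continuous_ramp continuous_hat)
    then have "continuous_on {0..real K} (\<lambda>t. level_sum K i t \<omega>)" for i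
      unfolding level_sum_def by (intro continuous_intros) auto
    then show "\<forall>\<^sub>F n in sequentially. continuous_on {0..real K} (\<lambda>t. \<Sum>i<n. level_sum K i t \<omega>)"
      by (intro always_eventually allI continuous_intros) auto
  qed simp
  show ?thesis unfolding continuous_on_iff
  proof (intro ballI allI impI)
    fix x e :: real assume x: "x \<in> {0..}" and e: "0 < e"
    \<comment> \<open>The margin 1 keeps a neighbourhood of \<open>x\<close> within
      \<open>{0..real K}\<close>, where continuity is known.\<close>
    obtain K :: nat where K: "x + 1 \<le> real K" using real_arch_simple by blast
    have "x \<in> {0..real K}" using x K by simp
    from c[of K, unfolded continuous_on_iff, rule_format, OF this e]
    obtain d where d: "0 < d" "\<And>y. y \<in> {0..real K} \<Longrightarrow> dist y x < d \<Longrightarrow> dist (wiener y \<omega>) (wiener x \<omega>) < e"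
      by blast
    show "\<exists>d>0. \<forall>y\<in>{0..}. dist y x < d \<longrightarrow> dist (wiener y \<omega>) (wiener x \<omega>) < e"
      by (intro exI[of _ "min d 1"]) (use d K in \<open>auto simp: dist_real_def\<close>)
  qed
qed

lemma wiener_measurable[measurable]: "wiener t \<in> borel_measurable gauss_space"
  unfolding wiener_def level_sum_def by measurable

lemma sum_level_sum: "(\<Sum>i<Suc N. level_sum K i t \<omega>) = (\<Sum>x\<in>schauder_index K N. schauder x t * gauss_coord x \<omega>)"
  unfolding level_sum_def schauder_index_def lessThan_Suc_atMost by (subst sum.Sigma) auto

lemma wiener_limit:
  assumes "\<omega> \<in> good_points" "0 \<le> t" "t \<le> real K"
  shows "(\<lambda>N. \<Sum>x\<in>schauder_index K N. schauder x t * gauss_coord x \<omega>) \<longlonglongrightarrow> wiener t \<omega>"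
proof -
  have "(\<lambda>N. \<Sum>i<N. level_sum K i t \<omega>) \<longlonglongrightarrow> wiener t \<omega>"
    using tendsto_uniform_limitI[OF wiener_uniform_limit[OF assms(1), of K]] assms by auto
  from LIMSEQ_Suc[OF this] show ?thesis by (simp only: sum_level_sum)
qed

section \<open>The law of the increments\<close>

text \<open>The partial sums are finite Gaussian sums with explicit characteristic functions. Their
  variances converge by \<open>schauder_parseval\<close>, and dominated convergence carries the
  integrals to the limit. One cutoff \<open>K\<close> serves for all the times involved.\<close>

lemma wiener_char:
  assumes \<tau>: "0 \<le> \<tau> 0" "mono \<tau>"
  shows "(CLINT \<omega>|gauss_space. iexp (\<Sum>i<n. \<theta> i * (wiener (\<tau> (Suc i)) \<omega> - wiener (\<tau> i) \<omega>))) =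
    exp (- (\<Sum>i<n. (\<theta> i)\<^sup>2 * (\<tau> (Suc i) - \<tau> i)) / 2)"
proof -
  interpret prob_space gauss_space by (rule prob_space_gauss_space)
  obtain K :: nat where K: "\<tau> n \<le> real K" using real_arch_simple by blast
  have t0: "0 \<le> \<tau> i" for i using \<tau> monoD[OF \<tau>(2), of 0 i] by simp
  have tK: "\<tau> i \<le> real K" if "i \<le> n" for i using monoD[OF \<tau>(2) that] K by simp
  define J where "J = schauder_index K"
  have J: "finite (J N)" for N by (simp add: J_def finite_schauder_index)
  define \<Delta> where "\<Delta> i x = schauder x (\<tau> (Suc i)) - schauder x (\<tau> i)" for i x
  define c where "c x = (\<Sum>i<n. \<theta> i * \<Delta> i x)" for x
  define Y where "Y N \<omega> = (\<Sum>x\<in>J N. c x * gauss_coord x \<omega>)" for N \<omega>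
  have Y_eq: "Y N \<omega> = (\<Sum>i<n. \<theta> i * ((\<Sum>x\<in>J N. schauder x (\<tau> (Suc i)) * gauss_coord x \<omega>) -
      (\<Sum>x\<in>J N. schauder x (\<tau> i) * gauss_coord x \<omega>)))" for N \<omega>
    unfolding Y_def c_def sum_subtractf[symmetric] sum_distrib_left sum_distrib_right
    by (subst sum.swap) (auto simp: \<Delta>_def algebra_simps intro!: sum.cong)
  have charY: "(CLINT \<omega>|gauss_space. iexp (Y N \<omega>)) = exp (- (\<Sum>x\<in>J N. (c x)\<^sup>2) / 2)" for N
  proof -
    have "Y N \<omega> = (\<Sum>m\<in>prod_encode ` J N. c (prod_decode m) * \<omega> m)" for \<omega>
      unfolding Y_def gauss_coord_def by (subst sum.reindex) (auto simp: inj_prod_encode)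
    moreover have "(\<Sum>x\<in>J N. (c x)\<^sup>2) = (\<Sum>m\<in>prod_encode ` J N. (c (prod_decode m))\<^sup>2)"
      by (subst sum.reindex) (auto simp: inj_prod_encode)
    ultimately show ?thesis using char_gauss_sum[of "prod_encode ` J N" "\<lambda>m. c (prod_decode m)"] J[of N]
      by simp
  qed
  have var: "(\<lambda>N. \<Sum>x\<in>J N. (c x)\<^sup>2) \<longlonglongrightarrow> (\<Sum>i<n. (\<theta> i)\<^sup>2 * (\<tau> (Suc i) - \<tau> i))"
  proof -
    have "(\<Sum>x\<in>J N. (c x)\<^sup>2) = (\<Sum>i<n. \<Sum>j<n. \<theta> i * \<theta> j * (\<Sum>x\<in>J N. \<Delta> i x * \<Delta> j x))" for N
    proof -
      have "(\<Sum>x\<in>J N. (c x)\<^sup>2) = (\<Sum>x\<in>J N. \<Sum>i<n. \<Sum>j<n. \<theta> i * \<theta> j * (\<Delta> i x * \<Delta> j x))"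
        by (simp add: c_def power2_eq_square sum_product mult_ac)
      also have "\<dots> = (\<Sum>i<n. \<Sum>j<n. \<Sum>x\<in>J N. \<theta> i * \<theta> j * (\<Delta> i x * \<Delta> j x))"
        by (subst sum.swap) (intro sum.cong refl sum.swap)
      finally show ?thesis by (simp add: sum_distrib_left)
    qed
    moreover have "(\<lambda>N. \<Sum>x\<in>J N. \<Delta> i x * \<Delta> j x) \<longlonglongrightarrow> (if i = j then \<tau> (Suc i) - \<tau> i else 0)"
      if ij: "i < n" "j < n" for i j
    proof -
      have sp: "(\<lambda>N. \<Sum>x\<in>J N. schauder x (\<tau> a) * schauder x (\<tau> b)) \<longlonglongrightarrow> min (\<tau> a) (\<tau> b)"
        if "a \<le> n" "b \<le> n" for a b
        unfolding J_def using that t0 tK by (intro schauder_parseval) auto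
      have "(\<lambda>N. (\<Sum>x\<in>J N. schauder x (\<tau> (Suc i)) * schauder x (\<tau> (Suc j)))
          - (\<Sum>x\<in>J N. schauder x (\<tau> (Suc i)) * schauder x (\<tau> j))
          - (\<Sum>x\<in>J N. schauder x (\<tau> i) * schauder x (\<tau> (Suc j)))
          + (\<Sum>x\<in>J N. schauder x (\<tau> i) * schauder x (\<tau> j)))
        \<longlonglongrightarrow> min (\<tau> (Suc i)) (\<tau> (Suc j)) - min (\<tau> (Suc i)) (\<tau> j) - min (\<tau> i) (\<tau> (Suc j)) + min (\<tau> i) (\<tau> j)"
        using ij by (intro tendsto_add tendsto_diff sp) auto
      \<comment> \<open>The covariance of two increments: for \<open>i \<noteq> j\<close> the time
        intervals overlap in at most a point, and the four minima cancel.\<close>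
      moreover have "min (\<tau> (Suc i)) (\<tau> (Suc j)) - min (\<tau> (Suc i)) (\<tau> j) - min (\<tau> i) (\<tau> (Suc j)) + min (\<tau> i) (\<tau> j)
          = (if i = j then \<tau> (Suc i) - \<tau> i else 0)"
      proof (cases i j rule: linorder_cases)
        case less
        then show ?thesis using monoD[OF \<tau>(2), of "Suc i" j] monoD[OF \<tau>(2), of i "Suc i"] monoD[OF \<tau>(2), of j "Suc j"]
          by (simp add: min_def)
      next
        case equal
        then show ?thesis using monoD[OF \<tau>(2), of i "Suc i"] by (simp add: min_def)
      next
        case greater
        then show ?thesis using monoD[OF \<tau>(2), of "Suc j" i] monoD[OF \<tau>(2), of i "Suc i"] monoD[OF \<tau>(2), of j "Suc j"]
          by (simp add: min_def)
      qed
      moreover have "(\<Sum>x\<in>J N. \<Delta> i x * \<Delta> j x) = (\<Sum>x\<in>J N. schauder x (\<tau> (Suc i)) * schauder x (\<tau> (Suc j)))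
          - (\<Sum>x\<in>J N. schauder x (\<tau> (Suc i)) * schauder x (\<tau> j))
          - (\<Sum>x\<in>J N. schauder x (\<tau> i) * schauder x (\<tau> (Suc j)))
          + (\<Sum>x\<in>J N. schauder x (\<tau> i) * schauder x (\<tau> j))" for N
        unfolding sum_subtractf[symmetric] sum.distrib[symmetric]
        by (intro sum.cong refl) (simp add: \<Delta>_def algebra_simps)
      ultimately show ?thesis by simp
    qed
    ultimately have "(\<lambda>N. \<Sum>x\<in>J N. (c x)\<^sup>2) \<longlonglongrightarrow>
        (\<Sum>i<n. \<Sum>j<n. \<theta> i * \<theta> j * (if i = j then \<tau> (Suc i) - \<tau> i else 0))"
      by (simp only:) (intro tendsto_sum tendsto_mult tendsto_const; simp)
    also have "(\<Sum>i<n. \<Sum>j<n. \<theta> i * \<theta> j * (if i = j then \<tau> (Suc i) - \<tau> i else 0)) =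
        (\<Sum>i<n. (\<theta> i)\<^sup>2 * (\<tau> (Suc i) - \<tau> i))"
      by (intro sum.cong refl) (simp add: if_distrib[of "\<lambda>x. _ * x"] sum.delta power2_eq_square cong: if_cong)
    finally show ?thesis .
  qed
  have "(\<lambda>N. CLINT \<omega>|gauss_space. iexp (Y N \<omega>)) \<longlonglongrightarrow>
      (CLINT \<omega>|gauss_space. iexp (\<Sum>i<n. \<theta> i * (wiener (\<tau> (Suc i)) \<omega> - wiener (\<tau> i) \<omega>)))"
  proof (rule integral_dominated_convergence[where w = "\<lambda>_. 1"])
    show "(\<lambda>\<omega>. iexp (Y N \<omega>)) \<in> borel_measurable gauss_space" for N unfolding Y_def by measurable
    show "AE \<omega> in gauss_space. (\<lambda>N. iexp (Y N \<omega>)) \<longlonglongrightarrow>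
        iexp (\<Sum>i<n. \<theta> i * (wiener (\<tau> (Suc i)) \<omega> - wiener (\<tau> i) \<omega>))"
      using AE_good_points
    proof eventually_elim
      case (elim \<omega>)
      have "(\<lambda>N. Y N \<omega>) \<longlonglongrightarrow> (\<Sum>i<n. \<theta> i * (wiener (\<tau> (Suc i)) \<omega> - wiener (\<tau> i) \<omega>))"
        unfolding Y_eq J_def
        using tK t0 by (intro tendsto_sum tendsto_mult tendsto_const tendsto_diff wiener_limit elim) auto
      then show ?case by (intro tendsto_intros)
    qed
  qed auto
  moreover have "(\<lambda>N. CLINT \<omega>|gauss_space. iexp (Y N \<omega>)) \<longlonglongrightarrow>
      complex_of_real (exp (- (\<Sum>i<n. (\<theta> i)\<^sup>2 * (\<tau> (Suc i) - \<tau> i)) / 2))"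
    unfolding charY by (intro tendsto_intros var) simp
  ultimately show ?thesis by (rule LIMSEQ_unique)
qed

text \<open>Unlike \<open>normal_density\<close>, this covers the variance \<open>0\<close> of the increment between equal times.\<close>

definition scaled_normal :: "real \<Rightarrow> real measure" where
  "scaled_normal s = distr std_normal_distribution borel (\<lambda>z. sqrt s * z)"

lemma real_distribution_scaled_normal: "real_distribution (scaled_normal s)"
proof -
  interpret N: prob_space std_normal_distribution by (rule prob_space_normal_density) simp
  show ?thesis unfolding scaled_normal_def by (rule N.real_distribution_distr) simp
qed

lemma char_scaled_normal:
  assumes "0 \<le> s" shows "char (scaled_normal s) \<theta> = exp (- (\<theta>\<^sup>2 * s) / 2)"
proof -
  have "char (scaled_normal s) \<theta> = char std_normal_distribution (\<theta> * sqrt s)"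
    unfolding scaled_normal_def char_def by (subst integral_distr) (auto simp: mult_ac)
  then show ?thesis using assms by (simp add: char_std_normal_distribution power_mult_distrib)
qed

lemma scaled_normal_eq_density:
  assumes "0 < s" shows "scaled_normal s = density lborel (normal_density 0 (sqrt s))"
proof -
  interpret N: prob_space std_normal_distribution by (rule prob_space_normal_density) simp
  have "distributed std_normal_distribution lborel (\<lambda>x. x) std_normal_density"
    unfolding distributed_def by (intro conjI distr_id2) (simp_all cong: measurable_cong_sets)
  then have "distributed std_normal_distribution lborel (\<lambda>x. (sqrt s * x - 0) / sqrt s) std_normal_density"
    using assms by simp
  then have "distributed std_normal_distribution lborel (\<lambda>x. sqrt s * x) (normal_density 0 (sqrt s))"
    using assms by (subst N.normal_standard_normal_convert) auto
  then have "distr std_normal_distribution lborel (\<lambda>x. sqrt s * x) = density lborel (normal_density 0 (sqrt s))"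
    by (simp add: distributed_def)
  moreover have "distr std_normal_distribution lborel (\<lambda>x. sqrt s * x) = scaled_normal s"
    unfolding scaled_normal_def by (rule distr_cong) auto
  ultimately show ?thesis by simp
qed

lemma wiener_increments:
  assumes \<tau>: "0 \<le> \<tau> 0" "mono \<tau>"
  shows "prob_space.indep_vars gauss_space (\<lambda>_. borel) (\<lambda>i \<omega>. wiener (\<tau> (Suc i)) \<omega> - wiener (\<tau> i) \<omega>) {..<n}"
    and "i < n \<Longrightarrow> distr gauss_space borel (\<lambda>\<omega>. wiener (\<tau> (Suc i)) \<omega> - wiener (\<tau> i) \<omega>) = scaled_normal (\<tau> (Suc i) - \<tau> i)"
proof -
  interpret prob_space gauss_space by (rule prob_space_gauss_space)
  have c: "(CLINT \<omega>|gauss_space. iexp (\<Sum>i<n. \<theta> i * (wiener (\<tau> (Suc i)) \<omega> - wiener (\<tau> i) \<omega>))) =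
      (\<Prod>i<n. char (scaled_normal (\<tau> (Suc i) - \<tau> i)) (\<theta> i))" for \<theta>
  proof -
    have "(\<Prod>i<n. char (scaled_normal (\<tau> (Suc i) - \<tau> i)) (\<theta> i)) =
        (\<Prod>i<n. complex_of_real (exp (- ((\<theta> i)\<^sup>2 * (\<tau> (Suc i) - \<tau> i)) / 2)))"
      using monoD[OF \<tau>(2), of _ "Suc _"] by (intro prod.cong refl char_scaled_normal) simp
    also have "\<dots> = exp (- (\<Sum>i<n. (\<theta> i)\<^sup>2 * (\<tau> (Suc i) - \<tau> i)) / 2)"
      by (simp add: exp_sum[symmetric] sum_divide_distrib sum_negf flip: of_real_prod of_real_exp)
    finally show ?thesis by (simp only: wiener_char[OF \<tau>])
  qed
  show "indep_vars (\<lambda>_. borel) (\<lambda>i \<omega>. wiener (\<tau> (Suc i)) \<omega> - wiener (\<tau> i) \<omega>) {..<n}"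
    by (rule indep_vars_char[OF _ _ _ c]) (simp_all add: real_distribution_scaled_normal)
  show "distr gauss_space borel (\<lambda>\<omega>. wiener (\<tau> (Suc i)) \<omega> - wiener (\<tau> i) \<omega>) = scaled_normal (\<tau> (Suc i) - \<tau> i)"
    if "i < n"
    by (rule indep_vars_char(2)[OF _ _ _ c]) (use that in \<open>simp_all add: real_distribution_scaled_normal\<close>)
qed

theorem standard_brownian_motion_wiener: "standard_brownian_motion gauss_space wiener"
proof -
  interpret prob_space gauss_space by (rule prob_space_gauss_space)
  show ?thesis
  proof
    fix s t :: real assume st: "0 \<le> s" "s < t"
    \<comment> \<open>One increment is the case \<open>n = 1\<close> of the time sequence
      \<open>s, t, t, ...\<close>.\<close>
    define \<tau> where "\<tau> i = (if i = 0 then s else t)" for i :: nat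
    have "distr gauss_space borel (\<lambda>\<omega>. wiener (\<tau> (Suc 0)) \<omega> - wiener (\<tau> 0) \<omega>) = scaled_normal (\<tau> (Suc 0) - \<tau> 0)"
      by (rule wiener_increments(2)[where n = 1]) (use st in \<open>auto simp: \<tau>_def mono_def\<close>)
    then have "distr gauss_space borel (\<lambda>\<omega>. wiener t \<omega> - wiener s \<omega>) = density lborel (normal_density 0 (sqrt (t - s)))"
      using st by (simp add: \<tau>_def scaled_normal_eq_density)
    moreover have "distr gauss_space lborel (\<lambda>\<omega>. wiener t \<omega> - wiener s \<omega>) = distr gauss_space borel (\<lambda>\<omega>. wiener t \<omega> - wiener s \<omega>)"
      by (rule distr_cong) auto
    ultimately show "distributed gauss_space lborel (\<lambda>\<omega>. wiener t \<omega> - wiener s \<omega>) (normal_density 0 (sqrt (t - s)))"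
      by (simp add: distributed_def)
  qed (auto simp: wiener_0 wiener_continuous intro: wiener_increments(1))
qed


section \<open>Bounded stopped Brownian motion\<close>

lemma natural_filtration_generators:
  "null_sets M \<union> (\<Union>s\<in>{0..t}. {B s -` A \<inter> space M | A. A \<in> sets borel}) \<subseteq> Pow (space M)"
  using sets.sets_into_space[of _ M] by (auto simp: null_sets_def)

lemma space_natural_filtration[simp]: "space (natural_filtration M B t) = space M"
  unfolding natural_filtration_def by (rule space_measure_of[OF natural_filtration_generators])

lemma sets_natural_filtration:
  "sets (natural_filtration M B t) =
     sigma_sets (space M) (null_sets M \<union> (\<Union>s\<in>{0..t}. {B s -` A \<inter> space M | A. A \<in> sets borel}))"
  unfolding natural_filtration_def by (rule sets_measure_of[OF natural_filtration_generators])

lemma natural_filtration_measurable: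
  assumes "0 \<le> s" "s \<le> t" shows "B s \<in> borel_measurable (natural_filtration M B t)"
proof (rule measurableI)
  fix A :: "real set" assume "A \<in> sets borel"
  then show "B s -` A \<inter> space (natural_filtration M B t) \<in> sets (natural_filtration M B t)"
    unfolding sets_natural_filtration using assms by (auto intro!: sigma_sets.Basic)
qed simp

lemma natural_filtration_mono:
  assumes "s \<le> t" shows "sets (natural_filtration M B s) \<subseteq> sets (natural_filtration M B t)"
proof -
  define G where "G r = {B r -` A \<inter> space M | A. A \<in> sets borel}" for r
  have "(\<Union>r\<in>{0..s}. G r) \<subseteq> (\<Union>r\<in>{0..t}. G r)" using assms by (intro UN_mono) simp_all
  then have "null_sets M \<union> (\<Union>r\<in>{0..s}. G r) \<subseteq> null_sets M \<union> (\<Union>r\<in>{0..t}. G r)"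
    by (rule Un_mono[OF order_refl])
  then show ?thesis unfolding sets_natural_filtration G_def[symmetric] by (rule sigma_sets_mono')
qed

context standard_brownian_motion
begin

lemma subalgebra_natural_filtration: "subalgebra M (natural_filtration M B t)"
  unfolding subalgebra_def sets_natural_filtration space_natural_filtration
  using random_variable_B by (intro conjI refl sets.sigma_sets_subset) (auto intro: measurable_sets)

lemma complete_filtered_natural_filtration:
  assumes "complete_measure M" shows "complete_filtered_prob_space M (natural_filtration M B)"
proof -
  interpret complete_measure M by fact
  show ?thesis
  proof
    show "null_sets M \<subseteq> sets (natural_filtration M B 0)"
      unfolding sets_natural_filtration by (intro subsetI sigma_sets.Basic UnI1)
  qed (rule subalgebra_natural_filtration natural_filtration_mono, assumption?)+
qed

section \<open>Independence of an increment from the past\<close>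

text \<open>A set of pairs may list a time repeatedly, so intersecting cylinders is uniting their
  index sets.\<close>

definition cylinder :: "(real \<times> real set) set \<Rightarrow> 'a set" where
  "cylinder P = {\<omega> \<in> space M. \<forall>p\<in>P. B (fst p) \<omega> \<in> snd p}"

definition cylinders :: "real \<Rightarrow> 'a set set" where
  "cylinders t = cylinder ` {P. finite P \<and> P \<subseteq> {0..t} \<times> sets borel}"

lemma cylinder_events:
  assumes "finite P" "P \<subseteq> {0..t} \<times> sets borel" shows "cylinder P \<in> events"
  unfolding cylinder_def
proof (rule sets.sets_Collect_finite_All[OF _ assms(1)])
  fix p assume "p \<in> P"
  then have "0 \<le> fst p" "snd p \<in> sets borel" using assms(2) by auto
  from measurable_sets[OF random_variable_B[OF this(1)] this(2)]
  show "{\<omega> \<in> space M. B (fst p) \<omega> \<in> snd p} \<in> events"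
    by (simp add: vimage_def Int_def conj_commute)
qed

lemma Int_stable_cylinders: "Int_stable (null_sets M \<union> cylinders t)"
proof (rule Int_stableI)
  fix a b assume ab: "a \<in> null_sets M \<union> cylinders t" "b \<in> null_sets M \<union> cylinders t"
  then have ev: "a \<in> events" "b \<in> events" by (auto simp: cylinders_def intro: cylinder_events)
  consider "a \<in> null_sets M" | "b \<in> null_sets M" | "a \<in> cylinders t" "b \<in> cylinders t" using ab by auto
  then show "a \<inter> b \<in> null_sets M \<union> cylinders t"
  proof cases
    case 1 then show ?thesis using ev by (simp add: null_set_Int2)
  next
    case 2 then show ?thesis using ev by (simp add: null_set_Int1)
  next
    case 3
    then obtain P P' where P: "a = cylinder P" "finite P" "P \<subseteq> {0..t} \<times> sets borel"
      "b = cylinder P'" "finite P'" "P' \<subseteq> {0..t} \<times> sets borel"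
      by (auto simp: cylinders_def)
    have "a \<inter> b = cylinder (P \<union> P')" unfolding P(1,4) cylinder_def by auto
    moreover have "cylinder (P \<union> P') \<in> cylinders t"
      unfolding cylinders_def
    proof (rule imageI, rule CollectI, rule conjI)
      show "finite (P \<union> P')" using P(2,5) by (rule finite_UnI)
      show "P \<union> P' \<subseteq> {0..t} \<times> sets borel" using P(3,6) by (rule Un_least)
    qed
    ultimately show ?thesis by (simp only: UnI2)
  qed
qed

text \<open>The finitely many times are sorted into the beginning of a sequence
  \<open>\<tau>\<close> that continues with \<open>u\<close>. As the path starts at 0, its values at
  these times are sums of the first \<open>n\<close> increments, so the cylinder is an event of
  those and independent of increment number \<open>n\<close>.\<close>

lemma cylinder_indep_increment:
  assumes tu: "0 \<le> t" "t < u" and C: "C \<in> cylinders t" and A: "A \<in> sets borel"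
  shows "C \<in> events" "prob (C \<inter> ((\<lambda>\<omega>. B u \<omega> - B t \<omega>) -` A \<inter> space M)) =
    prob C * prob ((\<lambda>\<omega>. B u \<omega> - B t \<omega>) -` A \<inter> space M)"
proof -
  obtain P where P: "C = cylinder P" "finite P" "P \<subseteq> {0..t} \<times> sets borel"
    using C unfolding cylinders_def by blast
  \<comment> \<open>The time 0 makes each value a sum of increments, and \<open>t\<close> makes the
    last increment start at \<open>t\<close>.\<close>
  define T where "T = insert 0 (insert t (fst ` P))"
  have T: "finite T" "T \<noteq> {}" "T \<subseteq> {0..t}" "0 \<in> T" "t \<in> T" using P(2,3) tu by (auto simp: T_def)
  define xs where "xs = sorted_list_of_set T"
  have xs: "sorted xs" "set xs = T" "xs \<noteq> []" using T unfolding xs_def by auto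
  define n where "n = length xs - 1"
  have n: "length xs = Suc n" using xs by (cases xs) (auto simp: n_def)
  \<comment> \<open>From index \<open>Suc n\<close> on the sequence stays at \<open>u\<close>, which
    keeps it monotone on all naturals.\<close>
  define \<tau> where "\<tau> i = (if i \<le> n then xs ! i else u)" for i
  have xsT: "xs ! i \<in> T" if "i \<le> n" for i using nth_mem[of i xs] that n xs(2) by simp
  have mono: "mono \<tau>"
  proof (rule monoI)
    fix i j :: nat assume "i \<le> j"
    then show "\<tau> i \<le> \<tau> j"
      using sorted_nth_mono[OF xs(1), of i j] n xsT[of i] T(3) tu by (force simp: \<tau>_def)
  qed
  have ex: "\<exists>i\<le>n. \<tau> i = s" if s: "s \<in> T" for s
  proof -
    obtain i where "i < length xs" "xs ! i = s" using s unfolding xs(2)[symmetric] in_set_conv_nth by blast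
    then show ?thesis using n by (intro exI[of _ i]) (simp add: \<tau>_def)
  qed
  have \<tau>0: "\<tau> 0 = 0"
  proof -
    obtain i where "i \<le> n" "\<tau> i = 0" using ex T by blast
    then have "\<tau> 0 \<le> 0" using monoD[OF mono, of 0 i] by simp
    then show ?thesis using xsT[of 0] T(3) by (auto simp: \<tau>_def)
  qed
  have \<tau>n: "\<tau> n = t"
  proof -
    obtain i where "i \<le> n" "\<tau> i = t" using ex T by blast
    then have "t \<le> \<tau> n" using monoD[OF mono, of i n] by simp
    then show ?thesis using xsT[of n] T(3) by (auto simp: \<tau>_def)
  qed
  have \<tau>S: "\<tau> (Suc n) = u" by (simp add: \<tau>_def)
  define X where "X i \<omega> = B (\<tau> (Suc i)) \<omega> - B (\<tau> i) \<omega>" for i \<omega>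
  have ind: "indep_vars (\<lambda>_. borel) X {..<Suc n}"
    unfolding X_def using indep_increments[OF _ mono, of "Suc n"] \<tau>0 by simp
  have Bsum: "B (\<tau> i) \<omega> = (\<Sum>j<i. X j \<omega>)" if "\<omega> \<in> space M" for i \<omega>
    using start[OF that] \<tau>0 unfolding X_def by (subst sum_lessThan_telescope) simp
  have iv: "indep_var (Pi\<^sub>M {..<n} (\<lambda>_. borel)) (\<lambda>\<omega>. restrict (\<lambda>i. X i \<omega>) {..<n})
     (Pi\<^sub>M {n} (\<lambda>_. borel)) (\<lambda>\<omega>. restrict (\<lambda>i. X i \<omega>) {n})"
    by (rule indep_var_restrict[OF ind]) auto
  have "\<exists>i. \<forall>p\<in>P. i p \<le> n \<and> \<tau> (i p) = fst p"
    using ex by (intro bchoice) (auto simp: T_def)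
  then obtain i where i: "\<And>p. p \<in> P \<Longrightarrow> i p \<le> n" "\<And>p. p \<in> P \<Longrightarrow> \<tau> (i p) = fst p" by blast
  define G where "G = {f \<in> space (Pi\<^sub>M {..<n} (\<lambda>_. borel :: real measure)). \<forall>p\<in>P. (\<Sum>j<i p. f j) \<in> snd p}"
  define H where "H = {f \<in> space (Pi\<^sub>M {n} (\<lambda>_. borel :: real measure)). f n \<in> A}"
  have G: "G \<in> sets (Pi\<^sub>M {..<n} (\<lambda>_. borel))"
    unfolding G_def
  proof (rule sets.sets_Collect_finite_All[OF _ P(2)])
    fix p assume p: "p \<in> P"
    have "(\<lambda>f. \<Sum>j<i p. f j) \<in> borel_measurable (Pi\<^sub>M {..<n} (\<lambda>_. borel :: real measure))"
      using i(1)[OF p] by (intro borel_measurable_sum measurable_component_singleton) auto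
    moreover have "snd p \<in> sets borel" using p P(3) by auto
    ultimately have "(\<lambda>f. \<Sum>j<i p. f j) -` snd p \<inter> space (Pi\<^sub>M {..<n} (\<lambda>_. borel)) \<in> sets (Pi\<^sub>M {..<n} (\<lambda>_. borel))"
      by (rule measurable_sets)
    then show "{f \<in> space (Pi\<^sub>M {..<n} (\<lambda>_. borel)). (\<Sum>j<i p. f j) \<in> snd p} \<in> sets (Pi\<^sub>M {..<n} (\<lambda>_. borel))"
      by (simp add: vimage_def Int_def conj_commute)
  qed
  have H: "H \<in> sets (Pi\<^sub>M {n} (\<lambda>_. borel))"
  proof -
    have "(\<lambda>f. f n) \<in> borel_measurable (Pi\<^sub>M {n} (\<lambda>_. borel :: real measure))"
      by (intro measurable_component_singleton) auto
    from measurable_sets[OF this A] show ?thesis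
      by (simp add: H_def vimage_def Int_def conj_commute)
  qed
  have eqG: "(\<lambda>\<omega>. restrict (\<lambda>i. X i \<omega>) {..<n}) -` G \<inter> space M = C"
  proof -
    have "(\<Sum>j<i p. restrict (\<lambda>i. X i \<omega>) {..<n} j) = B (fst p) \<omega>" if "\<omega> \<in> space M" "p \<in> P" for \<omega> p
      unfolding i(2)[OF that(2), symmetric] Bsum[OF that(1)] using i(1)[OF that(2)] by (intro sum.cong) auto
    then show ?thesis unfolding G_def P(1) cylinder_def by (auto simp: space_PiM)
  qed
  have eqH: "(\<lambda>\<omega>. restrict (\<lambda>i. X i \<omega>) {n}) -` H \<inter> space M = (\<lambda>\<omega>. B u \<omega> - B t \<omega>) -` A \<inter> space M"
    by (auto simp: H_def space_PiM X_def \<tau>n \<tau>S)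
  show "C \<in> events"
    unfolding eqG[symmetric] using measurable_sets[OF indep_var_rv1[OF iv] G] .
  have "prob ((\<lambda>\<omega>. (restrict (\<lambda>i. X i \<omega>) {..<n}, restrict (\<lambda>i. X i \<omega>) {n})) -` (G \<times> H) \<inter> space M) =
      prob ((\<lambda>\<omega>. restrict (\<lambda>i. X i \<omega>) {..<n}) -` G \<inter> space M) * prob ((\<lambda>\<omega>. restrict (\<lambda>i. X i \<omega>) {n}) -` H \<inter> space M)"
    by (rule indep_varD[OF iv G H])
  moreover have "(\<lambda>\<omega>. (restrict (\<lambda>i. X i \<omega>) {..<n}, restrict (\<lambda>i. X i \<omega>) {n})) -` (G \<times> H) \<inter> space M =
      C \<inter> ((\<lambda>\<omega>. B u \<omega> - B t \<omega>) -` A \<inter> space M)"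
    unfolding eqG[symmetric] eqH[symmetric] by auto
  ultimately show "prob (C \<inter> ((\<lambda>\<omega>. B u \<omega> - B t \<omega>) -` A \<inter> space M)) =
    prob C * prob ((\<lambda>\<omega>. B u \<omega> - B t \<omega>) -` A \<inter> space M)"
    unfolding eqG eqH by simp
qed

text \<open>Cylinders and null sets together form a pi-system whose sigma-algebra contains the
  augmented filtration at time \<open>t\<close>, and null sets are independent of
  everything.\<close>

lemma indep_increment:
  assumes tu: "0 \<le> t" "t < u" and Y: "Y \<in> borel_measurable (natural_filtration M B t)"
  shows "indep_var borel Y borel (\<lambda>\<omega>. B u \<omega> - B t \<omega>)"
proof -
  let ?D = "\<lambda>\<omega>. B u \<omega> - B t \<omega>"
  have D: "?D \<in> borel_measurable M" using tu random_variable_B by auto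
  let ?A = "null_sets M \<union> cylinders t" and ?B = "{?D -` A \<inter> space M | A. A \<in> sets borel}"
  have "indep_set ?A ?B"
  proof (rule indep_setI)
    show "?A \<subseteq> events" using cylinder_indep_increment(1)[OF tu] by (auto simp: null_sets_def)
    show "?B \<subseteq> events" using D by (auto intro: measurable_sets)
    fix a b assume a: "a \<in> ?A" and b: "b \<in> ?B"
    then obtain A where A: "b = ?D -` A \<inter> space M" "A \<in> sets borel" by auto
    show "prob (a \<inter> b) = prob a * prob b"
    proof (cases "a \<in> null_sets M")
      case True
      then have "a \<inter> b \<in> null_sets M" using \<open>?B \<subseteq> events\<close> b by (intro null_set_Int2) auto
      then show ?thesis using True by (simp add: measure_eq_0_null_sets)
    next
      case False
      then show ?thesis using a A cylinder_indep_increment(2)[OF tu] by auto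
    qed
  qed
  then have i: "indep_set (sigma_sets (space M) ?A) (sigma_sets (space M) ?B)"
  proof (rule indep_set_sigma_sets)
    show "Int_stable ?B"
    proof (rule Int_stableI)
      fix a b assume "a \<in> ?B" "b \<in> ?B"
      then obtain A A' where A: "A \<in> sets borel" "A' \<in> sets borel" "a = ?D -` A \<inter> space M" "b = ?D -` A' \<inter> space M"
        by auto
      then have "a \<inter> b = ?D -` (A \<inter> A') \<inter> space M" by auto
      with A show "a \<inter> b \<in> ?B" by blast
    qed
  qed (rule Int_stable_cylinders)
  have sub: "sets (natural_filtration M B t) \<subseteq> sigma_sets (space M) ?A"
    unfolding sets_natural_filtration
  proof (rule sigma_sets_mono)
    show "null_sets M \<union> (\<Union>s\<in>{0..t}. {B s -` A \<inter> space M |A. A \<in> sets borel}) \<subseteq> sigma_sets (space M) ?A"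
    proof
      fix x assume "x \<in> null_sets M \<union> (\<Union>s\<in>{0..t}. {B s -` A \<inter> space M |A. A \<in> sets borel})"
      then consider "x \<in> null_sets M" | s A where "s \<in> {0..t}" "A \<in> sets borel" "x = B s -` A \<inter> space M"
        by auto
      then have "x \<in> ?A"
      proof cases
        case 2
        have "x = cylinder {(s, A)}" using 2 by (auto simp: cylinder_def)
        moreover have "cylinder {(s, A)} \<in> cylinders t"
          unfolding cylinders_def
        proof (rule imageI, rule CollectI, rule conjI)
          show "{(s, A)} \<subseteq> {0..t} \<times> sets borel" using 2(1,2) by blast
        qed simp
        ultimately show ?thesis by simp
      qed simp
      then show "x \<in> sigma_sets (space M) ?A" by (rule sigma_sets.Basic)
    qed
  qed
  have YM: "Y \<in> borel_measurable M" by (rule measurable_from_subalg[OF subalgebra_natural_filtration Y])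
  have Ysub: "{Y -` A \<inter> space M | A. A \<in> sets borel} \<subseteq> sets (natural_filtration M B t)"
    using measurable_sets[OF Y] by auto
  have "sigma_sets (space M) {Y -` A \<inter> space M | A. A \<in> sets borel} \<subseteq> sets (natural_filtration M B t)"
    using sets.sigma_sets_subset[of _ "natural_filtration M B t"] Ysub by simp
  with sub have Ysub': "sigma_sets (space M) {Y -` A \<inter> space M | A. A \<in> sets borel} \<subseteq> sigma_sets (space M) ?A"
    by blast
  show ?thesis
    unfolding indep_var_eq
  proof (intro conjI YM D indep_setI)
    show "sigma_sets (space M) {Y -` A \<inter> space M | A. A \<in> sets borel} \<subseteq> events"
      using Ysub' i unfolding indep_set_def indep_sets_def by (auto simp: UNIV_bool)
    show "sigma_sets (space M) ?B \<subseteq> events"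
      using i unfolding indep_set_def indep_sets_def by (auto simp: UNIV_bool)
    fix a b assume "a \<in> sigma_sets (space M) {Y -` A \<inter> space M | A. A \<in> sets borel}" "b \<in> sigma_sets (space M) ?B"
    then show "prob (a \<inter> b) = prob a * prob b" using indep_setD[OF i] Ysub' by auto
  qed
qed

lemma increment_moments:
  assumes tu: "0 \<le> t" "t < u"
  shows "integrable M (\<lambda>\<omega>. B u \<omega> - B t \<omega>)" "(\<integral>\<omega>. B u \<omega> - B t \<omega> \<partial>M) = 0"
    "integrable M (\<lambda>\<omega>. (B u \<omega> - B t \<omega>)\<^sup>2)" "(\<integral>\<omega>. (B u \<omega> - B t \<omega>)\<^sup>2 \<partial>M) = u - t"
proof -
  note d = normal_increments[OF tu]
  have s: "0 < sqrt (u - t)" using tu by simp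
  show e: "(\<integral>\<omega>. B u \<omega> - B t \<omega> \<partial>M) = 0" using normal_distributed_expectation[OF s d] .
  have "integrable lborel (\<lambda>x. normal_density 0 (sqrt (u - t)) x * x)"
    using integrable_normal_moment[OF s, of 0 1] by simp
  then show "integrable M (\<lambda>\<omega>. B u \<omega> - B t \<omega>)"
    using distributed_integrable[OF d, of "\<lambda>x. x"] by simp
  have "integrable lborel (\<lambda>x. normal_density 0 (sqrt (u - t)) x * x\<^sup>2)"
    using integrable_normal_moment[OF s, of 0 2] by simp
  then show "integrable M (\<lambda>\<omega>. (B u \<omega> - B t \<omega>)\<^sup>2)"
    using distributed_integrable[OF d, of "\<lambda>x. x\<^sup>2"] by simp
  show "(\<integral>\<omega>. (B u \<omega> - B t \<omega>)\<^sup>2 \<partial>M) = u - t"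
    using normal_distributed_variance[OF s d] e tu by simp
qed

end

section \<open>Stopping along grids\<close>

lemma grid_less:
  fixes s u :: real
  assumes "s < u"
  shows "s + (u - s) * real i / real (Suc N) < s + (u - s) * real (Suc i) / real (Suc N)"
  using assms by (intro add_strict_left_mono divide_strict_right_mono mult_strict_left_mono) simp_all

text \<open>\<open>Q\<close> holds on an initial segment, so the gated sum telescopes up to the
  first failure \<open>k\<close>, capped at \<open>N\<close>. For a stopping time, \<open>k\<close>
  will mark the first grid point that is not before it.\<close>

lemma sum_prefix:
  fixes f :: "nat \<Rightarrow> real"
  assumes "\<And>i. Q (Suc i) \<Longrightarrow> Q i"
  shows "\<exists>k\<le>N. (\<Sum>i<N. if Q i then f (Suc i) - f i else 0) = f k - f 0 \<and> (k < N \<longrightarrow> \<not> Q k) \<and> (0 < k \<longrightarrow> Q (k - 1))"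
proof (induction N)
  case (Suc N)
  then obtain k where k: "k \<le> N" "(\<Sum>i<N. if Q i then f (Suc i) - f i else 0) = f k - f 0"
    "k < N \<Longrightarrow> \<not> Q k" "0 < k \<Longrightarrow> Q (k - 1)" by blast
  have anti: "Q i" if "Q j" "i \<le> j" for i j using that(2,1) by (induction rule: dec_induct) (use assms in auto)
  show ?case
  proof (cases "Q N")
    case True
    then have "k = N" using k(1,3) anti[OF True, of k] by (cases "k < N") auto
    then show ?thesis using k(2) True by (intro exI[of _ "Suc N"]) simp
  next
    case False
    then show ?thesis using k by (intro exI[of _ k]) (auto simp: less_Suc_eq)
  qed
qed simp

text \<open>Bounded second moments give uniform integrability: by
  \<open>z <= min z L + z\<^sup>2 / L\<close>, truncation at \<open>L\<close> costs at most
  \<open>D / L\<close>. The truncated part vanishes by dominated convergence, and then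
  \<open>L\<close> tends to infinity.\<close>

lemma (in prob_space) L2_bounded_integral_limit:
  fixes S :: "nat \<Rightarrow> 'a \<Rightarrow> real"
  assumes S: "\<And>n. integrable M (S n)" "\<And>n. integrable M (\<lambda>\<omega>. (S n \<omega>)\<^sup>2)" "\<And>n. (\<integral>\<omega>. (S n \<omega>)\<^sup>2 \<partial>M) \<le> c"
    "\<And>n. (\<integral>\<omega>. S n \<omega> \<partial>M) = 0"
    and Z: "Z \<in> borel_measurable M" "\<And>\<omega>. \<omega> \<in> space M \<Longrightarrow> \<bar>Z \<omega>\<bar> \<le> K"
    and lim: "\<And>\<omega>. \<omega> \<in> space M \<Longrightarrow> (\<lambda>n. S n \<omega>) \<longlonglongrightarrow> Z \<omega>"
  shows "(\<integral>\<omega>. Z \<omega> \<partial>M) = 0"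
proof -
  note [measurable] = Z(1) borel_measurable_integrable[OF S(1)]
  have iZ: "integrable M Z" using Z by (intro integrable_const_bound[where B = K]) auto
  define D where "D = 2 * K\<^sup>2 + 2 * c"
  have *: "\<bar>\<integral>\<omega>. Z \<omega> \<partial>M\<bar> \<le> D / L" if L: "0 < L" for L
  proof -
    have imin: "integrable M (\<lambda>\<omega>. min \<bar>S n \<omega> - Z \<omega>\<bar> L)" for n
      using L by (intro integrable_const_bound[where B = L]) auto
    have "\<bar>\<integral>\<omega>. Z \<omega> \<partial>M\<bar> \<le> (\<integral>\<omega>. min \<bar>S n \<omega> - Z \<omega>\<bar> L \<partial>M) + D / L" for n
    proof -
      have "\<bar>\<integral>\<omega>. Z \<omega> \<partial>M\<bar> = \<bar>\<integral>\<omega>. S n \<omega> - Z \<omega> \<partial>M\<bar>" using S iZ by simp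
      also have "\<dots> \<le> (\<integral>\<omega>. \<bar>S n \<omega> - Z \<omega>\<bar> \<partial>M)" by (rule integral_abs_bound)
      also have "\<dots> \<le> (\<integral>\<omega>. min \<bar>S n \<omega> - Z \<omega>\<bar> L + (2 * K\<^sup>2 + 2 * (S n \<omega>)\<^sup>2) / L \<partial>M)"
      proof (rule integral_mono)
        show "integrable M (\<lambda>\<omega>. min \<bar>S n \<omega> - Z \<omega>\<bar> L + (2 * K\<^sup>2 + 2 * (S n \<omega>)\<^sup>2) / L)"
          using imin[of n] S(2)[of n] by simp
        fix \<omega> assume \<omega>: "\<omega> \<in> space M"
        define z where "z = \<bar>S n \<omega> - Z \<omega>\<bar>"
        have "z\<^sup>2 \<le> 2 * (Z \<omega>)\<^sup>2 + 2 * (S n \<omega>)\<^sup>2"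
          using zero_le_power2[of "S n \<omega> + Z \<omega>"] by (simp add: z_def power2_eq_square algebra_simps)
        moreover have "(Z \<omega>)\<^sup>2 \<le> K\<^sup>2" using Z(2)[OF \<omega>] by (simp add: abs_le_square_iff[symmetric])
        ultimately have zz: "z\<^sup>2 / L \<le> (2 * K\<^sup>2 + 2 * (S n \<omega>)\<^sup>2) / L"
          using L by (intro divide_right_mono) auto
        have "z \<le> min z L + z\<^sup>2 / L"
        proof (cases "z \<le> L")
          case True then show ?thesis using L by simp
        next
          case False
          then have "z * L \<le> z * z" using L by (intro mult_left_mono) auto
          then have "z \<le> z\<^sup>2 / L" using L by (simp add: pos_le_divide_eq power2_eq_square)
          then show ?thesis using L False by simp
        qed
        with zz show "\<bar>S n \<omega> - Z \<omega>\<bar> \<le> min \<bar>S n \<omega> - Z \<omega>\<bar> L + (2 * K\<^sup>2 + 2 * (S n \<omega>)\<^sup>2) / L"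
          unfolding z_def by linarith
      qed (use S iZ in auto)
      also have "\<dots> = (\<integral>\<omega>. min \<bar>S n \<omega> - Z \<omega>\<bar> L \<partial>M) + (2 * K\<^sup>2 + 2 * (\<integral>\<omega>. (S n \<omega>)\<^sup>2 \<partial>M)) / L"
        using imin[of n] S(2)[of n] by (simp add: prob_space)
      also have "\<dots> \<le> (\<integral>\<omega>. min \<bar>S n \<omega> - Z \<omega>\<bar> L \<partial>M) + D / L"
        unfolding D_def using S(3)[of n] L by (intro add_left_mono divide_right_mono) auto
      finally show ?thesis .
    qed
    moreover have "(\<lambda>n. (\<integral>\<omega>. min \<bar>S n \<omega> - Z \<omega>\<bar> L \<partial>M) + D / L) \<longlonglongrightarrow> (\<integral>\<omega>. 0 \<partial>M) + D / L"
    proof (intro tendsto_add tendsto_const integral_dominated_convergence[where w = "\<lambda>_. L"])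
      show "AE \<omega> in M. (\<lambda>n. min \<bar>S n \<omega> - Z \<omega>\<bar> L) \<longlonglongrightarrow> 0"
      proof (rule AE_I2)
        fix \<omega> assume "\<omega> \<in> space M"
        from tendsto_min[OF tendsto_rabs[OF tendsto_diff[OF lim[OF this] tendsto_const[of "Z \<omega>"]]] tendsto_const[of L]]
        show "(\<lambda>n. min \<bar>S n \<omega> - Z \<omega>\<bar> L) \<longlonglongrightarrow> 0" using L by simp
      qed
    qed (use L in auto)
    ultimately show ?thesis by (intro LIMSEQ_le_const[where X = "\<lambda>n. (\<integral>\<omega>. min \<bar>S n \<omega> - Z \<omega>\<bar> L \<partial>M) + D / L"]) auto
  qed
  have "(\<lambda>n. D / real (Suc n)) \<longlonglongrightarrow> 0" using LIMSEQ_Suc[OF lim_const_over_n[of D]] by simp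
  then have "\<bar>\<integral>\<omega>. Z \<omega> \<partial>M\<bar> \<le> 0"
    by (rule LIMSEQ_le_const) (use *[of "real (Suc _)"] in auto)
  then show ?thesis by simp
qed

context standard_brownian_motion
begin

lemma stopping_event:
  assumes "ext_stopping_time (natural_filtration M B) \<eta>" "0 \<le> t"
  shows "{\<omega> \<in> space M. ennreal t < \<eta> \<omega>} \<in> sets (natural_filtration M B t)"
proof -
  have "Measurable.pred (natural_filtration M B t) (\<lambda>\<omega>. \<not> \<eta> \<omega> \<le> ennreal t)"
    using assms by (intro pred_intros_logic) (auto simp: ext_stopping_time_def)
  then show ?thesis by (simp add: pred_def not_le)
qed

text \<open>The gate compares \<open>\<eta>\<close> with the left end point of the cell, hence is
  known before the increment starts. The event \<open>A\<close> is carried along to test conditional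
  expectations.\<close>

definition grid_sum :: "'a set \<Rightarrow> ('a \<Rightarrow> ennreal) \<Rightarrow> (nat \<Rightarrow> real) \<Rightarrow> nat \<Rightarrow> 'a \<Rightarrow> real" where
  "grid_sum A \<eta> r n \<omega> = (\<Sum>i<n. if \<omega> \<in> A \<and> ennreal (r i) < \<eta> \<omega> then B (r (Suc i)) \<omega> - B (r i) \<omega> else 0)"

text \<open>Each increment is independent of its gate and of the sum so far. Cross terms therefore
  vanish, and the second moment stays below the elapsed time, however fine the grid is.\<close>

lemma grid_sum_moments:
  assumes \<eta>: "ext_stopping_time (natural_filtration M B) \<eta>" and r: "0 \<le> r 0" "\<And>i. r i < r (Suc i)"
    and A: "A \<in> sets (natural_filtration M B (r 0))"
  shows "grid_sum A \<eta> r n \<in> borel_measurable (natural_filtration M B (r n)) \<and>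
    integrable M (grid_sum A \<eta> r n) \<and> (\<integral>\<omega>. grid_sum A \<eta> r n \<omega> \<partial>M) = 0 \<and>
    integrable M (\<lambda>\<omega>. (grid_sum A \<eta> r n \<omega>)\<^sup>2) \<and> (\<integral>\<omega>. (grid_sum A \<eta> r n \<omega>)\<^sup>2 \<partial>M) \<le> r n - r 0"
proof (induction n)
  case 0
  then show ?case by (simp add: grid_sum_def)
next
  case (Suc n)
  let ?F = "natural_filtration M B"
  have r0: "r 0 \<le> r i" for i by (rule lift_Suc_mono_le[of r]) (use r(2) in \<open>auto intro: less_imp_le\<close>)
  have rp: "0 \<le> r i" for i using r(1) r0[of i] by simp
  define G where "G = A \<inter> {\<omega> \<in> space M. ennreal (r n) < \<eta> \<omega>}"
  have G: "G \<in> sets (?F (r n))"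
    unfolding G_def using natural_filtration_mono[OF r0[of n]] A stopping_event[OF \<eta> rp] by (intro sets.Int) auto
  have GM: "G \<in> events" using G subalgebra_natural_filtration[of "r n"] by (auto simp: subalgebra_def)
  define S where "S = grid_sum A \<eta> r n"
  define \<Delta> where "\<Delta> \<omega> = B (r (Suc n)) \<omega> - B (r n) \<omega>" for \<omega>
  note D = increment_moments[OF rp r(2), of n, folded \<Delta>_def]
  have S: "S \<in> borel_measurable (?F (r n))" "integrable M S" "(\<integral>\<omega>. S \<omega> \<partial>M) = 0"
    "integrable M (\<lambda>\<omega>. (S \<omega>)\<^sup>2)" "(\<integral>\<omega>. (S \<omega>)\<^sup>2 \<partial>M) \<le> r n - r 0"
    using Suc by (auto simp: S_def)
  have step: "grid_sum A \<eta> r (Suc n) \<omega> = S \<omega> + indicator G \<omega> * \<Delta> \<omega>" if "\<omega> \<in> space M" for \<omega>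
    using that by (simp add: grid_sum_def S_def G_def \<Delta>_def indicator_def)
  have prod: "integrable M (\<lambda>\<omega>. Y \<omega> * \<Delta> \<omega>)" "(\<integral>\<omega>. Y \<omega> * \<Delta> \<omega> \<partial>M) = 0"
    if Y: "Y \<in> borel_measurable (?F (r n))" "integrable M Y" for Y
  proof -
    have ind: "indep_var borel Y borel \<Delta>"
      unfolding \<Delta>_def by (rule indep_increment[OF rp r(2) Y(1)])
    show "integrable M (\<lambda>\<omega>. Y \<omega> * \<Delta> \<omega>)" by (rule indep_var_integrable[OF ind Y(2) D(1)])
    show "(\<integral>\<omega>. Y \<omega> * \<Delta> \<omega> \<partial>M) = 0"
      using indep_var_lebesgue_integral[OF ind Y(2) D(1)] D(2) by simp
  qed
  have indG: "(indicator G :: 'a \<Rightarrow> real) \<in> borel_measurable (?F (r n))" "integrable M (indicator G :: 'a \<Rightarrow> real)"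
    using G GM by (auto simp: emeasure_eq_measure)
  note p1 = prod[OF indG]
  have SG: "(\<lambda>\<omega>. S \<omega> * indicator G \<omega>) \<in> borel_measurable (?F (r n))" "integrable M (\<lambda>\<omega>. S \<omega> * indicator G \<omega>)"
    using S(1,2) indG(1) GM by (auto intro: integrable_real_mult_indicator)
  note p2 = prod[OF SG]
  have iD: "integrable M (\<lambda>\<omega>. indicator G \<omega> * (\<Delta> \<omega>)\<^sup>2)"
    using integrable_real_mult_indicator[OF GM D(3)] by (simp add: mult.commute)
  have "(\<integral>\<omega>. indicator G \<omega> * (\<Delta> \<omega>)\<^sup>2 \<partial>M) \<le> (\<integral>\<omega>. (\<Delta> \<omega>)\<^sup>2 \<partial>M)"
    by (rule integral_mono[OF iD D(3)]) (simp add: indicator_def)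
  then have D2: "(\<integral>\<omega>. indicator G \<omega> * (\<Delta> \<omega>)\<^sup>2 \<partial>M) \<le> r (Suc n) - r n" using D(4) by simp
  have sq: "(grid_sum A \<eta> r (Suc n) \<omega>)\<^sup>2 = (S \<omega>)\<^sup>2 + 2 * (S \<omega> * indicator G \<omega> * \<Delta> \<omega>) + indicator G \<omega> * (\<Delta> \<omega>)\<^sup>2"
    if "\<omega> \<in> space M" for \<omega>
    unfolding step[OF that] by (simp add: power2_eq_square algebra_simps indicator_def)
  show ?case
  proof (intro conjI)
    have F': "r n \<le> r (Suc n)" using r(2)[of n] by simp
    have sub: "subalgebra (?F (r (Suc n))) (?F (r n))"
      using natural_filtration_mono[OF F'] by (simp add: subalgebra_def)
    have "(\<lambda>\<omega>. S \<omega> + indicator G \<omega> * \<Delta> \<omega>) \<in> borel_measurable (?F (r (Suc n)))"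
      unfolding \<Delta>_def
      using measurable_from_subalg[OF sub S(1)] measurable_from_subalg[OF sub indG(1)]
        natural_filtration_measurable[OF rp order_refl] natural_filtration_measurable[OF rp F']
      by (intro borel_measurable_add borel_measurable_times borel_measurable_diff)
    then show "grid_sum A \<eta> r (Suc n) \<in> borel_measurable (?F (r (Suc n)))"
      by (rule measurable_cong[THEN iffD1, rotated]) (simp add: step)
    show "integrable M (grid_sum A \<eta> r (Suc n))"
      using S(2) p1(1) by (subst Bochner_Integration.integrable_cong[OF refl step]) auto
    show "(\<integral>\<omega>. grid_sum A \<eta> r (Suc n) \<omega> \<partial>M) = 0"
      using S p1 by (subst Bochner_Integration.integral_cong[OF refl step]) auto
    show "integrable M (\<lambda>\<omega>. (grid_sum A \<eta> r (Suc n) \<omega>)\<^sup>2)"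
      using S(4) p2(1) iD by (subst Bochner_Integration.integrable_cong[OF refl sq]) auto
    show "(\<integral>\<omega>. (grid_sum A \<eta> r (Suc n) \<omega>)\<^sup>2 \<partial>M) \<le> r (Suc n) - r 0"
      using S(4,5) p2 iD D2 by (subst Bochner_Integration.integral_cong[OF refl sq]) auto
  qed
qed

text \<open>The sum telescopes to the value of the path at the first grid point not before
  \<open>min \<eta> u\<close>, which is off by at most one mesh width. Path continuity does the
  rest; if \<open>\<eta> <= s\<close>, all gates are closed.\<close>

lemma grid_sum_limit:
  assumes su: "0 \<le> s" "s < u" and \<omega>: "\<omega> \<in> space M"
  shows "(\<lambda>N. grid_sum A \<eta> (\<lambda>i. s + (u - s) * real i / real (Suc N)) (Suc N) \<omega>)
    \<longlonglongrightarrow> indicator A \<omega> * (stopped B \<eta> u \<omega> - stopped B \<eta> s \<omega>)"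
proof (cases "\<omega> \<in> A \<and> ennreal s < \<eta> \<omega>")
  case False
  have "grid_sum A \<eta> (\<lambda>i. s + (u - s) * real i / real (Suc N)) (Suc N) \<omega> = 0" for N
  proof -
    have "\<not> (\<omega> \<in> A \<and> ennreal (s + (u - s) * real i / real (Suc N)) < \<eta> \<omega>)" for i
    proof
      assume *: "\<omega> \<in> A \<and> ennreal (s + (u - s) * real i / real (Suc N)) < \<eta> \<omega>"
      have "ennreal s \<le> ennreal (s + (u - s) * real i / real (Suc N))" using su by (intro ennreal_leI) simp
      then show False using * False by auto
    qed
    then show ?thesis by (simp only: grid_sum_def if_False sum.neutral_const)
  qed
  moreover have "indicator A \<omega> * (stopped B \<eta> u \<omega> - stopped B \<eta> s \<omega>) = 0"
  proof (cases "\<omega> \<in> A")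
    case True
    then have "\<eta> \<omega> \<le> ennreal s" using False by auto
    moreover have "ennreal s \<le> ennreal u" using su by (intro ennreal_leI) simp
    ultimately have "min (\<eta> \<omega>) (ennreal u) = min (\<eta> \<omega>) (ennreal s)" by (auto simp: min_def)
    then show ?thesis by (simp add: stopped_def)
  qed simp
  ultimately show ?thesis by (simp only: tendsto_const)
next
  case True
  define \<rho> where "\<rho> = enn2real (min (\<eta> \<omega>) (ennreal u))"
  have \<rho>: "ennreal \<rho> = min (\<eta> \<omega>) (ennreal u)" unfolding \<rho>_def
    by (intro ennreal_enn2real) (simp add: min_less_iff_disj)
  have \<rho>0: "0 \<le> \<rho>" by (simp add: \<rho>_def)
  have "min (\<eta> \<omega>) (ennreal s) = ennreal s" using True by (intro min_absorb2) auto
  then have Xs: "stopped B \<eta> s \<omega> = B s \<omega>" using su by (simp add: stopped_def)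
  define r where "r N i = s + (u - s) * real i / real (Suc N)" for N i :: nat
  have r: "r N (Suc i) = r N i + (u - s) / real (Suc N)" for N i
    by (simp only: r_def of_nat_Suc[of i] distrib_left mult_1_right add_divide_distrib add.assoc)
  moreover have "0 \<le> r N i" "r N (Suc N) = u" "r N 0 = s" for N i
    using su by (simp_all add: r_def)
  ultimately have r: "r N (Suc i) = r N i + (u - s) / real (Suc N)" "0 \<le> r N i" "r N (Suc N) = u" "r N 0 = s" for N i
    by blast+
  have "\<exists>v. 0 \<le> v \<and> \<bar>v - \<rho>\<bar> \<le> (u - s) / real (Suc N) \<and> grid_sum A \<eta> (r N) (Suc N) \<omega> = B v \<omega> - B s \<omega>" for N
  proof -
    have mono: "r N i \<le> r N j" if "i \<le> j" for i j
      using su that by (auto simp: r_def intro!: divide_right_mono mult_left_mono)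
    have "\<exists>k\<le>Suc N. (\<Sum>i<Suc N. if ennreal (r N i) < \<eta> \<omega> then B (r N (Suc i)) \<omega> - B (r N i) \<omega> else 0) = B (r N k) \<omega> - B (r N 0) \<omega>
        \<and> (k < Suc N \<longrightarrow> \<not> ennreal (r N k) < \<eta> \<omega>) \<and> (0 < k \<longrightarrow> ennreal (r N (k - 1)) < \<eta> \<omega>)"
      by (rule sum_prefix) (meson mono ennreal_leI le_less_trans lessI less_imp_le_nat)
    then obtain k where k: "k \<le> Suc N" "(\<Sum>i<Suc N. if ennreal (r N i) < \<eta> \<omega> then B (r N (Suc i)) \<omega> - B (r N i) \<omega> else 0) = B (r N k) \<omega> - B (r N 0) \<omega>"
      "k < Suc N \<Longrightarrow> \<not> ennreal (r N k) < \<eta> \<omega>" "0 < k \<Longrightarrow> ennreal (r N (k - 1)) < \<eta> \<omega>" by blast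
    have "0 < k" using k(3) True r(4) by (cases k) auto
    then obtain l where l: "k = Suc l" by (cases k) auto
    have ge: "\<rho> \<le> r N k"
    proof (cases "k = Suc N")
      case True
      have "ennreal \<rho> \<le> ennreal u" unfolding \<rho> by simp
      then show ?thesis using True r(3) su by (simp add: ennreal_le_iff)
    next
      case False
      then have "\<eta> \<omega> \<le> ennreal (r N k)" using k(1,3) by auto
      then have "ennreal \<rho> \<le> ennreal (r N k)" unfolding \<rho> by (meson min.coboundedI1)
      then show ?thesis using r(2) by (simp add: ennreal_le_iff)
    qed
    have le: "r N l \<le> \<rho>"
    proof -
      have "ennreal (r N l) \<le> \<eta> \<omega>" using k(4) l by auto
      moreover have "ennreal (r N l) \<le> ennreal u"
        using mono[of l "Suc N"] k(1) l r(3) by (intro ennreal_leI) auto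
      ultimately have "ennreal (r N l) \<le> ennreal \<rho>" unfolding \<rho> by simp
      then show ?thesis using \<rho>0 by (simp add: ennreal_le_iff)
    qed
    have "\<bar>r N k - \<rho>\<bar> \<le> (u - s) / real (Suc N)" using ge le r(1)[of N l] l by simp
    moreover have "grid_sum A \<eta> (r N) (Suc N) \<omega> = B (r N k) \<omega> - B s \<omega>"
      using k(2) True r(4) by (simp add: grid_sum_def)
    ultimately show ?thesis using r(2) by blast
  qed
  then obtain v where v: "\<And>N. 0 \<le> v N" "\<And>N. \<bar>v N - \<rho>\<bar> \<le> (u - s) / real (Suc N)"
    "\<And>N. grid_sum A \<eta> (r N) (Suc N) \<omega> = B (v N) \<omega> - B s \<omega>" by metis
  have "v \<longlonglongrightarrow> \<rho>"
  proof (subst LIM_zero_iff[symmetric], rule tendsto_0_le[where K = 1])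
    show "(\<lambda>N. (u - s) / real (Suc N)) \<longlonglongrightarrow> 0" using LIMSEQ_Suc[OF lim_const_over_n[of "u - s"]] by simp
  qed (use v(2) su in auto)
  then have "(\<lambda>N. B (v N) \<omega>) \<longlonglongrightarrow> B \<rho> \<omega>"
    using continuous_on_tendsto_compose[OF continuous_paths[OF \<omega>], of v \<rho> sequentially] v(1) \<rho>0 by auto
  then have "(\<lambda>N. B (v N) \<omega> - B s \<omega>) \<longlonglongrightarrow> B \<rho> \<omega> - B s \<omega>" by (intro tendsto_diff tendsto_const)
  moreover have "indicator A \<omega> * (stopped B \<eta> u \<omega> - stopped B \<eta> s \<omega>) = B \<rho> \<omega> - B s \<omega>"
    using True Xs by (simp add: stopped_def[where t = u] \<rho>_def)
  ultimately show ?thesis unfolding v(3)[symmetric] r_def by (simp only:)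
qed

text \<open>A pointwise limit of grid sums over \<open>{0..u}\<close>, each of them measurable at
  time \<open>u\<close>. At \<open>u = 0\<close> the grid degenerates, but the value is
  constant.\<close>

lemma stopped_adapted:
  assumes \<eta>: "ext_stopping_time (natural_filtration M B) \<eta>" and u: "0 \<le> u"
  shows "stopped B \<eta> u \<in> borel_measurable (natural_filtration M B u)"
proof (cases "u = 0")
  case True
  have "(\<lambda>_. 0) \<in> borel_measurable (natural_filtration M B u)" by simp
  then show ?thesis
    by (rule measurable_cong[THEN iffD1, rotated]) (simp add: stopped_def True start)
next
  case False
  define r where "r N i = 0 + (u - 0) * real i / real (Suc N)" for N i :: nat
  have "(\<lambda>\<omega>. indicator (space M) \<omega> * (stopped B \<eta> u \<omega> - stopped B \<eta> 0 \<omega>)) \<in> borel_measurable (natural_filtration M B u)"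
  proof (rule borel_measurable_LIMSEQ_real)
    show "grid_sum (space M) \<eta> (r N) (Suc N) \<in> borel_measurable (natural_filtration M B u)" for N
    proof -
      have "space M \<in> sets (natural_filtration M B (r N 0))"
        using sets.top[of "natural_filtration M B (r N 0)"] by simp
      then have "grid_sum (space M) \<eta> (r N) (Suc N) \<in> borel_measurable (natural_filtration M B (r N (Suc N)))"
        using grid_sum_moments[OF \<eta>, of "r N" "space M" "Suc N"] grid_less[of 0 u _ N] u False by (simp add: r_def)
      then show ?thesis by (simp add: r_def del: of_nat_Suc)
    qed
    show "(\<lambda>N. grid_sum (space M) \<eta> (r N) (Suc N) \<omega>)
      \<longlonglongrightarrow> indicator (space M) \<omega> * (stopped B \<eta> u \<omega> - stopped B \<eta> 0 \<omega>)"
      if "\<omega> \<in> space (natural_filtration M B u)" for \<omega>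
      unfolding r_def by (rule grid_sum_limit) (use u False that in auto)
  qed
  then show ?thesis
    by (rule measurable_cong[THEN iffD1, rotated]) (simp add: stopped_def start)
qed

text \<open>The grid sums have mean 0 but no uniform bound, so it is their second-moment bound
  \<open>u - s\<close> that carries the mean to the bounded limit.\<close>

lemma stopped_increment:
  assumes \<eta>: "ext_stopping_time (natural_filtration M B) \<eta>" and su: "0 \<le> s" "s < u"
    and A: "A \<in> sets (natural_filtration M B s)"
    and K: "\<And>t \<omega>. 0 \<le> t \<Longrightarrow> \<omega> \<in> space M \<Longrightarrow> \<bar>stopped B \<eta> t \<omega>\<bar> \<le> K"
  shows "(\<integral>\<omega>. indicator A \<omega> * (stopped B \<eta> u \<omega> - stopped B \<eta> s \<omega>) \<partial>M) = 0"
proof -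
  define r where "r N i = s + (u - s) * real i / real (Suc N)" for N i :: nat
  have r: "r N 0 = s" "r N (Suc N) = u" "r N i < r N (Suc i)" for N i
    using grid_less[OF su(2)] by (simp_all add: r_def)
  note m = grid_sum_moments[OF \<eta>, of "r N" A "Suc N" for N]
  have m: "integrable M (grid_sum A \<eta> (r N) (Suc N))" "(\<integral>\<omega>. grid_sum A \<eta> (r N) (Suc N) \<omega> \<partial>M) = 0"
    "integrable M (\<lambda>\<omega>. (grid_sum A \<eta> (r N) (Suc N) \<omega>)\<^sup>2)" "(\<integral>\<omega>. (grid_sum A \<eta> (r N) (Suc N) \<omega>)\<^sup>2 \<partial>M) \<le> u - s" for N
    using m[of N] r su A by auto
  have X: "stopped B \<eta> t \<in> borel_measurable M" if "0 \<le> t" for t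
    by (rule measurable_from_subalg[OF subalgebra_natural_filtration stopped_adapted[OF \<eta> that]])
  have AM: "A \<in> events" using A subalgebra_natural_filtration[of s] by (auto simp: subalgebra_def)
  show ?thesis
  proof (rule L2_bounded_integral_limit[where S = "\<lambda>N. grid_sum A \<eta> (r N) (Suc N)" and c = "u - s" and K = "2 * K"])
    show "(\<lambda>\<omega>. indicator A \<omega> * (stopped B \<eta> u \<omega> - stopped B \<eta> s \<omega>)) \<in> borel_measurable M"
      using X[of u] X[of s] AM su by (intro borel_measurable_times borel_measurable_diff borel_measurable_indicator) auto
    show "\<bar>indicator A \<omega> * (stopped B \<eta> u \<omega> - stopped B \<eta> s \<omega>)\<bar> \<le> 2 * K" if "\<omega> \<in> space M" for \<omega>
      using K[of u \<omega>] K[of s \<omega>] su that by (auto simp: indicator_def)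
    show "(\<lambda>N. grid_sum A \<eta> (r N) (Suc N) \<omega>) \<longlonglongrightarrow> indicator A \<omega> * (stopped B \<eta> u \<omega> - stopped B \<eta> s \<omega>)"
      if "\<omega> \<in> space M" for \<omega>
      unfolding r_def by (rule grid_sum_limit[OF su that])
  qed (rule m)+
qed

section \<open>Stopped Brownian motion as a martingale, and its terminal value\<close>

lemma stopped_continuous:
  assumes \<omega>: "\<omega> \<in> space M" shows "continuous_on {0..} (\<lambda>t. stopped B \<eta> t \<omega>)"
proof (cases "\<eta> \<omega> = \<infinity>")
  case True
  have "continuous_on {0..} (\<lambda>t. B t \<omega>)" by (rule continuous_paths[OF \<omega>])
  then show ?thesis
    by (rule continuous_on_cong[THEN iffD1, rotated 2]) (auto simp: stopped_def True min_absorb2)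
next
  case False
  then obtain e where e: "\<eta> \<omega> = ennreal e" "0 \<le> e" by (cases "\<eta> \<omega>") auto
  have "continuous_on {0..} (\<lambda>t. B (min e t) \<omega>)"
    by (rule continuous_on_compose2[OF continuous_paths[OF \<omega>]]) (use e in \<open>auto intro!: continuous_intros\<close>)
  moreover have "stopped B \<eta> t \<omega> = B (min e t) \<omega>" if "0 \<le> t" for t
    using that e by (simp add: stopped_def min_def ennreal_le_iff)
  ultimately show ?thesis by (subst continuous_on_cong[OF refl]) auto
qed

lemma stopped_0: "\<omega> \<in> space M \<Longrightarrow> stopped B \<eta> 0 \<omega> = 0"
  by (simp add: stopped_def start)

lemma cadlag_stopped:
  assumes \<omega>: "\<omega> \<in> space M"
  shows "cadlag (\<lambda>t. stopped B \<eta> t \<omega>)" and "0 \<le> t \<Longrightarrow> jump (\<lambda>t. stopped B \<eta> t \<omega>) t = 0"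
proof -
  let ?x = "\<lambda>t. stopped B \<eta> t \<omega>"
  have l: "(?x \<longlongrightarrow> ?x t) (at_left t)" if "0 < t" for t
  proof -
    have "(?x \<longlongrightarrow> ?x t) (at t within {0..})"
      using stopped_continuous[OF \<omega>, of \<eta>] that by (simp add: continuous_on_def)
    moreover have "at t within {0..} = at t" using that by (intro at_within_interior) simp
    ultimately have "(?x \<longlongrightarrow> ?x t) (at t)" by simp
    then show ?thesis by (rule filterlim_mono[OF _ order_refl at_le]) simp
  qed
  have r: "(?x \<longlongrightarrow> ?x t) (at_right t)" if "0 \<le> t" for t
  proof -
    have "(?x \<longlongrightarrow> ?x t) (at t within {0..})"
      using stopped_continuous[OF \<omega>, of \<eta>] that by (simp add: continuous_on_def)
    then show ?thesis by (rule filterlim_mono[OF _ order_refl at_le]) (use that in auto)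
  qed
  show "cadlag ?x" unfolding cadlag_def using l r by (auto simp: continuous_within)
  show "jump ?x t = 0" if "0 \<le> t"
    using that tendsto_Lim[OF _ l, of t] \<omega> by (cases "t = 0") (auto simp: jump_def stopped_0)
qed

lemma stopped_supermartingale:
  assumes M: "complete_measure M" and \<eta>: "ext_stopping_time (natural_filtration M B) \<eta>"
    and K: "\<And>t \<omega>. 0 \<le> t \<Longrightarrow> \<omega> \<in> space M \<Longrightarrow> \<bar>stopped B \<eta> t \<omega>\<bar> \<le> K"
  shows "supermartingale_nonneg_jumps M (natural_filtration M B) (stopped B \<eta>)"
proof -
  let ?F = "natural_filtration M B"
  have X: "stopped B \<eta> t \<in> borel_measurable M" if "0 \<le> t" for t
    by (rule measurable_from_subalg[OF subalgebra_natural_filtration stopped_adapted[OF \<eta> that]])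
  have i: "integrable M (stopped B \<eta> t)" if "0 \<le> t" for t
    using X[OF that] K[OF that] by (intro integrable_const_bound[where B = K]) auto
  have cond: "AE \<omega> in M. real_cond_exp M (?F s) (stopped B \<eta> t) \<omega> \<le> stopped B \<eta> s \<omega>"
    if st: "0 \<le> s" "s \<le> t" for s t
  proof -
    interpret S: finite_measure_subalgebra M "?F s"
      by standard (rule subalgebra_natural_filtration)
    have "AE \<omega> in M. real_cond_exp M (?F s) (stopped B \<eta> t) \<omega> = stopped B \<eta> s \<omega>"
    proof (rule S.real_cond_exp_charact)
      fix A assume A: "A \<in> sets (?F s)"
      then have AM: "A \<in> events" using subalgebra_natural_filtration[of s] by (auto simp: subalgebra_def)
      have iA: "integrable M (\<lambda>\<omega>. indicator A \<omega> * stopped B \<eta> u \<omega>)" if "0 \<le> u" for u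
        using integrable_real_mult_indicator[OF AM i[OF that]] by (simp add: mult.commute)
      have "(\<integral>\<omega>. indicator A \<omega> * (stopped B \<eta> t \<omega> - stopped B \<eta> s \<omega>) \<partial>M) = 0"
        using stopped_increment[OF \<eta> st(1) _ A K, of t] st by (cases "s = t") auto
      then show "(\<integral>\<omega>\<in>A. stopped B \<eta> t \<omega> \<partial>M) = (\<integral>\<omega>\<in>A. stopped B \<eta> s \<omega> \<partial>M)"
        using iA[of t] iA[of s] st by (simp add: set_lebesgue_integral_def right_diff_distrib)
    qed (use i st stopped_adapted[OF \<eta>] in auto)
    then show ?thesis by eventually_elim simp
  qed
  have "supermartingale M ?F (stopped B \<eta>)"
    unfolding supermartingale_def adapted_def using i cond stopped_adapted[OF \<eta>] by blast
  then show ?thesis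
    unfolding supermartingale_nonneg_jumps_def
    using complete_filtered_natural_filtration[OF M] cadlag_stopped by (auto simp: stopped_0)
qed

text \<open>Where \<open>\<eta>\<close> is infinite, \<open>enn2real\<close> gives 0 and the value
  is \<open>B 0\<close>; the lemmas on it assume a finite \<open>\<eta>\<close>, at least almost
  everywhere.\<close>

definition terminal :: "('a \<Rightarrow> ennreal) \<Rightarrow> 'a \<Rightarrow> real" where
  "terminal \<eta> \<omega> = B (enn2real (\<eta> \<omega>)) \<omega>"

lemma stopped_eventually_terminal:
  assumes "\<eta> \<omega> \<noteq> \<infinity>"
  shows "eventually (\<lambda>n. stopped B \<eta> (real n) \<omega> = terminal \<eta> \<omega>) sequentially"
proof -
  obtain e where e: "\<eta> \<omega> = ennreal e" "0 \<le> e" using assms by (cases "\<eta> \<omega>") auto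
  obtain N :: nat where N: "e \<le> real N" using real_arch_simple by blast
  show ?thesis
    by (rule eventually_sequentiallyI[of N])
       (use N e in \<open>auto simp: stopped_def terminal_def min_def ennreal_le_iff\<close>)
qed

text \<open>Optional stopping by dominated convergence along integer times. The terminal value
  agrees with a measurable limit only almost everywhere, and completeness turns this into
  measurability.\<close>

lemma terminal_facts:
  assumes \<eta>: "ext_stopping_time (natural_filtration M B) \<eta>"
    and K: "\<And>t \<omega>. 0 \<le> t \<Longrightarrow> \<omega> \<in> space M \<Longrightarrow> \<bar>stopped B \<eta> t \<omega>\<bar> \<le> K"
    and fin: "AE \<omega> in M. \<eta> \<omega> \<noteq> \<infinity>" and M: "complete_measure M"
  shows "terminal \<eta> \<in> borel_measurable M" "AE \<omega> in M. \<bar>terminal \<eta> \<omega>\<bar> \<le> K" "(\<integral>\<omega>. terminal \<eta> \<omega> \<partial>M) = 0"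
proof -
  interpret complete_measure M by fact
  have X: "stopped B \<eta> t \<in> borel_measurable M" if "0 \<le> t" for t
    by (rule measurable_from_subalg[OF subalgebra_natural_filtration stopped_adapted[OF \<eta> that]])
  have lim: "AE \<omega> in M. (\<lambda>n. stopped B \<eta> (real n) \<omega>) \<longlonglongrightarrow> terminal \<eta> \<omega>"
    using fin by eventually_elim (intro tendsto_eventually stopped_eventually_terminal)
  have L: "(\<lambda>\<omega>. lim (\<lambda>n. stopped B \<eta> (real n) \<omega>)) \<in> borel_measurable M"
    using X by (intro borel_measurable_lim_metric) auto
  show T: "terminal \<eta> \<in> borel_measurable M"
  proof (rule measurableI)
    fix A :: "real set" assume A: "A \<in> sets borel"
    show "terminal \<eta> -` A \<inter> space M \<in> sets M"
    proof (rule in_sets_AE[OF _ measurable_sets[OF L A]])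
      show "AE \<omega> in M. \<omega> \<in> (\<lambda>\<omega>. lim (\<lambda>n. stopped B \<eta> (real n) \<omega>)) -` A \<inter> space M \<longleftrightarrow> \<omega> \<in> terminal \<eta> -` A \<inter> space M"
        using lim by eventually_elim (simp add: limI)
    qed simp
  qed simp
  show "AE \<omega> in M. \<bar>terminal \<eta> \<omega>\<bar> \<le> K"
    using lim AE_space
  proof eventually_elim
    case (elim \<omega>)
    from tendsto_rabs[OF elim(1)] show ?case by (rule LIMSEQ_le_const2) (use K elim in auto)
  qed
  have "(\<lambda>n. \<integral>\<omega>. stopped B \<eta> (real n) \<omega> \<partial>M) \<longlonglongrightarrow> (\<integral>\<omega>. terminal \<eta> \<omega> \<partial>M)"
    by (rule integral_dominated_convergence[where w = "\<lambda>_. K"]) (use lim K X T in auto)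
  moreover have "(\<integral>\<omega>. stopped B \<eta> (real n) \<omega> \<partial>M) = 0" for n
  proof (cases "n = 0")
    case True
    then show ?thesis by (simp add: stopped_0 cong: Bochner_Integration.integral_cong)
  next
    case False
    have "space M \<in> sets (natural_filtration M B 0)"
      using sets.top[of "natural_filtration M B 0"] by simp
    from stopped_increment[OF \<eta> order_refl _ this K, of "real n"] False
    have "(\<integral>\<omega>. indicator (space M) \<omega> * (stopped B \<eta> (real n) \<omega> - stopped B \<eta> 0 \<omega>) \<partial>M) = 0" by simp
    moreover have "(\<integral>\<omega>. indicator (space M) \<omega> * (stopped B \<eta> (real n) \<omega> - stopped B \<eta> 0 \<omega>) \<partial>M) = (\<integral>\<omega>. stopped B \<eta> (real n) \<omega> \<partial>M)"
      by (intro Bochner_Integration.integral_cong) (simp_all add: stopped_0)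
    ultimately show ?thesis by simp
  qed
  ultimately show "(\<integral>\<omega>. terminal \<eta> \<omega> \<partial>M) = 0" by (simp add: LIMSEQ_const_iff)
qed

end


section \<open>Hitting times\<close>

text \<open>If the level is never reached, the infimum over the empty set is infinity.\<close>

definition hit :: "(real \<Rightarrow> 'a \<Rightarrow> real) \<Rightarrow> real \<Rightarrow> 'a \<Rightarrow> ennreal" where
  "hit B x \<omega> = (INF t\<in>{t. 0 \<le> t \<and> B t \<omega> = x}. ennreal t)"

text \<open>The time \<open>u\<close> restricted to the event \<open>u < d\<close>. The value
  infinity elsewhere lets a minimum with a later time take over.\<close>

definition restrict_time :: "('a \<Rightarrow> ennreal) \<Rightarrow> ('a \<Rightarrow> ennreal) \<Rightarrow> 'a \<Rightarrow> ennreal" where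
  "restrict_time u d \<omega> = (if u \<omega> < d \<omega> then u \<omega> else \<infinity>)"

lemma pred_bex_countable:
  assumes "countable I" "\<And>q. q \<in> I \<Longrightarrow> Measurable.pred N (P q)"
  shows "Measurable.pred N (\<lambda>\<omega>. \<exists>q\<in>I. P q \<omega>)"
  unfolding pred_def by (rule sets.sets_Collect_countable_Ex'[OF assms(2)[unfolded pred_def] assms(1)])

context standard_brownian_motion
begin

text \<open>By path continuity the times at which the level is attained form a closed set, which
  contains its infimum. The interval reaches to \<open>t + 1\<close> because the infimum might be
  approached from above \<open>t\<close>.\<close>

lemma hit_le_iff:
  assumes \<omega>: "\<omega> \<in> space M" and t: "0 \<le> t"
  shows "hit B x \<omega> \<le> ennreal t \<longleftrightarrow> (\<exists>s\<in>{0..t}. B s \<omega> = x)"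
proof
  assume "\<exists>s\<in>{0..t}. B s \<omega> = x"
  then obtain s where "0 \<le> s" "s \<le> t" "B s \<omega> = x" by auto
  then show "hit B x \<omega> \<le> ennreal t" unfolding hit_def by (intro INF_lower2[of s]) (auto intro: ennreal_leI)
next
  assume h: "hit B x \<omega> \<le> ennreal t"
  define S where "S = {s \<in> {0..t + 1}. B s \<omega> = x}"
  have "S = {0..t + 1} \<inter> (\<lambda>s. B s \<omega>) -` {x}" by (auto simp: S_def)
  moreover have "continuous_on {0..t + 1} (\<lambda>s. B s \<omega>)"
    by (rule continuous_on_subset[OF continuous_paths[OF \<omega>]]) auto
  ultimately have "closed S" using continuous_closed_preimage[of "{0..t+1}" "\<lambda>s. B s \<omega>" "{x}"] by simp
  have near: "\<exists>s\<in>S. s < t + e" if "0 < e" "e \<le> 1" for e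
  proof -
    have "hit B x \<omega> < ennreal (t + e)" using h that t by (auto intro: le_less_trans simp: ennreal_less_iff)
    then obtain s where "0 \<le> s" "B s \<omega> = x" "ennreal s < ennreal (t + e)"
      unfolding hit_def INF_less_iff by auto
    then show ?thesis using that by (intro bexI[of _ s]) (auto simp: S_def ennreal_less_iff)
  qed
  have ne: "S \<noteq> {}" and bd: "bdd_below S" using near[of 1] by (auto simp: S_def)
  have "Inf S \<in> S" by (rule closed_contains_Inf[OF ne bd \<open>closed S\<close>])
  moreover have "Inf S \<le> t"
  proof (rule field_le_epsilon)
    fix e :: real assume "0 < e"
    then obtain s where "s \<in> S" "s < t + min e 1" using near[of "min e 1"] by auto
    then show "Inf S \<le> t + e" using cInf_lower[OF _ bd, of s] by auto
  qed
  ultimately show "\<exists>s\<in>{0..t}. B s \<omega> = x" by (auto simp: S_def)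
qed

lemma hit_attained:
  assumes \<omega>: "\<omega> \<in> space M" and h: "hit B x \<omega> = ennreal t" "0 \<le> t" shows "B t \<omega> = x"
proof -
  obtain s where s: "0 \<le> s" "s \<le> t" "B s \<omega> = x"
    using hit_le_iff[OF \<omega> h(2), of x] h by auto
  then have "hit B x \<omega> \<le> ennreal s" unfolding hit_def by (intro INF_lower) auto
  then have "t \<le> s" using h s by (simp add: ennreal_le_iff)
  then show ?thesis using s by auto
qed

lemma hit_le_pos:
  assumes \<omega>: "\<omega> \<in> space M" and x: "0 \<le> x" and s: "0 \<le> s" "x \<le> B s \<omega>"
  shows "hit B x \<omega> \<le> ennreal s"
proof -
  have "\<exists>r\<ge>0. r \<le> s \<and> B r \<omega> = x"
    using s x start[OF \<omega>] continuous_on_subset[OF continuous_paths[OF \<omega>], of "{0..s}"] by (intro IVT') auto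
  then show ?thesis using hit_le_iff[OF \<omega> s(1)] by auto
qed

lemma hit_le_neg:
  assumes \<omega>: "\<omega> \<in> space M" and x: "x \<le> 0" and s: "0 \<le> s" "B s \<omega> \<le> x"
  shows "hit B x \<omega> \<le> ennreal s"
proof -
  have "\<exists>r\<ge>0. r \<le> s \<and> B r \<omega> = x"
    using s x start[OF \<omega>] continuous_on_subset[OF continuous_paths[OF \<omega>], of "{0..s}"] by (intro IVT2') auto
  then show ?thesis using hit_le_iff[OF \<omega> s(1)] by auto
qed

lemma before_hit_pos:
  assumes \<omega>: "\<omega> \<in> space M" and x: "0 \<le> x" and s: "0 \<le> s" "ennreal s \<le> hit B x \<omega>"
  shows "B s \<omega> \<le> x"
proof (rule ccontr)
  assume "\<not> B s \<omega> \<le> x"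
  then have "hit B x \<omega> = ennreal s" using hit_le_pos[OF \<omega> x s(1)] s(2) by (intro antisym) auto
  then show False using hit_attained[OF \<omega> _ s(1)] \<open>\<not> B s \<omega> \<le> x\<close> by auto
qed

lemma before_hit_neg:
  assumes \<omega>: "\<omega> \<in> space M" and x: "x \<le> 0" and s: "0 \<le> s" "ennreal s \<le> hit B x \<omega>"
  shows "x \<le> B s \<omega>"
proof (rule ccontr)
  assume "\<not> x \<le> B s \<omega>"
  then have "hit B x \<omega> = ennreal s" using hit_le_neg[OF \<omega> x s(1)] s(2) by (intro antisym) auto
  then show False using hit_attained[OF \<omega> _ s(1)] \<open>\<not> x \<le> B s \<omega>\<close> by auto
qed

lemma hit_mono_pos:
  assumes \<omega>: "\<omega> \<in> space M" and "0 \<le> x" "x \<le> y" shows "hit B x \<omega> \<le> hit B y \<omega>"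
  unfolding hit_def[of B y] by (intro INF_greatest) (use assms hit_le_pos[OF \<omega>] in auto)

lemma hit_mono_neg:
  assumes \<omega>: "\<omega> \<in> space M" and "x \<le> 0" "y \<le> x" shows "hit B x \<omega> \<le> hit B y \<omega>"
  unfolding hit_def[of B y] by (intro INF_greatest) (use assms hit_le_neg[OF \<omega>] in auto)

text \<open>By compactness a level is attained on \<open>{0..t}\<close> exactly if the path comes
  arbitrarily close to it at rational times or at \<open>t\<close>. This involves countably many
  times, none of them later than \<open>t\<close>.\<close>

lemma ext_stopping_time_hit: "ext_stopping_time (natural_filtration M B) (hit B x)"
  unfolding ext_stopping_time_def
proof (intro allI impI)
  fix t :: real assume t: "0 \<le> t"
  let ?F = "natural_filtration M B t"
  have B: "B q \<in> borel_measurable ?F" if "q \<in> insert t (\<rat> \<inter> {0..t})" for q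
    using that t by (intro natural_filtration_measurable) auto
  have "(\<exists>s\<in>{0..t}. B s \<omega> = x) \<longleftrightarrow> (\<forall>n. \<exists>q\<in>insert t (\<rat> \<inter> {0..t}). \<bar>B q \<omega> - x\<bar> < 1 / real (Suc n))"
    if \<omega>: "\<omega> \<in> space M" for \<omega>
  proof
    assume "\<exists>s\<in>{0..t}. B s \<omega> = x"
    then obtain s where s: "0 \<le> s" "s \<le> t" "B s \<omega> = x" by auto
    show "\<forall>n. \<exists>q\<in>insert t (\<rat> \<inter> {0..t}). \<bar>B q \<omega> - x\<bar> < 1 / real (Suc n)"
    proof
      fix n
      obtain d where d: "0 < d" "\<And>r. 0 \<le> r \<Longrightarrow> \<bar>r - s\<bar> < d \<Longrightarrow> \<bar>B r \<omega> - B s \<omega>\<bar> < 1 / real (Suc n)"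
      proof -
        have "s \<in> {0..}" "0 < 1 / real (Suc n)" using s by auto
        from continuous_paths[OF \<omega>, unfolded continuous_on_iff, rule_format, OF this] that
        show ?thesis unfolding dist_real_def by (auto simp del: of_nat_Suc)
      qed
      show "\<exists>q\<in>insert t (\<rat> \<inter> {0..t}). \<bar>B q \<omega> - x\<bar> < 1 / real (Suc n)"
      proof (cases "s = t")
        case True then show ?thesis using s by (intro bexI[of _ t]) auto
      next
        case False
        then obtain q where q: "q \<in> \<rat>" "s < q" "q < min t (s + d)"
          using Rats_dense_in_real[of s "min t (s + d)"] d s by auto
        then show ?thesis using d(2)[of q] s by (intro bexI[of _ q]) auto
      qed
    qed
  next
    assume *: "\<forall>n. \<exists>q\<in>insert t (\<rat> \<inter> {0..t}). \<bar>B q \<omega> - x\<bar> < 1 / real (Suc n)"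
    have "continuous_on {0..t} (\<lambda>s. \<bar>B s \<omega> - x\<bar>)"
      by (intro continuous_intros continuous_on_subset[OF continuous_paths[OF \<omega>]]) auto
    then obtain s where s: "s \<in> {0..t}" "\<And>r. r \<in> {0..t} \<Longrightarrow> \<bar>B s \<omega> - x\<bar> \<le> \<bar>B r \<omega> - x\<bar>"
      using continuous_attains_inf[of "{0..t}" "\<lambda>s. \<bar>B s \<omega> - x\<bar>"] t by auto
    have "\<bar>B s \<omega> - x\<bar> \<le> 1 / real (Suc n)" for n
    proof -
      obtain q where "q \<in> insert t (\<rat> \<inter> {0..t})" "\<bar>B q \<omega> - x\<bar> < 1 / real (Suc n)" using * by blast
      then show ?thesis using s(2)[of q] t by auto
    qed
    moreover have "(\<lambda>n. 1 / real (Suc n)) \<longlonglongrightarrow> 0" using LIMSEQ_Suc[OF lim_const_over_n[of 1]] .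
    ultimately have "\<bar>B s \<omega> - x\<bar> \<le> 0" by (intro LIMSEQ_le_const[where X = "\<lambda>n. 1 / real (Suc n)"]) blast+
    then have "B s \<omega> = x" by simp
    with s(1) show "\<exists>s\<in>{0..t}. B s \<omega> = x" by blast
  qed
  moreover have "Measurable.pred ?F (\<lambda>\<omega>. \<forall>n. \<exists>q\<in>insert t (\<rat> \<inter> {0..t}). \<bar>B q \<omega> - x\<bar> < 1 / real (Suc n))"
  proof (rule pred_intros_countable(1), rule pred_bex_countable)
    show "countable (insert t (\<rat> \<inter> {0..t}))" by (intro countable_insert countable_Int1 countable_rat)
    fix n q assume "q \<in> insert t (\<rat> \<inter> {0..t})"
    note [measurable] = B[OF this]
    show "Measurable.pred ?F (\<lambda>\<omega>. \<bar>B q \<omega> - x\<bar> < 1 / real (Suc n))" by measurable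
  qed
  ultimately show "Measurable.pred ?F (\<lambda>\<omega>. hit B x \<omega> \<le> ennreal t)"
    by (subst measurable_cong[where g = "\<lambda>\<omega>. \<forall>n. \<exists>q\<in>insert t (\<rat> \<inter> {0..t}). \<bar>B q \<omega> - x\<bar> < 1 / real (Suc n)"])
       (auto simp: hit_le_iff t)
qed

lemma ext_stopping_time_min:
  assumes "ext_stopping_time F \<eta>" "ext_stopping_time F \<eta>'"
  shows "ext_stopping_time F (\<lambda>\<omega>. min (\<eta> \<omega>) (\<eta>' \<omega>))"
  using assms unfolding ext_stopping_time_def min_le_iff_disj by (intro allI impI pred_intros_logic) auto

text \<open>If \<open>u < d <= t\<close>, a rational time separates the two; if \<open>d\<close> is
  after \<open>t\<close>, then \<open>t\<close> itself does. So the event is a countable union of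
  events known at time \<open>t\<close>.\<close>

lemma ext_stopping_time_restrict:
  assumes u: "ext_stopping_time (natural_filtration M B) u" and d: "ext_stopping_time (natural_filtration M B) d"
  shows "ext_stopping_time (natural_filtration M B) (restrict_time u d)"
  unfolding ext_stopping_time_def
proof (intro allI impI)
  fix t :: real assume t: "0 \<le> t"
  let ?F = "natural_filtration M B t"
  have sub: "Measurable.pred ?F P" if "Measurable.pred (natural_filtration M B q) P" "q \<in> insert t (\<rat> \<inter> {0..t})" for P q
  proof -
    have "q \<le> t" using that(2) by auto
    then show ?thesis using that(1) natural_filtration_mono[of q t M B] unfolding pred_def by auto
  qed
  have *: "Measurable.pred ?F (\<lambda>\<omega>. u \<omega> \<le> ennreal q)" "Measurable.pred ?F (\<lambda>\<omega>. d \<omega> \<le> ennreal q)"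
    if q: "q \<in> insert t (\<rat> \<inter> {0..t})" for q
  proof -
    have "0 \<le> q" using q t by auto
    then have m: "Measurable.pred (natural_filtration M B q) (\<lambda>\<omega>. u \<omega> \<le> ennreal q)"
      "Measurable.pred (natural_filtration M B q) (\<lambda>\<omega>. d \<omega> \<le> ennreal q)"
      using u d unfolding ext_stopping_time_def by simp_all
    show "Measurable.pred ?F (\<lambda>\<omega>. u \<omega> \<le> ennreal q)" by (rule sub[OF m(1) q])
    show "Measurable.pred ?F (\<lambda>\<omega>. d \<omega> \<le> ennreal q)" by (rule sub[OF m(2) q])
  qed
  have "restrict_time u d \<omega> \<le> ennreal t \<longleftrightarrow> (\<exists>q\<in>insert t (\<rat> \<inter> {0..t}). u \<omega> \<le> ennreal q \<and> \<not> d \<omega> \<le> ennreal q)" for \<omega>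
  proof
    assume "restrict_time u d \<omega> \<le> ennreal t"
    then have ud: "u \<omega> < d \<omega>" "u \<omega> \<le> ennreal t" by (auto simp: restrict_time_def top_unique split: if_splits)
    show "\<exists>q\<in>insert t (\<rat> \<inter> {0..t}). u \<omega> \<le> ennreal q \<and> \<not> d \<omega> \<le> ennreal q"
    proof (cases "d \<omega> \<le> ennreal t")
      case False then show ?thesis using ud by blast
    next
      case True
      then obtain d' where d': "d \<omega> = ennreal d'" "0 \<le> d'" by (cases "d \<omega>") (auto simp: top_unique)
      obtain u' where u': "u \<omega> = ennreal u'" "0 \<le> u'" using ud(2) by (cases "u \<omega>") (auto simp: top_unique)
      have "u' < d'" using ud d' u' by (simp add: ennreal_less_iff)
      then obtain q where q: "q \<in> \<rat>" "u' < q" "q < d'" using Rats_dense_in_real by blast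
      have "d' \<le> t" using True d' t by (simp add: ennreal_le_iff)
      then have "q \<in> \<rat> \<inter> {0..t}" using q u' by auto
      moreover have "u \<omega> \<le> ennreal q" "\<not> d \<omega> \<le> ennreal q"
        using q u' d' by (auto simp: ennreal_le_iff)
      ultimately show ?thesis by blast
    qed
  next
    assume "\<exists>q\<in>insert t (\<rat> \<inter> {0..t}). u \<omega> \<le> ennreal q \<and> \<not> d \<omega> \<le> ennreal q"
    then obtain q where q: "q \<in> insert t (\<rat> \<inter> {0..t})" "u \<omega> \<le> ennreal q" "\<not> d \<omega> \<le> ennreal q" by blast
    have "ennreal q \<le> ennreal t" using q(1) by (intro ennreal_leI) auto
    with q show "restrict_time u d \<omega> \<le> ennreal t"
      by (auto simp: restrict_time_def not_le intro: order_trans dest: le_less_trans)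
  qed
  moreover have "Measurable.pred ?F (\<lambda>\<omega>. \<exists>q\<in>insert t (\<rat> \<inter> {0..t}). u \<omega> \<le> ennreal q \<and> \<not> d \<omega> \<le> ennreal q)"
  proof (rule pred_bex_countable)
    show "countable (insert t (\<rat> \<inter> {0..t}))" by (intro countable_insert countable_Int1 countable_rat)
    fix q assume "q \<in> insert t (\<rat> \<inter> {0..t})"
    from *[OF this] show "Measurable.pred ?F (\<lambda>\<omega>. u \<omega> \<le> ennreal q \<and> \<not> d \<omega> \<le> ennreal q)"
      by (intro pred_intros_logic)
  qed
  ultimately show "Measurable.pred ?F (\<lambda>\<omega>. restrict_time u d \<omega> \<le> ennreal t)" by simp
qed

section \<open>Almost sure exit from bounded intervals\<close>

text \<open>The density of the path at time \<open>n\<close> is at most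
  \<open>1 / sqrt (2 * pi * n)\<close>, so the probability of lying in a fixed interval tends to 0
  along the integers. Staying there forever is less likely still.\<close>

lemma AE_exits_interval: "AE \<omega> in M. \<not> (\<forall>t\<ge>0. \<bar>B t \<omega>\<bar> \<le> K)"
proof -
  have bound: "prob {\<omega> \<in> space M. \<bar>B (real (Suc n)) \<omega>\<bar> \<le> K} \<le> 2 * \<bar>K\<bar> / sqrt (2 * pi * real (Suc n))" for n
  proof -
    let ?t = "real (Suc n)"
    have d: "distributed M lborel (\<lambda>\<omega>. B ?t \<omega> - B 0 \<omega>) (normal_density 0 (sqrt ?t))"
      using normal_increments[of 0 ?t] by simp
    have "emeasure M ((\<lambda>\<omega>. B ?t \<omega> - B 0 \<omega>) -` {-\<bar>K\<bar>..\<bar>K\<bar>} \<inter> space M) =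
        (\<integral>\<^sup>+ x. ennreal (normal_density 0 (sqrt ?t) x) * indicator {-\<bar>K\<bar>..\<bar>K\<bar>} x \<partial>lborel)"
      by (rule distributed_emeasure[OF d]) simp
    also have "\<dots> \<le> (\<integral>\<^sup>+ x. ennreal (1 / sqrt (2 * pi * ?t)) * indicator {-\<bar>K\<bar>..\<bar>K\<bar>} x \<partial>lborel)"
    proof (rule nn_integral_mono)
      fix x
      have "normal_density 0 (sqrt ?t) x = 1 / sqrt (2 * pi * ?t) * exp (- x\<^sup>2 / (2 * ?t))"
        by (simp add: normal_density_def del: of_nat_Suc)
      also have "\<dots> \<le> 1 / sqrt (2 * pi * ?t) * 1"
        by (intro mult_left_mono) (auto simp: divide_nonneg_pos)
      finally have "ennreal (normal_density 0 (sqrt ?t) x) \<le> ennreal (1 / sqrt (2 * pi * ?t))"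
        by (intro ennreal_leI) simp
      then show "ennreal (normal_density 0 (sqrt ?t) x) * indicator {-\<bar>K\<bar>..\<bar>K\<bar>} x \<le>
          ennreal (1 / sqrt (2 * pi * ?t)) * indicator {-\<bar>K\<bar>..\<bar>K\<bar>} x"
        by (rule mult_right_mono) simp
    qed
    also have "\<dots> = ennreal (1 / sqrt (2 * pi * ?t)) * ennreal (2 * \<bar>K\<bar>)"
      by (subst nn_integral_cmult_indicator) auto
    also have "\<dots> = ennreal (2 * \<bar>K\<bar> / sqrt (2 * pi * ?t))" by (simp flip: ennreal_mult del: of_nat_Suc)
    finally have e: "emeasure M ((\<lambda>\<omega>. B ?t \<omega> - B 0 \<omega>) -` {-\<bar>K\<bar>..\<bar>K\<bar>} \<inter> space M) \<le> ennreal (2 * \<bar>K\<bar> / sqrt (2 * pi * ?t))" .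
    have "prob {\<omega> \<in> space M. \<bar>B ?t \<omega>\<bar> \<le> K} \<le> prob ((\<lambda>\<omega>. B ?t \<omega> - B 0 \<omega>) -` {-\<bar>K\<bar>..\<bar>K\<bar>} \<inter> space M)"
      using random_variable_B[of ?t] random_variable_B[of 0] by (intro finite_measure_mono) (auto simp: start simp del: of_nat_Suc)
    also have "\<dots> \<le> 2 * \<bar>K\<bar> / sqrt (2 * pi * ?t)"
      using e unfolding emeasure_eq_measure by (subst (asm) ennreal_le_iff) (auto simp del: of_nat_Suc)
    finally show ?thesis .
  qed
  define E where "E = {\<omega> \<in> space M. \<forall>n. \<bar>B (real (Suc n)) \<omega>\<bar> \<le> K}"
  have E: "E \<in> events"
  proof -
    have [measurable]: "B (real (Suc n)) \<in> borel_measurable M" for n by (rule random_variable_B) simp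
    show ?thesis unfolding E_def by measurable
  qed
  have "prob E \<le> 2 * \<bar>K\<bar> / sqrt (2 * pi * real (Suc n))" for n
  proof -
    have "prob E \<le> prob {\<omega> \<in> space M. \<bar>B (real (Suc n)) \<omega>\<bar> \<le> K}"
    proof (rule finite_measure_mono)
      have [measurable]: "B (real (Suc n)) \<in> borel_measurable M" by (rule random_variable_B) simp
      show "{\<omega> \<in> space M. \<bar>B (real (Suc n)) \<omega>\<bar> \<le> K} \<in> events" by measurable
      show "E \<subseteq> {\<omega> \<in> space M. \<bar>B (real (Suc n)) \<omega>\<bar> \<le> K}" unfolding E_def by blast
    qed
    with bound[of n] show ?thesis by linarith
  qed
  moreover have "(\<lambda>n. 2 * \<bar>K\<bar> / sqrt (2 * pi * real (Suc n))) \<longlonglongrightarrow> 0" by real_asymp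
  ultimately have "prob E \<le> 0" by (intro LIMSEQ_le_const) auto
  then have "E \<in> null_sets M" using E by (simp add: null_sets_def emeasure_eq_measure measure_le_0_iff)
  then have "AE \<omega> in M. \<omega> \<notin> E" by (rule AE_not_in)
  then show ?thesis
    using AE_space
  proof eventually_elim
    case (elim \<omega>)
    show ?case
    proof
      assume "\<forall>t\<ge>0. \<bar>B t \<omega>\<bar> \<le> K"
      then have "\<bar>B (real (Suc n)) \<omega>\<bar> \<le> K" for n by (simp del: of_nat_Suc)
      with elim show False unfolding E_def by simp
    qed
  qed
qed

end


section \<open>Sharpness\<close>

context standard_brownian_motion
begin

section \<open>The stages\<close>

definition exit_time :: "real \<Rightarrow> real \<Rightarrow> nat \<Rightarrow> 'a \<Rightarrow> ennreal" where
  "exit_time a q k \<omega> = min (hit B (- (q ^ k)) \<omega>) (hit B (a * q ^ k) \<omega>)"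

text \<open>Stage \<open>k\<close> ends when the path leaves \<open>(- (q ^ k), a * q ^ k)\<close>. After an exit at the upper end
  nothing changes any more, after an exit at the lower end the next stage begins.\<close>

primrec stage_time :: "real \<Rightarrow> real \<Rightarrow> nat \<Rightarrow> 'a \<Rightarrow> ennreal" where
  "stage_time a q 0 = exit_time a q 0"
| "stage_time a q (Suc k) =
     (\<lambda>\<omega>. min (restrict_time (stage_time a q k) (hit B (- (q ^ k))) \<omega>) (exit_time a q (Suc k) \<omega>))"

lemma ext_stopping_time_exit: "ext_stopping_time (natural_filtration M B) (exit_time a q k)"
  unfolding exit_time_def[abs_def] by (intro ext_stopping_time_min ext_stopping_time_hit)

lemma ext_stopping_time_stage: "ext_stopping_time (natural_filtration M B) (stage_time a q k)"
proof (induction k)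
  case 0
  then show ?case by (simp add: ext_stopping_time_exit)
next
  case (Suc k)
  then show ?case unfolding stage_time.simps
    by (intro ext_stopping_time_min ext_stopping_time_exit ext_stopping_time_restrict ext_stopping_time_hit)
qed

lemma stage_le_exit: "stage_time a q k \<omega> \<le> exit_time a q k \<omega>"
  by (cases k) auto

context
  fixes a q :: real
  assumes a: "0 < a" and q: "1 < q"
begin

definition all_exit :: "'a \<Rightarrow> bool" where
  "all_exit \<omega> \<longleftrightarrow> (\<forall>k. exit_time a q k \<omega> \<noteq> \<infinity>)"

lemma AE_all_exit: "AE \<omega> in M. all_exit \<omega>"
  unfolding all_exit_def AE_all_countable
proof
  fix k
  show "AE \<omega> in M. exit_time a q k \<omega> \<noteq> \<infinity>"
    using AE_exits_interval[of "max (q ^ k) (a * q ^ k)"] AE_space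
  proof eventually_elim
    case (elim \<omega>)
    show ?case
    proof
      assume "exit_time a q k \<omega> = \<infinity>"
      then have inf: "hit B (- (q ^ k)) \<omega> = \<infinity>" "hit B (a * q ^ k) \<omega> = \<infinity>"
        by (auto simp: exit_time_def min_def top_unique split: if_splits)
      have "\<bar>B t \<omega>\<bar> \<le> max (q ^ k) (a * q ^ k)" if "0 \<le> t" for t
        using before_hit_pos[OF elim(2), of "a * q ^ k" t] before_hit_neg[OF elim(2), of "- (q ^ k)" t]
          that inf a q by auto
      with elim(1) show False by blast
    qed
  qed
qed

lemma exit_mono: "\<omega> \<in> space M \<Longrightarrow> exit_time a q k \<omega> \<le> exit_time a q (Suc k) \<omega>"
  unfolding exit_time_def using a q by (intro min.mono hit_mono_neg hit_mono_pos) auto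

text \<open>A stage never outlasts the exit from its own interval, so neither end has been crossed
  before.\<close>

lemma stopped_stage_bound:
  assumes \<omega>: "\<omega> \<in> space M" and t: "0 \<le> t"
  shows "\<bar>stopped B (stage_time a q k) t \<omega>\<bar> \<le> max (q ^ k) (a * q ^ k)"
proof -
  define s where "s = enn2real (min (stage_time a q k \<omega>) (ennreal t))"
  have s: "ennreal s = min (stage_time a q k \<omega>) (ennreal t)"
    unfolding s_def by (intro ennreal_enn2real) (simp add: min_less_iff_disj)
  have "ennreal s \<le> exit_time a q k \<omega>" unfolding s using stage_le_exit[of a q k \<omega>] by (meson min.coboundedI1)
  then have "ennreal s \<le> hit B (- (q ^ k)) \<omega>" "ennreal s \<le> hit B (a * q ^ k) \<omega>" by (auto simp: exit_time_def)
  moreover have "0 \<le> s" by (simp add: s_def)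
  ultimately have "- (q ^ k) \<le> B s \<omega>" "B s \<omega> \<le> a * q ^ k"
    using before_hit_pos[OF \<omega>, of "a * q ^ k" s] before_hit_neg[OF \<omega>, of "- (q ^ k)" s] a q by auto
  then show ?thesis by (auto simp: stopped_def s_def)
qed

lemma exit_cases:
  assumes \<omega>: "\<omega> \<in> space M" "all_exit \<omega>"
  obtains (down) "exit_time a q k \<omega> = hit B (- (q ^ k)) \<omega>" "terminal (exit_time a q k) \<omega> = - (q ^ k)"
  | (up) "exit_time a q k \<omega> < hit B (- (q ^ k)) \<omega>" "terminal (exit_time a q k) \<omega> = a * q ^ k"
      "\<And>s. 0 \<le> s \<Longrightarrow> ennreal s \<le> exit_time a q k \<omega> \<Longrightarrow> - (q ^ k) \<le> B s \<omega>"
proof -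
  obtain r where r: "exit_time a q k \<omega> = ennreal r" "0 \<le> r"
    using \<omega>(2) by (cases "exit_time a q k \<omega>") (auto simp: all_exit_def)
  show thesis
  proof (cases "hit B (- (q ^ k)) \<omega> \<le> hit B (a * q ^ k) \<omega>")
    case True
    then have e: "exit_time a q k \<omega> = hit B (- (q ^ k)) \<omega>" by (simp add: exit_time_def min_absorb1)
    then have "B r \<omega> = - (q ^ k)" using hit_attained[OF \<omega>(1), of "- (q ^ k)" r] r by simp
    then show thesis using r e by (intro down) (auto simp: terminal_def)
  next
    case False
    then have e: "exit_time a q k \<omega> = hit B (a * q ^ k) \<omega>" by (simp add: exit_time_def min_absorb2)
    then have "B r \<omega> = a * q ^ k" using hit_attained[OF \<omega>(1), of "a * q ^ k" r] r by simp
    then have t: "terminal (exit_time a q k) \<omega> = a * q ^ k" using r by (simp add: terminal_def)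
    have lt: "exit_time a q k \<omega> < hit B (- (q ^ k)) \<omega>" using False e by simp
    show thesis
    proof (rule up[OF lt t])
      fix s :: real assume s: "0 \<le> s" "ennreal s \<le> exit_time a q k \<omega>"
      show "- (q ^ k) \<le> B s \<omega>"
        using q s lt by (intro before_hit_neg[OF \<omega>(1)]) auto
    qed
  qed
qed

lemma terminal_cong: "\<eta> \<omega> = \<eta>' \<omega> \<Longrightarrow> terminal \<eta> \<omega> = terminal \<eta>' \<omega>"
  by (simp add: terminal_def)

definition down :: "nat \<Rightarrow> 'a \<Rightarrow> bool" where
  "down k \<omega> \<longleftrightarrow> stage_time a q k \<omega> = hit B (- (q ^ k)) \<omega> \<and> terminal (stage_time a q k) \<omega> = - (q ^ k)"

text \<open>An upper exit at stage \<open>j\<close> has value \<open>a * q ^ j\<close>, and the path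
  has stayed above \<open>- (q ^ j)\<close>. Dividing the value by \<open>a\<close> recovers this
  bound without remembering \<open>j\<close>. The first clause makes \<open>restrict_time\<close>
  keep the time at the next stage.\<close>

definition up :: "nat \<Rightarrow> 'a \<Rightarrow> bool" where
  "up k \<omega> \<longleftrightarrow> stage_time a q k \<omega> < hit B (- (q ^ k)) \<omega> \<and> 0 < terminal (stage_time a q k) \<omega> \<and>
     (\<forall>s\<ge>0. ennreal s \<le> stage_time a q k \<omega> \<longrightarrow> - terminal (stage_time a q k) \<omega> / a \<le> B s \<omega>)"

lemma stage_0:
  assumes \<omega>: "\<omega> \<in> space M" "all_exit \<omega>"
  shows "down 0 \<omega> \<or> up 0 \<omega> \<and> terminal (stage_time a q 0) \<omega> = a"
proof (cases rule: exit_cases[OF \<omega>, of 0])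
  case 1
  then show ?thesis by (simp add: down_def)
next
  case 2
  then show ?thesis using a by (simp add: up_def)
qed

text \<open>\<open>restrict_time\<close> returns the old time, and the exit from the larger interval
  cannot come earlier, so the minimum is the old time.\<close>

lemma stage_Suc_up:
  assumes \<omega>: "\<omega> \<in> space M" and u: "up k \<omega>"
  shows "up (Suc k) \<omega>" "terminal (stage_time a q (Suc k)) \<omega> = terminal (stage_time a q k) \<omega>"
proof -
  have "stage_time a q k \<omega> \<le> exit_time a q (Suc k) \<omega>"
    using stage_le_exit[of a q k \<omega>] exit_mono[OF \<omega>, of k] by (rule order_trans)
  then have e: "stage_time a q (Suc k) \<omega> = stage_time a q k \<omega>"
    using u by (simp add: up_def restrict_time_def min_absorb1)
  then show t: "terminal (stage_time a q (Suc k)) \<omega> = terminal (stage_time a q k) \<omega>" by (rule terminal_cong)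
  have "hit B (- (q ^ k)) \<omega> \<le> hit B (- (q ^ Suc k)) \<omega>"
    using q by (intro hit_mono_neg[OF \<omega>]) auto
  then show "up (Suc k) \<omega>" using u unfolding up_def t e by (auto intro: less_le_trans)
qed

text \<open>The old time coincides with the lower hit, so \<open>restrict_time\<close> is infinite
  and the minimum is the next exit time.\<close>

lemma stage_Suc_down:
  assumes \<omega>: "\<omega> \<in> space M" "all_exit \<omega>" and d: "down k \<omega>"
  shows "down (Suc k) \<omega> \<or> up (Suc k) \<omega> \<and> terminal (stage_time a q (Suc k)) \<omega> = a * q ^ Suc k"
proof -
  have e: "stage_time a q (Suc k) \<omega> = exit_time a q (Suc k) \<omega>"
    using d by (simp add: down_def restrict_time_def min_absorb2)
  then have t: "terminal (stage_time a q (Suc k)) \<omega> = terminal (exit_time a q (Suc k)) \<omega>" by (rule terminal_cong)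
  show ?thesis
  proof (cases rule: exit_cases[OF \<omega>, of "Suc k"])
    case 1
    then show ?thesis unfolding down_def t e by simp
  next
    case 2
    have "0 < a * q ^ Suc k" using a q by simp
    moreover have "- (a * q ^ Suc k) / a = - (q ^ Suc k)" using a by simp
    ultimately show ?thesis using 2 unfolding up_def t e by simp
  qed
qed

lemma down_or_up: "\<omega> \<in> space M \<Longrightarrow> all_exit \<omega> \<Longrightarrow> down k \<omega> \<or> up k \<omega>"
  by (induction k) (use stage_0 stage_Suc_up stage_Suc_down in blast)+

lemma down_neg: "down k \<omega> \<Longrightarrow> terminal (stage_time a q k) \<omega> < 0"
  using q by (simp add: down_def)

lemma up_pos: "up k \<omega> \<Longrightarrow> 0 < terminal (stage_time a q k) \<omega>"
  by (simp add: up_def)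

text \<open>The bound depends on the terminal value alone and holds for all times at once, so its
  moment can be computed from the exit probabilities.\<close>

lemma infimum_stopped_bound:
  assumes \<omega>: "\<omega> \<in> space M" "all_exit \<omega>" and t: "0 \<le> t"
  shows "\<bar>infimum_process (stopped B (stage_time a q k)) t \<omega>\<bar> \<le>
    (if terminal (stage_time a q k) \<omega> < 0 then - terminal (stage_time a q k) \<omega> else terminal (stage_time a q k) \<omega> / a)"
    (is "_ \<le> ?m")
proof -
  have m: "0 \<le> ?m" using a by auto
  have "- ?m \<le> stopped B (stage_time a q k) r \<omega>" if r: "0 \<le> r" for r
  proof -
    define s where "s = enn2real (min (stage_time a q k \<omega>) (ennreal r))"
    have s: "ennreal s = min (stage_time a q k \<omega>) (ennreal r)" "0 \<le> s"
      unfolding s_def by (intro ennreal_enn2real) (auto simp: min_less_iff_disj)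
    have le: "ennreal s \<le> stage_time a q k \<omega>" unfolding s by simp
    have "- ?m \<le> B s \<omega>"
    proof (cases "down k \<omega>")
      case True
      then have "- (q ^ k) \<le> B s \<omega>"
        using before_hit_neg[OF \<omega>(1), of "- (q ^ k)" s] s(2) le q by (simp add: down_def)
      then show ?thesis using True down_neg[OF True] by (simp add: down_def)
    next
      case False
      then have u: "up k \<omega>" using down_or_up[OF \<omega>] by blast
      then show ?thesis using s(2) le up_pos[OF u] by (auto simp: up_def)
    qed
    then show ?thesis by (simp add: stopped_def s_def)
  qed
  then have "- ?m \<le> (INF s\<in>{0..t}. stopped B (stage_time a q k) s \<omega>)"
    using t by (intro cINF_greatest) auto
  then show ?thesis using m unfolding infimum_process_def by (auto simp: min_def)
qed

section \<open>Moments at the end of a stage\<close>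

text \<open>Every identity is the integral of a pointwise relation that holds where all exits
  happen. The mean 0 of the terminal values yields the probabilities \<open>Q\<close> of ending at
  the lower level, and \<open>Q k - Q (Suc k)\<close> is the probability of leaving through the
  upper end at stage \<open>Suc k\<close>.\<close>

lemma stage_integrals:
  assumes M: "complete_measure M" and p: "0 < p"
  defines "x \<equiv> \<lambda>k. terminal (stage_time a q k)"
  defines "Q \<equiv> \<lambda>k. prob {\<omega> \<in> space M. x k \<omega> < 0}"
  defines "R \<equiv> \<lambda>k. \<integral>\<omega>. max (x k \<omega>) 0 powr p \<partial>M"
  shows "x k \<in> borel_measurable M" "AE \<omega> in M. \<bar>x k \<omega>\<bar> \<le> max (q ^ k) (a * q ^ k)"
    and "(1 + a) * Q 0 = a" "R 0 = a powr p * (1 - Q 0)"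
    and "(1 + a * q) * Q k = (1 + a) * q * Q (Suc k)"
    and "R (Suc k) = R k + (a * q ^ Suc k) powr p * (Q k - Q (Suc k))"
    and "(\<integral>\<omega>. \<bar>x k \<omega>\<bar> powr p \<partial>M) = R k + (q ^ k) powr p * Q k"
    and "(\<integral>\<omega>. (if x k \<omega> < 0 then - x k \<omega> else x k \<omega> / a) powr p \<partial>M) = R k / a powr p + (q ^ k) powr p * Q k"
    and "integrable M (\<lambda>\<omega>. (if x k \<omega> < 0 then - x k \<omega> else x k \<omega> / a) powr p)"
proof -
  have fin: "AE \<omega> in M. stage_time a q k \<omega> \<noteq> \<infinity>" for k
    using AE_all_exit
  proof eventually_elim
    case (elim \<omega>)
    then have "exit_time a q k \<omega> < \<infinity>" by (simp add: all_exit_def less_top)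
    then show ?case using stage_le_exit[of a q k \<omega>] by (auto dest: le_less_trans)
  qed
  note T = terminal_facts[OF ext_stopping_time_stage stopped_stage_bound fin M, folded x_def]
  have xM: "x k \<in> borel_measurable M" for k unfolding x_def by (rule T(1)[unfolded x_def]) auto
  have xb: "AE \<omega> in M. \<bar>x k \<omega>\<bar> \<le> max (q ^ k) (a * q ^ k)" for k unfolding x_def by (rule T(2)[unfolded x_def]) auto
  have x0: "(\<integral>\<omega>. x k \<omega> \<partial>M) = 0" for k unfolding x_def by (rule T(3)[unfolded x_def]) auto
  show "x k \<in> borel_measurable M" "AE \<omega> in M. \<bar>x k \<omega>\<bar> \<le> max (q ^ k) (a * q ^ k)" by (rule xM, rule xb)
  note [measurable] = xM
  define N where "N k = {\<omega> \<in> space M. x k \<omega> < 0}" for k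
  have N[measurable]: "N k \<in> events" for k unfolding N_def by measurable
  have iN: "integrable M (indicator (N k) :: 'a \<Rightarrow> real)" "(\<integral>\<omega>. indicator (N k) \<omega> \<partial>M) = Q k" for k
    using N[of k] by (auto simp: Q_def N_def emeasure_eq_measure)
  have ix: "integrable M (x k)" for k
    using xb by (intro integrable_const_bound[where B = "max (q ^ k) (a * q ^ k)"]) auto
  have iR: "integrable M (\<lambda>\<omega>. max (x k \<omega>) 0 powr p)" for k
  proof (rule integrable_const_bound[where B = "max (q ^ k) (a * q ^ k) powr p"])
    show "AE \<omega> in M. norm (max (x k \<omega>) 0 powr p) \<le> max (q ^ k) (a * q ^ k) powr p"
      using xb[of k] by eventually_elim (use p in \<open>auto intro!: powr_mono2\<close>)
  qed measurable
  have pt0: "AE \<omega> in M. x 0 \<omega> = a - (1 + a) * indicator (N 0) \<omega> \<and>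
      max (x 0 \<omega>) 0 powr p = a powr p * (1 - indicator (N 0) \<omega>)"
    using AE_all_exit AE_space
  proof eventually_elim
    case (elim \<omega>)
    from stage_0[OF elim(2,1)] show ?case
    proof
      assume "down 0 \<omega>"
      then show ?thesis using elim(2) by (simp add: down_def x_def N_def)
    next
      assume "up 0 \<omega> \<and> terminal (stage_time a q 0) \<omega> = a"
      then show ?thesis using a by (simp add: x_def N_def)
    qed
  qed
  \<comment> \<open>From the lower end \<open>- (q ^ k)\<close> the value moves to the new upper
    end, corrected to the new lower end on \<open>N (Suc k)\<close>. After an upper exit nothing
    moves and both indicators are 0.\<close>
  have ptS: "AE \<omega> in M. x (Suc k) \<omega> = x k \<omega> + (q ^ k + a * q ^ Suc k) * indicator (N k) \<omega> - (1 + a) * q ^ Suc k * indicator (N (Suc k)) \<omega> \<and>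
      max (x (Suc k) \<omega>) 0 powr p = max (x k \<omega>) 0 powr p + (a * q ^ Suc k) powr p * (indicator (N k) \<omega> - indicator (N (Suc k)) \<omega>)" for k
    using AE_all_exit AE_space
  proof eventually_elim
    case (elim \<omega>)
    from down_or_up[OF elim(2,1)] show ?case
    proof
      assume u: "up k \<omega>"
      have "x (Suc k) \<omega> = x k \<omega>" "0 < x k \<omega>"
        using stage_Suc_up(2)[OF elim(2) u] up_pos[OF u] by (auto simp: x_def)
      then show ?thesis by (simp add: N_def)
    next
      assume d: "down k \<omega>"
      have xk: "x k \<omega> = - (q ^ k)" "\<omega> \<in> N k"
        using d down_neg[OF d] elim(2) by (auto simp: down_def x_def N_def)
      have mk: "max (x k \<omega>) 0 = 0" using xk q by simp
      from stage_Suc_down[OF elim(2,1) d] show ?thesis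
      proof
        assume d': "down (Suc k) \<omega>"
        have x': "x (Suc k) \<omega> = - (q ^ Suc k)" "\<omega> \<in> N (Suc k)"
          using d' down_neg[OF d'] elim(2) by (auto simp: down_def x_def N_def)
        have "max (x (Suc k) \<omega>) 0 = 0" using x' q by simp
        then show ?thesis using x' xk mk by (simp add: algebra_simps)
      next
        assume u': "up (Suc k) \<omega> \<and> terminal (stage_time a q (Suc k)) \<omega> = a * q ^ Suc k"
        then have x': "x (Suc k) \<omega> = a * q ^ Suc k" by (simp add: x_def)
        have pos: "0 < a * q ^ Suc k" using a q by simp
        have "\<omega> \<notin> N (Suc k)" using x' pos by (simp add: N_def)
        then show ?thesis using x' xk mk pos by (simp add: algebra_simps max_absorb1)
      qed
    qed
  qed
  have "(\<integral>\<omega>. x 0 \<omega> \<partial>M) = (\<integral>\<omega>. a - (1 + a) * indicator (N 0) \<omega> \<partial>M)"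
    using pt0 by (intro integral_cong_AE) auto
  then show "(1 + a) * Q 0 = a" using x0[of 0] iN by (simp add: prob_space)
  have "R 0 = (\<integral>\<omega>. a powr p * (1 - indicator (N 0) \<omega>) \<partial>M)"
    unfolding R_def using pt0 by (intro integral_cong_AE) auto
  then show "R 0 = a powr p * (1 - Q 0)" using iN by (simp add: prob_space)
  have "(\<integral>\<omega>. x (Suc k) \<omega> \<partial>M) = (\<integral>\<omega>. x k \<omega> + (q ^ k + a * q ^ Suc k) * indicator (N k) \<omega> - (1 + a) * q ^ Suc k * indicator (N (Suc k)) \<omega> \<partial>M)"
    using ptS[of k] by (intro integral_cong_AE) auto
  also have "\<dots> = (q ^ k + a * q ^ Suc k) * Q k - (1 + a) * q ^ Suc k * Q (Suc k)"
    using ix[of k] iN x0[of k] by simp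
  finally have "q ^ k * ((1 + a * q) * Q k) = q ^ k * ((1 + a) * q * Q (Suc k))"
    using x0[of "Suc k"] by (simp add: algebra_simps)
  then show "(1 + a * q) * Q k = (1 + a) * q * Q (Suc k)" using q by simp
  have "R (Suc k) = (\<integral>\<omega>. max (x k \<omega>) 0 powr p + (a * q ^ Suc k) powr p * (indicator (N k) \<omega> - indicator (N (Suc k)) \<omega>) \<partial>M)"
    unfolding R_def using ptS[of k] by (intro integral_cong_AE) auto
  then show "R (Suc k) = R k + (a * q ^ Suc k) powr p * (Q k - Q (Suc k))"
    using iR[of k] iN by (simp add: R_def)
  have ptN: "AE \<omega> in M. \<bar>x k \<omega>\<bar> powr p = max (x k \<omega>) 0 powr p + (q ^ k) powr p * indicator (N k) \<omega> \<and>
     (if x k \<omega> < 0 then - x k \<omega> else x k \<omega> / a) powr p = max (x k \<omega>) 0 powr p / a powr p + (q ^ k) powr p * indicator (N k) \<omega>"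
    using AE_all_exit AE_space
  proof eventually_elim
    case (elim \<omega>)
    from down_or_up[OF elim(2,1)] show ?case
    proof
      assume u: "up k \<omega>"
      then have "0 < x k \<omega>" by (auto simp: x_def up_def)
      then show ?thesis using a by (simp add: N_def powr_divide)
    next
      assume d: "down k \<omega>"
      have xk: "x k \<omega> = - (q ^ k)" "\<omega> \<in> N k"
        using d down_neg[OF d] elim(2) by (auto simp: down_def x_def N_def)
      moreover have "0 < q ^ k" using q by simp
      ultimately show ?thesis by (simp add: max_absorb2)
    qed
  qed
  have "(\<integral>\<omega>. \<bar>x k \<omega>\<bar> powr p \<partial>M) = (\<integral>\<omega>. max (x k \<omega>) 0 powr p + (q ^ k) powr p * indicator (N k) \<omega> \<partial>M)"
    using ptN by (intro integral_cong_AE) auto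
  then show "(\<integral>\<omega>. \<bar>x k \<omega>\<bar> powr p \<partial>M) = R k + (q ^ k) powr p * Q k"
    using iR[of k] iN by (simp add: R_def)
  have "(\<integral>\<omega>. (if x k \<omega> < 0 then - x k \<omega> else x k \<omega> / a) powr p \<partial>M) =
      (\<integral>\<omega>. max (x k \<omega>) 0 powr p / a powr p + (q ^ k) powr p * indicator (N k) \<omega> \<partial>M)"
    using ptN by (intro integral_cong_AE) auto
  then show "(\<integral>\<omega>. (if x k \<omega> < 0 then - x k \<omega> else x k \<omega> / a) powr p \<partial>M) = R k / a powr p + (q ^ k) powr p * Q k"
    using iR[of k] iN by (simp add: R_def)
  have "integrable M (\<lambda>\<omega>. max (x k \<omega>) 0 powr p / a powr p + (q ^ k) powr p * indicator (N k) \<omega>)"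
    using iR[of k] iN by simp
  then show "integrable M (\<lambda>\<omega>. (if x k \<omega> < 0 then - x k \<omega> else x k \<omega> / a) powr p)"
    by (rule integrable_cong_AE_imp) (use ptN in auto)
qed

end

end

section \<open>Failure of every smaller constant\<close>

text \<open>The difference \<open>\<Phi> n\<close> of the two sides grows at stage \<open>n\<close>
  by \<open>\<beta> * (w ^ n * Q n)\<close>. Here \<open>\<beta>\<close> is positive by assumption
  and \<open>w ^ n * Q n\<close> does not decrease, so the growth is at least linear.\<close>

lemma geometric_recursion_exceeds:
  fixes a q w d :: real and Q r :: "nat \<Rightarrow> real"
  assumes a: "0 < a" and q: "1 < q" and w: "0 < w" "q * (a + 1) < w * (a * q + 1)"
    and pos: "0 < (a' - d) * (w * (q - 1)) + (1 - d) * (w * (a * q + 1) - q * (a + 1))"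
    and Q0: "0 < Q 0" and Q: "\<And>k. (1 + a * q) * Q k = (1 + a) * q * Q (Suc k)"
    and r: "\<And>k. r (Suc k) = r k + w ^ Suc k * (Q k - Q (Suc k))"
  shows "\<exists>n. d * (r n + w ^ n * Q n) < a' * r n + w ^ n * Q n"
proof -
  define \<beta> where "\<beta> = ((a' - d) * (w * (q - 1)) + (1 - d) * (w * (a * q + 1) - q * (a + 1))) / (q * (a + 1))"
  have qa: "0 < q * (a + 1)" using a q by simp
  have \<beta>: "0 < \<beta>" unfolding \<beta>_def using pos qa by simp
  define \<Phi> where "\<Phi> n = (a' - d) * r n + (1 - d) * (w ^ n * Q n)" for n
  have Qpos: "0 < Q n" for n
  proof (induction n)
    case (Suc n)
    have "0 < (1 + a * q) * Q n" using Suc a q by (simp add: add_pos_pos)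
    then have "0 < ((1 + a) * q) * Q (Suc n)" using Q[of n] by simp
    moreover have "0 < (1 + a) * q" using a q by simp
    ultimately show ?case by (rule zero_less_mult_pos)
  qed (rule Q0)
  have QS: "Q (Suc n) = (1 + a * q) / (q * (a + 1)) * Q n" for n
    using Q[of n] qa by (simp add: field_simps)
  have wQ: "Q 0 \<le> w ^ n * Q n" for n
  proof (induction n)
    case (Suc n)
    have "w ^ n * Q n \<le> (w * (a * q + 1) / (q * (a + 1))) * (w ^ n * Q n)"
    proof -
      have "1 \<le> w * (a * q + 1) / (q * (a + 1))" using w(2) qa by simp
      moreover have "0 \<le> w ^ n * Q n" using Qpos[of n] w(1) by simp
      ultimately show ?thesis using mult_right_mono[of 1 "w * (a * q + 1) / (q * (a + 1))" "w ^ n * Q n"] by simp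
    qed
    also have "\<dots> = w ^ Suc n * Q (Suc n)" unfolding QS by (simp add: algebra_simps)
    finally show ?case using Suc by simp
  qed simp
  have step: "\<Phi> (Suc n) = \<Phi> n + \<beta> * (w ^ n * Q n)" for n
  proof -
    define y where "y = w ^ n * Q n"
    have 1: "w ^ Suc n * Q n = w * y" by (simp add: y_def)
    have 2: "w ^ Suc n * Q (Suc n) = w * ((1 + a * q) / (q * (a + 1))) * y"
      unfolding QS by (simp add: y_def)
    have "\<Phi> (Suc n) - \<Phi> n = (a' - d) * (w * y - w * ((1 + a * q) / (q * (a + 1))) * y)
        + (1 - d) * (w * ((1 + a * q) / (q * (a + 1))) * y - y)"
      unfolding \<Phi>_def r right_diff_distrib[of "w ^ Suc n"] 1 2 y_def[symmetric] by (simp add: algebra_simps)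
    also have "\<dots> = \<beta> * y"
    proof -
      define z where "z = q * (a + 1)"
      have z: "z \<noteq> 0" using qa unfolding z_def by (rule less_imp_neq[symmetric])
      have "(a' - d) * (w * y - w * ((1 + a * q) / z) * y) + (1 - d) * (w * ((1 + a * q) / z) * y - y)
         = ((a' - d) * (w * (z - (1 + a * q))) + (1 - d) * (w * (1 + a * q) - z)) / z * y"
        using z by (simp add: field_simps)
      moreover have "z - (1 + a * q) = q - 1" by (simp add: z_def algebra_simps)
      ultimately show ?thesis unfolding \<beta>_def z_def by (simp add: add.commute)
    qed
    finally show ?thesis by (simp add: y_def)
  qed
  have lower: "\<Phi> 0 + real n * (\<beta> * Q 0) \<le> \<Phi> n" for n
  proof (induction n)
    case (Suc n)
    have "\<beta> * Q 0 \<le> \<beta> * (w ^ n * Q n)" using \<beta> wQ by (intro mult_left_mono) auto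
    then show ?case using Suc step[of n] by (simp add: algebra_simps)
  qed simp
  have "0 < \<beta> * Q 0" using \<beta> Q0 by simp
  then obtain n :: nat where "- \<Phi> 0 < real n * (\<beta> * Q 0)" using reals_Archimedean3 by blast
  then have "0 < \<Phi> n" using lower[of n] by linarith
  then show ?thesis by (intro exI[of _ n]) (simp add: \<Phi>_def algebra_simps)
qed

text \<open>Used to refute the norm inequality. The supremum over time on the right is replaced by
  the moment of one bound \<open>m\<close>, the one on the left by the bounded limit along integer
  times.\<close>

lemma (in prob_space) terminal_moment_le:
  assumes p: "0 < p" and c: "0 \<le> c"
    and X: "\<And>n::nat. X (real n) \<in> borel_measurable M" "\<And>n \<omega>. \<omega> \<in> space M \<Longrightarrow> \<bar>X (real n) \<omega>\<bar> \<le> K"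
    and x: "x \<in> borel_measurable M" "AE \<omega> in M. eventually (\<lambda>n. X (real n) \<omega> = x \<omega>) sequentially"
    and m: "integrable M (\<lambda>\<omega>. m \<omega> powr p)" "AE \<omega> in M. \<forall>t\<ge>0. \<bar>infimum_process X t \<omega>\<bar> \<le> m \<omega>"
    and le: "process_norm M p X \<le> ennreal c * process_norm M p (infimum_process X)"
  shows "(\<integral>\<omega>. \<bar>x \<omega>\<bar> powr p \<partial>M) \<le> c powr p * (\<integral>\<omega>. m \<omega> powr p \<partial>M)"
proof -
  define N where "N = (\<integral>\<omega>. m \<omega> powr p \<partial>M)"
  have N: "0 \<le> N" unfolding N_def by (intro integral_nonneg_AE) simp
  have "process_norm M p (infimum_process X) \<le> ennreal (N powr (1 / p))"
    unfolding process_norm_def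
  proof (rule SUP_least)
    fix t :: real assume t: "t \<in> {0..}"
    have "(\<integral>\<^sup>+ \<omega>. ennreal (\<bar>infimum_process X t \<omega>\<bar> powr p) \<partial>M) \<le> (\<integral>\<^sup>+ \<omega>. ennreal (m \<omega> powr p) \<partial>M)"
    proof (rule nn_integral_mono_AE)
      show "AE \<omega> in M. ennreal (\<bar>infimum_process X t \<omega>\<bar> powr p) \<le> ennreal (m \<omega> powr p)"
        using m(2) by eventually_elim (use t p in \<open>auto intro!: ennreal_leI powr_mono2\<close>)
    qed
    also have "\<dots> = ennreal N" unfolding N_def by (rule nn_integral_eq_integral[OF m(1)]) simp
    finally have "ennreal_powr (\<integral>\<^sup>+ \<omega>. ennreal (\<bar>infimum_process X t \<omega>\<bar> powr p) \<partial>M) (1 / p) \<le> ennreal_powr (ennreal N) (1 / p)"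
      by (rule ennreal_powr_mono) (use p in simp)
    then show "ennreal_powr (\<integral>\<^sup>+ \<omega>. ennreal (\<bar>infimum_process X t \<omega>\<bar> powr p) \<partial>M) (1 / p) \<le> ennreal (N powr (1 / p))"
      using N by (simp add: ennreal_powr_def)
  qed
  then have "ennreal c * process_norm M p (infimum_process X) \<le> ennreal c * ennreal (N powr (1 / p))"
    by (rule mult_left_mono) simp
  with le have norm: "process_norm M p X \<le> ennreal (c * N powr (1 / p))"
    using c by (simp add: ennreal_mult')
  have iX: "integrable M (\<lambda>\<omega>. \<bar>X (real n) \<omega>\<bar> powr p)" for n
  proof (rule integrable_const_bound[where B = "K powr p"])
    show "AE \<omega> in M. norm (\<bar>X (real n) \<omega>\<bar> powr p) \<le> K powr p"
      by (rule AE_I2) (use X(2) p in \<open>auto intro!: powr_mono2\<close>)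
    show "(\<lambda>\<omega>. \<bar>X (real n) \<omega>\<bar> powr p) \<in> borel_measurable M" using X(1)[of n] by measurable
  qed
  have bound: "(\<integral>\<omega>. \<bar>X (real n) \<omega>\<bar> powr p \<partial>M) \<le> c powr p * N" for n
  proof -
    define y where "y = (\<integral>\<omega>. \<bar>X (real n) \<omega>\<bar> powr p \<partial>M)"
    have y: "0 \<le> y" unfolding y_def by (intro integral_nonneg_AE) simp
    have "(\<integral>\<^sup>+ \<omega>. ennreal (\<bar>X (real n) \<omega>\<bar> powr p) \<partial>M) = ennreal y"
      unfolding y_def by (rule nn_integral_eq_integral[OF iX]) simp
    then have "ennreal (y powr (1 / p)) = ennreal_powr (\<integral>\<^sup>+ \<omega>. ennreal (\<bar>X (real n) \<omega>\<bar> powr p) \<partial>M) (1 / p)"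
      using y by (simp add: ennreal_powr_def)
    also have "\<dots> \<le> process_norm M p X"
      unfolding process_norm_def by (rule SUP_upper) simp
    also note norm
    finally have "y powr (1 / p) \<le> c * N powr (1 / p)" using c by (simp add: ennreal_le_iff)
    then have "(y powr (1 / p)) powr p \<le> (c * N powr (1 / p)) powr p"
      using p by (intro powr_mono2) auto
    then show ?thesis using y N c p unfolding y_def[symmetric] by (simp add: powr_powr powr_mult)
  qed
  have "(\<lambda>n. \<integral>\<omega>. \<bar>X (real n) \<omega>\<bar> powr p \<partial>M) \<longlonglongrightarrow> (\<integral>\<omega>. \<bar>x \<omega>\<bar> powr p \<partial>M)"
  proof (rule integral_dominated_convergence[where w = "\<lambda>_. K powr p"])
    show "AE \<omega> in M. (\<lambda>n. \<bar>X (real n) \<omega>\<bar> powr p) \<longlonglongrightarrow> \<bar>x \<omega>\<bar> powr p"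
      using x(2)
    proof eventually_elim
      case (elim \<omega>)
      have "eventually (\<lambda>n. \<bar>X (real n) \<omega>\<bar> powr p = \<bar>x \<omega>\<bar> powr p) sequentially"
        by (rule eventually_mono[OF elim]) simp
      then show ?case by (rule tendsto_eventually)
    qed
    show "AE \<omega> in M. norm (\<bar>X (real n) \<omega>\<bar> powr p) \<le> K powr p" for n
      by (rule AE_I2) (use X(2) p in \<open>auto intro!: powr_mono2\<close>)
    show "(\<lambda>\<omega>. \<bar>X (real n) \<omega>\<bar> powr p) \<in> borel_measurable M" for n using X(1)[of n] by measurable
    show "(\<lambda>\<omega>. \<bar>x \<omega>\<bar> powr p) \<in> borel_measurable M" using x(1) by measurable
  qed simp
  then show ?thesis unfolding N_def[symmetric] by (rule LIMSEQ_le_const2) (use bound in auto)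
qed

lemma (in standard_brownian_motion) stopped_exceeds:
  assumes M: "complete_measure M" and p: "0 < p" "p < 1" and c: "0 \<le> c" "c < C_const p"
  obtains \<eta> K where "ext_stopping_time (natural_filtration M B) \<eta>"
    "\<And>t \<omega>. 0 \<le> t \<Longrightarrow> \<omega> \<in> space M \<Longrightarrow> \<bar>stopped B \<eta> t \<omega>\<bar> \<le> K"
    "\<not> process_norm M p (stopped B \<eta>) \<le> ennreal c * process_norm M p (infimum_process (stopped B \<eta>))"
proof -
  obtain a where a: "0 < a" "1 < p * (a + 1)" "c powr p < 1 + (a powr p - 1) / (p * (a + 1))"
    using extremal_parameter[OF p c] by blast
  obtain q where q: "1 < q" "q * (a + 1) < q powr p * (a * q + 1)"
    "0 < (a powr p - c powr p) * (q powr p * (q - 1)) + (1 - c powr p) * (q powr p * (a * q + 1) - q * (a + 1))"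
    using extremal_ratio[OF p a] by blast
  define x where "x k = terminal (stage_time a q k)" for k
  define Q where "Q k = prob {\<omega> \<in> space M. x k \<omega> < 0}" for k
  define R where "R k = (\<integral>\<omega>. max (x k \<omega>) 0 powr p \<partial>M)" for k
  note S = stage_integrals[OF a(1) q(1) M p(1), folded x_def, folded Q_def R_def]
  have pw: "(q ^ k) powr p = (q powr p) ^ k" for k
    using q(1) by (simp add: powr_powr mult.commute flip: powr_realpow)
  \<comment> \<open>The recursion runs on \<open>R n / a powr p\<close>, the contribution of upper
    exits to the bound on the infimum; \<open>a powr p\<close> times it is their contribution to the
    moment of the value.\<close>
  have "\<exists>n. c powr p * (R n / a powr p + (q powr p) ^ n * Q n) < a powr p * (R n / a powr p) + (q powr p) ^ n * Q n"
  proof (rule geometric_recursion_exceeds[OF a(1) q(1) _ q(2,3)])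
    show "0 < Q 0" using S(3) a(1) by (smt (verit) zero_less_mult_iff)
    show "(1 + a * q) * Q k = (1 + a) * q * Q (Suc k)" for k by (rule S(5))
    show "R (Suc k) / a powr p = R k / a powr p + (q powr p) ^ Suc k * (Q k - Q (Suc k))" for k
      unfolding S(6)[of k] pw[symmetric] using a(1) q(1) by (simp add: powr_mult add_divide_distrib)
  qed (use q in simp)
  then obtain n where n: "c powr p * (R n / a powr p + (q powr p) ^ n * Q n) < R n + (q powr p) ^ n * Q n"
    using a(1) by auto
  show thesis
  proof (rule that[of "stage_time a q n" "max (q ^ n) (a * q ^ n)"])
    show "ext_stopping_time (natural_filtration M B) (stage_time a q n)" by (rule ext_stopping_time_stage)
    show b: "\<bar>stopped B (stage_time a q n) t \<omega>\<bar> \<le> max (q ^ n) (a * q ^ n)" if "0 \<le> t" "\<omega> \<in> space M" for t \<omega>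
      by (rule stopped_stage_bound[OF a(1) q(1) that(2,1)])
    show "\<not> process_norm M p (stopped B (stage_time a q n)) \<le> ennreal c * process_norm M p (infimum_process (stopped B (stage_time a q n)))"
    proof
      assume le: "process_norm M p (stopped B (stage_time a q n)) \<le> ennreal c * process_norm M p (infimum_process (stopped B (stage_time a q n)))"
      have "(\<integral>\<omega>. \<bar>x n \<omega>\<bar> powr p \<partial>M) \<le> c powr p * (\<integral>\<omega>. (if x n \<omega> < 0 then - x n \<omega> else x n \<omega> / a) powr p \<partial>M)"
      proof (rule terminal_moment_le[OF p(1) c(1) _ b _ _ S(9) _ le])
        show "stopped B (stage_time a q n) (real k) \<in> borel_measurable M" for k :: nat
          by (rule measurable_from_subalg[OF subalgebra_natural_filtration stopped_adapted[OF ext_stopping_time_stage]]) simp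
        show "AE \<omega> in M. \<forall>\<^sub>F k in sequentially. stopped B (stage_time a q n) (real k) \<omega> = x n \<omega>"
          unfolding x_def using AE_all_exit[OF a(1) q(1)]
        proof eventually_elim
          case (elim \<omega>)
          then have "exit_time a q n \<omega> < \<infinity>" by (simp add: all_exit_def[OF a(1) q(1)] less_top)
          then have "stage_time a q n \<omega> < \<infinity>" using stage_le_exit[of a q n \<omega>] by (rule le_less_trans[rotated])
          then show ?case by (intro stopped_eventually_terminal) simp
        qed
        show "AE \<omega> in M. \<forall>t\<ge>0. \<bar>infimum_process (stopped B (stage_time a q n)) t \<omega>\<bar>
            \<le> (if x n \<omega> < 0 then - x n \<omega> else x n \<omega> / a)"
          unfolding x_def using AE_all_exit[OF a(1) q(1)] AE_space
        proof eventually_elim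
          case (elim \<omega>)
          then show ?case using infimum_stopped_bound[OF a(1) q(1)] by blast
        qed
      qed (assumption | rule S(1) of_nat_0_le_iff)+
      then show False using n unfolding S(7,8) pw by simp
    qed
  qed
qed

section \<open>The inequality and its sharpness\<close>

theorem theorem1p3:
  fixes p :: real
  assumes "0 < p" and "p < 1"
  shows "(\<forall>(M :: 'a measure) F X. supermartingale_nonneg_jumps M F X \<longrightarrow>
            process_norm M p X \<le> ennreal (C_const p) * process_norm M p (infimum_process X))
       \<and> (\<forall>c<C_const p. \<exists>(M :: (nat \<Rightarrow> real) measure) F X. supermartingale_nonneg_jumps M F X \<and>
            \<not> process_norm M p X \<le> ennreal c * process_norm M p (infimum_process X))
       \<and> (\<forall>c<C_const p. \<exists>(M :: (nat \<Rightarrow> real) measure) X. stopped_brownian_motion M X \<and>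
            \<not> process_norm M p X \<le> ennreal c * process_norm M p (infimum_process X))"
proof -
  obtain a where a: "0 < a" "0 < C_const p" "C_const p powr p = (1 - p) * a powr (p - 1) * (a + 1)"
    "1 \<le> (1 - p) * a powr p - p * a powr (p - 1)"
    using bellman_parameter[OF assms] by blast
  have upper: "process_norm M p X \<le> ennreal (C_const p) * process_norm M p (infimum_process X)"
    if X: "supermartingale_nonneg_jumps M F X" for M :: "'a measure" and F X
  proof -
    interpret complete_filtered_prob_space M F
      using X unfolding supermartingale_nonneg_jumps_def by (elim conjE)
    show ?thesis by (rule process_norm_le_infimum_process[OF assms a(1,4,2,3) X])
  qed
  interpret standard_brownian_motion gauss_space wiener by (rule standard_brownian_motion_wiener)
  \<comment> \<open>One witness serves for both sharpness claims: a bounded stopped Brownian motion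
    is itself a supermartingale whose jumps are all 0.\<close>
  have sharp: "\<exists>X. supermartingale_nonneg_jumps gauss_space (natural_filtration gauss_space wiener) X \<and>
      stopped_brownian_motion gauss_space X \<and>
      \<not> process_norm gauss_space p X \<le> ennreal c * process_norm gauss_space p (infimum_process X)"
    if c: "c < C_const p" for c
  proof -
    \<comment> \<open>For negative \<open>c\<close> the coefficient \<open>ennreal c\<close> is 0,
      so \<open>c\<close> may be replaced by \<open>max c 0\<close>, still below the
      constant.\<close>
    have c': "0 \<le> max c 0" "max c 0 < C_const p" "ennreal c = ennreal (max c 0)"
      using c a(2) by (auto simp: max_def ennreal_neg)
    obtain \<eta> K where \<eta>: "ext_stopping_time (natural_filtration gauss_space wiener) \<eta>"
      "\<And>t \<omega>. 0 \<le> t \<Longrightarrow> \<omega> \<in> space gauss_space \<Longrightarrow> \<bar>stopped wiener \<eta> t \<omega>\<bar> \<le> K"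
      "\<not> process_norm gauss_space p (stopped wiener \<eta>) \<le>
        ennreal (max c 0) * process_norm gauss_space p (infimum_process (stopped wiener \<eta>))"
      using stopped_exceeds[OF complete_gauss_space assms c'(1,2)] by blast
    have "supermartingale_nonneg_jumps gauss_space (natural_filtration gauss_space wiener) (stopped wiener \<eta>)"
      by (rule stopped_supermartingale[OF complete_gauss_space \<eta>(1,2)])
    moreover have "stopped_brownian_motion gauss_space (stopped wiener \<eta>)"
      unfolding stopped_brownian_motion_def
      by (intro conjI exI[of _ wiener] exI[of _ \<eta>] complete_gauss_space standard_brownian_motion_wiener \<eta>(1) refl)
    moreover have "\<not> process_norm gauss_space p (stopped wiener \<eta>) \<le>
        ennreal c * process_norm gauss_space p (infimum_process (stopped wiener \<eta>))"
      unfolding c'(3) by (rule \<eta>(3))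
    ultimately show ?thesis by (intro exI[of _ "stopped wiener \<eta>"] conjI)
  qed
  show ?thesis
  proof (intro conjI allI impI)
    fix c assume "c < C_const p"
    from sharp[OF this] obtain X where X:
      "supermartingale_nonneg_jumps gauss_space (natural_filtration gauss_space wiener) X"
      "stopped_brownian_motion gauss_space X"
      "\<not> process_norm gauss_space p X \<le> ennreal c * process_norm gauss_space p (infimum_process X)"
      by (elim exE conjE)
    from X(1,3) show "\<exists>(M :: (nat \<Rightarrow> real) measure) F X. supermartingale_nonneg_jumps M F X \<and>
        \<not> process_norm M p X \<le> ennreal c * process_norm M p (infimum_process X)" by (intro exI conjI)
    from X(2,3) show "\<exists>(M :: (nat \<Rightarrow> real) measure) X. stopped_brownian_motion M X \<and>
        \<not> process_norm M p X \<le> ennreal c * process_norm M p (infimum_process X)" by (intro exI conjI)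
  qed (rule upper)
qed

end
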